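(* Let $\Omega=(-1,1)^2$ and let $\Phi(x,t)=\phi(t)+a(x)\psi(t)$ be as in the context. Suppose that $$\int_0\phi\Big(\frac1r\Big)\,r\,dr<\infty\qquad\text{and}\qquad\int_0\psi^*\Big(\frac1r\Big)\,r\,dr<\infty .$$ Then $H^{1,\Phi(\cdot)}(\Omega)\neq W^{1,\Phi(\cdot)}(\Omega)$ and $H_0^{1,\Phi(\cdot)}(\Omega)\ne W_0^{1,\Phi(\cdot)}(\Omega)$. Moreover, there exists a vector field $b\in L^{\Phi^*(\cdot)}(\Omega)$ (with values in $\mathbb{R}^2$) such that for $$\mathcal{G}(u)=\int_\Omega\Phi(x,|\nabla u|)\,dx+\int_\Omega b\cdot\nabla u\,dx$$ there is a Lavrentiev gap: $$\inf\mathcal{G}\big(W_0^{1,\Phi(\cdot)}(\Omega)\big)<\inf\mathcal{G}\big(H_0^{1,\Phi(\cdot)}(\Omega)\big).$$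
   Context: $\Omega=(-1,1)^2\subset\mathbb{R}^2$. The weight is $a(x)=1$ if $|x_1|<|x_2|$ and $a(x)=0$ if $|x_1|>|x_2|$. An Orlicz function is a convex, left-continuous $\phi:[0,\infty)\to[0,\infty]$ with $\phi(0)=0$, $\lim_{t\to0}\phi(t)=0$, $\lim_{t\to\infty}\phi(t)=\infty$; its conjugate is $\phi^*(s)=\sup_{t\ge0}(st-\phi(t))$. It satisfies $\Delta_2$ if $\phi(2t)\le c\,\phi(t)$ for all $t\ge0$, and $\nabla_2$ if $\phi^*$ satisfies $\Delta_2$. Standing assumptions: $\phi,\psi$ are Orlicz functions satisfying $\Delta_2$ and $\nabla_2$, with $t^{p_-}\le\phi(t)\le c_1t^{p_+}+c_2$ and $t^{p_-}\le\psi(t)\le c_1t^{p_+}+c_2$ for all $t\ge 0$, where $1<p_-<p_+<\infty$, $c_1>0$; $\phi\le c_3\psi+c_4$ for some constants $c_3,c_4$; and $\phi(t)/\psi(t)\to0$ as $t\to\infty$. Put $\Phi(x,t)=\phi(t)+a(x)\psi(t)$, $\Phi^*(x,\cdot)=(\Phi(x,\cdot))^*$. The notation $\int_0 f(r)\,dr$ means $\int_0^\delta f(r)\,dr$ for a small $\delta>0$ (only convergence or divergence at $0$ matters). The norm is $\|f\|_{L^{\Phi(\cdot)}(\Omega)}=\inf\{\gamma>0:\int_\Omega\Phi(x,|f(x)/\gamma|)\,dx\le1\}$, and $L^{\Phi(\cdot)}(\Omega)$ is the space of measurable (scalar or vector valued) $f$ with finite norm (likewise for $\Phi^*$). $W^{1,\Phi(\cdot)}(\Omega)=\{w\in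 W^{1,1}(\Omega):\nabla w\in L^{\Phi(\cdot)}(\Omega)\}$ with norm $\|w\|_{L^1(\Omega)}+\|\nabla w\|_{L^{\Phi(\cdot)}(\Omega)}$; $H^{1,\Phi(\cdot)}(\Omega)$ is the closure of $C^\infty(\Omega)\cap W^{1,\Phi(\cdot)}(\Omega)$ in $W^{1,\Phi(\cdot)}(\Omega)$. $W_0^{1,\Phi(\cdot)}(\Omega)=\{w\in W_0^{1,1}(\Omega):\nabla w\in L^{\Phi(\cdot)}(\Omega)\}$ with norm $\|\nabla w\|_{L^{\Phi(\cdot)}(\Omega)}$; $H_0^{1,\Phi(\cdot)}(\Omega)$ is the closure of $C_0^\infty(\Omega)$ in $W_0^{1,\Phi(\cdot)}(\Omega)$. *)

theory Defs
  imports "HOL-Analysis.Analysis"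
begin

text \<open>
  Orlicz functions live on the half line; they are modelled as functions on
  \<^typ>\<open>real\<close> of which only the values at nonnegative arguments matter.
\<close>

definition orlicz_function :: "(real \<Rightarrow> ennreal) \<Rightarrow> bool" where
  "orlicz_function \<phi> \<longleftrightarrow>
     (\<forall>s\<ge>0. \<forall>t\<ge>0. \<forall>u\<in>{0..1}.
        \<phi> ((1 - u) * s + u * t) \<le> ennreal (1 - u) * \<phi> s + ennreal u * \<phi> t) \<and>
     (\<forall>t>0. (\<phi> \<longlongrightarrow> \<phi> t) (at_left t)) \<and>
     \<phi> 0 = 0 \<and>
     (\<phi> \<longlongrightarrow> 0) (at_right 0) \<and>
     (\<phi> \<longlongrightarrow> \<infinity>) at_top"

text \<open>
  The supremum is taken in \<^typ>\<open>ereal\<close>, where the difference is not truncated. It is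
  nonnegative when \<open>\<phi> 0 = 0\<close>, so the final conversion to \<^typ>\<open>ennreal\<close> is then lossless.
\<close>

definition orlicz_conj :: "(real \<Rightarrow> ennreal) \<Rightarrow> real \<Rightarrow> ennreal" where
  "orlicz_conj \<phi> s = e2ennreal (SUP t\<in>{0..}. ereal (s * t) - enn2ereal (\<phi> t))"

definition Delta2 :: "(real \<Rightarrow> ennreal) \<Rightarrow> bool" where
  "Delta2 \<phi> \<longleftrightarrow> (\<exists>c::real. \<forall>t\<ge>0. \<phi> (2 * t) \<le> ennreal c * \<phi> t)"

definition Nabla2 :: "(real \<Rightarrow> ennreal) \<Rightarrow> bool" where
  "Nabla2 \<phi> \<longleftrightarrow> Delta2 (orlicz_conj \<phi>)"

definition square :: "(real^2) set" where
  "square = {x. \<forall>i. x $ i \<in> {-1<..<1}}"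

text \<open>The value on the diagonals, a null set, is immaterial.\<close>

definition weight :: "real^2 \<Rightarrow> real" where
  "weight x = (if \<bar>x $ 1\<bar> < \<bar>x $ 2\<bar> then 1 else 0)"

definition double_phase ::
    "(real \<Rightarrow> ennreal) \<Rightarrow> (real \<Rightarrow> ennreal) \<Rightarrow> real^2 \<Rightarrow> real \<Rightarrow> ennreal" where
  "double_phase \<phi> \<psi> x t = \<phi> t + ennreal (weight x) * \<psi> t"

text \<open>Convergence at the origin of the integral of a nonnegative function.\<close>

definition converges_at_0 :: "(real \<Rightarrow> ennreal) \<Rightarrow> bool" where
  "converges_at_0 f \<longleftrightarrow> (\<exists>\<delta>>0. (\<integral>\<^sup>+r\<in>{0<..<\<delta>}. f r \<partial>lborel) < \<infinity>)"

text \<open>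
  All function spaces below consist of representatives defined on the whole of
  \<open>real^'n\<close>. Their values outside \<open>\<Omega>\<close> are irrelevant, and all Lebesgue and Sobolev spaces
  are closed under modification on null subsets of \<open>\<Omega>\<close>.
\<close>

definition luxemburg_norm ::
    "(real^'n) set \<Rightarrow> (real^'n \<Rightarrow> real \<Rightarrow> ennreal) \<Rightarrow>
     (real^'n \<Rightarrow> 'b::real_normed_vector) \<Rightarrow> ennreal" where
  "luxemburg_norm \<Omega> \<Phi> f =
     Inf {ennreal \<gamma> |\<gamma>. \<gamma> > 0 \<and> (\<integral>\<^sup>+x. \<Phi> x (norm (f x /\<^sub>R \<gamma>)) \<partial>lebesgue_on \<Omega>) \<le> 1}"

definition orlicz_space ::
    "(real^'n) set \<Rightarrow> (real^'n \<Rightarrow> real \<Rightarrow> ennreal) \<Rightarrow>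
     (real^'n \<Rightarrow> 'b::real_normed_vector) set" where
  "orlicz_space \<Omega> \<Phi> =
     {f. f \<in> borel_measurable (lebesgue_on \<Omega>) \<and> luxemburg_norm \<Omega> \<Phi> f < \<infinity>}"

fun higher_differentiable_on :: "nat \<Rightarrow> (real^'n) set \<Rightarrow> (real^'n \<Rightarrow> real) \<Rightarrow> bool" where
  "higher_differentiable_on 0 S f \<longleftrightarrow> continuous_on S f"
| "higher_differentiable_on (Suc k) S f \<longleftrightarrow>
     (\<forall>x\<in>S. f differentiable at x) \<and>
     (\<forall>v. higher_differentiable_on k S (\<lambda>x. frechet_derivative f (at x) v))"

definition smooth_functions :: "(real^'n) set \<Rightarrow> (real^'n \<Rightarrow> real) set" where
  "smooth_functions \<Omega> = {f. \<forall>k. higher_differentiable_on k \<Omega> f}"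

definition test_functions :: "(real^'n) set \<Rightarrow> (real^'n \<Rightarrow> real) set" where
  "test_functions \<Omega> =
     {f. f \<in> smooth_functions UNIV \<and>
         compact (closure {x. f x \<noteq> 0}) \<and> closure {x. f x \<noteq> 0} \<subseteq> \<Omega>}"

definition locally_integrable ::
    "(real^'n) set \<Rightarrow> (real^'n \<Rightarrow> 'b::euclidean_space) \<Rightarrow> bool" where
  "locally_integrable \<Omega> f \<longleftrightarrow> (\<forall>K. compact K \<and> K \<subseteq> \<Omega> \<longrightarrow> f absolutely_integrable_on K)"

definition has_weak_gradient ::
    "(real^'n) set \<Rightarrow> (real^'n \<Rightarrow> real) \<Rightarrow> (real^'n \<Rightarrow> real^'n) \<Rightarrow> bool" where
  "has_weak_gradient \<Omega> w g \<longleftrightarrow>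
     locally_integrable \<Omega> w \<and> locally_integrable \<Omega> g \<and>
     (\<forall>\<eta>\<in>test_functions \<Omega>. \<forall>i.
        (\<integral>x. w x * frechet_derivative \<eta> (at x) (axis i 1) \<partial>lebesgue_on \<Omega>) =
        - (\<integral>x. g x $ i * \<eta> x \<partial>lebesgue_on \<Omega>))"

text \<open>A weak gradient is determined almost everywhere on an open \<open>\<Omega>\<close>; one version is chosen.\<close>

definition weak_gradient ::
    "(real^'n) set \<Rightarrow> (real^'n \<Rightarrow> real) \<Rightarrow> real^'n \<Rightarrow> real^'n" where
  "weak_gradient \<Omega> w = (SOME g. has_weak_gradient \<Omega> w g)"

definition L1_norm :: "(real^'n) set \<Rightarrow> (real^'n \<Rightarrow> 'b::real_normed_vector) \<Rightarrow> ennreal" where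
  "L1_norm \<Omega> f = (\<integral>\<^sup>+x. ennreal (norm (f x)) \<partial>lebesgue_on \<Omega>)"

definition norm_closure ::
    "((real^'n \<Rightarrow> real) \<Rightarrow> ennreal) \<Rightarrow> (real^'n \<Rightarrow> real) set \<Rightarrow> (real^'n \<Rightarrow> real) set \<Rightarrow>
     (real^'n \<Rightarrow> real) set" where
  "norm_closure N X S = {w\<in>X. \<forall>\<epsilon>>0. \<exists>v\<in>S. N (\<lambda>x. w x - v x) < \<epsilon>}"

definition W11 :: "(real^'n) set \<Rightarrow> (real^'n \<Rightarrow> real) set" where
  "W11 \<Omega> = {w. integrable (lebesgue_on \<Omega>) w \<and>
               (\<exists>g. has_weak_gradient \<Omega> w g \<and> integrable (lebesgue_on \<Omega>) g)}"

definition W11_norm :: "(real^'n) set \<Rightarrow> (real^'n \<Rightarrow> real) \<Rightarrow> ennreal" where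
  "W11_norm \<Omega> w = L1_norm \<Omega> w + L1_norm \<Omega> (weak_gradient \<Omega> w)"

definition W11_0 :: "(real^'n) set \<Rightarrow> (real^'n \<Rightarrow> real) set" where
  "W11_0 \<Omega> = norm_closure (W11_norm \<Omega>) (W11 \<Omega>) (test_functions \<Omega>)"

definition W1 ::
    "(real^'n) set \<Rightarrow> (real^'n \<Rightarrow> real \<Rightarrow> ennreal) \<Rightarrow> (real^'n \<Rightarrow> real) set" where
  "W1 \<Omega> \<Phi> = {w\<in>W11 \<Omega>. weak_gradient \<Omega> w \<in> orlicz_space \<Omega> \<Phi>}"

definition W1_norm ::
    "(real^'n) set \<Rightarrow> (real^'n \<Rightarrow> real \<Rightarrow> ennreal) \<Rightarrow> (real^'n \<Rightarrow> real) \<Rightarrow> ennreal" where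
  "W1_norm \<Omega> \<Phi> w = L1_norm \<Omega> w + luxemburg_norm \<Omega> \<Phi> (weak_gradient \<Omega> w)"

definition H1 ::
    "(real^'n) set \<Rightarrow> (real^'n \<Rightarrow> real \<Rightarrow> ennreal) \<Rightarrow> (real^'n \<Rightarrow> real) set" where
  "H1 \<Omega> \<Phi> = norm_closure (W1_norm \<Omega> \<Phi>) (W1 \<Omega> \<Phi>) (smooth_functions \<Omega> \<inter> W1 \<Omega> \<Phi>)"

definition W1_0 ::
    "(real^'n) set \<Rightarrow> (real^'n \<Rightarrow> real \<Rightarrow> ennreal) \<Rightarrow> (real^'n \<Rightarrow> real) set" where
  "W1_0 \<Omega> \<Phi> = {w\<in>W11_0 \<Omega>. weak_gradient \<Omega> w \<in> orlicz_space \<Omega> \<Phi>}"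

definition W1_0_norm ::
    "(real^'n) set \<Rightarrow> (real^'n \<Rightarrow> real \<Rightarrow> ennreal) \<Rightarrow> (real^'n \<Rightarrow> real) \<Rightarrow> ennreal" where
  "W1_0_norm \<Omega> \<Phi> w = luxemburg_norm \<Omega> \<Phi> (weak_gradient \<Omega> w)"

definition H1_0 ::
    "(real^'n) set \<Rightarrow> (real^'n \<Rightarrow> real \<Rightarrow> ennreal) \<Rightarrow> (real^'n \<Rightarrow> real) set" where
  "H1_0 \<Omega> \<Phi> = norm_closure (W1_0_norm \<Omega> \<Phi>) (W1_0 \<Omega> \<Phi>) (test_functions \<Omega>)"

text \<open>
  The functional takes values in \<^typ>\<open>ereal\<close>, so that infima need no boundedness side
  condition. For \<open>b\<close> in the dual Orlicz space and \<open>u\<close> in \<open>W1 \<Omega> \<Phi>\<close>, the second integrand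
  is integrable by the Orlicz-Hoelder inequality.
\<close>

definition energy ::
    "(real^'n) set \<Rightarrow> (real^'n \<Rightarrow> real \<Rightarrow> ennreal) \<Rightarrow> (real^'n \<Rightarrow> real^'n) \<Rightarrow>
     (real^'n \<Rightarrow> real) \<Rightarrow> ereal" where
  "energy \<Omega> \<Phi> b u =
     enn2ereal (\<integral>\<^sup>+x. \<Phi> x (norm (weak_gradient \<Omega> u x)) \<partial>lebesgue_on \<Omega>) +
     ereal (\<integral>x. b x \<bullet> weak_gradient \<Omega> u x \<partial>lebesgue_on \<Omega>)"

end

theory Submission
  imports Defs
begin

text \<open>
  The weight is \<open>1\<close> on the vertical double cone \<open>\<bar>x $ 1\<bar> < \<bar>x $ 2\<bar>\<close>, whose two halves touch only at
  the origin, and \<open>0\<close> on the horizontal one. A function that is constant on each half of the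
  vertical cone, with different constants above and below, has to pass from one value to the other
  inside the horizontal cones, where only \<open>\<phi>\<close> charges its gradient. If the transition depends on
  the angle alone, the gradient is of order \<open>1 / norm x\<close>, and its energy is controlled by the
  integral of \<open>\<phi> (1 / r) * r\<close>, which converges. This gives the competitor \<open>singular\<close>: a cutoff
  times \<open>conical_step\<close>.

  Smooth functions cannot imitate it, and a vector field in the dual space detects this. The
  \<open>ray_field\<close> points along the lines through the origin inside the vertical cone and has density
  \<open>1 / \<bar>x $ 2\<bar>\<close>, which cancels the Jacobian of the passage from the cone to these lines. Its
  pairing with the gradient of a \<open>C\<^sup>1\<close> function is therefore an integral of increments along full
  lines (\<open>integral_ray_field_gradient\<close>), so it vanishes when the function has compact support. For
  the competitor the lines are interrupted at the origin, where it jumps, and the pairing is a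
  nonzero multiple of the cutoff at the origin (\<open>singular_pairing\<close>). Convergence of the integral of
  \<open>orlicz_conj \<psi> (1 / r) * r\<close> puts the field into the dual space, and then Young's inequality makes
  the pairing continuous for the Luxemburg norm of the gradient (\<open>ray_field_hoelder\<close>). Hence the
  pairing vanishes on \<open>H1_0\<close> but not on the competitor; multiplying by a cutoff gives the same for
  \<open>H1\<close>. Finally, with a large multiple of the field as \<open>b\<close> the energy is nonnegative on \<open>H1_0\<close>,
  while it is negative at the competitor.

  Two facts about the plane carry the analysis. Since \<open>1 / norm x\<close> is integrable near the origin
  and every coordinate line but one avoids it, a function that is smooth off the origin with
  gradient \<open>O(1 / norm x)\<close> has its classical gradient as weak gradient
  (\<open>has_weak_gradient_off_origin\<close>) and can be cut off near the origin at vanishing cost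
  (\<open>tame_W11_0\<close>). And the weak gradient chosen by \<open>weak_gradient\<close> agrees almost everywhere with any
  other one, by the fundamental lemma of the calculus of variations.
\<close>

section \<open>Smooth functions and bumps\<close>

lemma smooth_cong:
  assumes "open S" "\<And>x. x \<in> S \<Longrightarrow> f x = g x" "higher_differentiable_on k S f"
  shows "higher_differentiable_on k S g"
  using assms(2,3)
proof (induction k arbitrary: f g)
  case 0
  then show ?case by (simp cong: continuous_on_cong)
next
  case (Suc k)
  have D: "(g has_derivative frechet_derivative f (at x)) (at x)" if "x \<in> S" for x
  proof (rule has_derivative_transform_within_open)
    show "(f has_derivative frechet_derivative f (at x)) (at x)"
      using Suc.prems that by (simp add: frechet_derivative_works)
  qed (use that assms(1) Suc.prems in auto)
  have "frechet_derivative g (at x) = frechet_derivative f (at x)" if "x \<in> S" for x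
    using frechet_derivative_at[OF D[OF that]] by simp
  moreover have "\<forall>v. higher_differentiable_on k S (\<lambda>x. frechet_derivative f (at x) v)"
    using Suc.prems by simp
  ultimately have "higher_differentiable_on k S (\<lambda>x. frechet_derivative g (at x) v)" for v
    using Suc.IH[of "\<lambda>x. frechet_derivative f (at x) v" "\<lambda>x. frechet_derivative g (at x) v"]
    by simp
  with D show ?case by (auto simp: differentiable_def)
qed

lemma smooth_SucI:
  assumes "open S" "\<And>x. x \<in> S \<Longrightarrow> (f has_derivative f' x) (at x)"
    and "\<And>v. higher_differentiable_on k S (\<lambda>x. f' x v)"
  shows "higher_differentiable_on (Suc k) S f"
proof -
  have "frechet_derivative f (at x) = f' x" if "x \<in> S" for x
    using frechet_derivative_at[OF assms(2)[OF that]] by simp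
  then have "higher_differentiable_on k S (\<lambda>x. frechet_derivative f (at x) v)" for v
    using smooth_cong[OF assms(1) _ assms(3)[of v]] by simp
  with assms(2) show ?thesis by (auto simp: differentiable_def)
qed

lemma smooth_subset:
  "higher_differentiable_on k S f \<Longrightarrow> T \<subseteq> S \<Longrightarrow> higher_differentiable_on k T f"
  by (induction k arbitrary: f) (auto intro: continuous_on_subset)

text \<open>
  Lets smoothness be checked by different formulas on different open sets.
\<close>

lemma smooth_local:
  assumes "\<And>x. x \<in> S \<Longrightarrow> \<exists>U. open U \<and> x \<in> U \<and> higher_differentiable_on k U f"
  shows "higher_differentiable_on k S f"
  using assms
proof (induction k arbitrary: f)
  case 0
  show ?case
    unfolding higher_differentiable_on.simps
  proof (rule continuous_at_imp_continuous_on, rule ballI)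
    fix x assume "x \<in> S"
    from 0[OF this] obtain U where "open U" "x \<in> U" "continuous_on U f" by auto
    then show "isCont f x" by (simp add: continuous_on_eq_continuous_at)
  qed
next
  case (Suc k)
  show ?case
    unfolding higher_differentiable_on.simps
  proof (intro conjI ballI allI)
    fix x assume "x \<in> S"
    from Suc.prems[OF this] show "f differentiable at x" by auto
  next
    fix v
    show "higher_differentiable_on k S (\<lambda>x. frechet_derivative f (at x) v)"
    proof (rule Suc.IH)
      fix x assume "x \<in> S"
      from Suc.prems[OF this] obtain U where "open U" "x \<in> U" "higher_differentiable_on (Suc k) U f"
        by blast
      then show "\<exists>U. open U \<and> x \<in> U \<and>
          higher_differentiable_on k U (\<lambda>x. frechet_derivative f (at x) v)"
        by (intro exI[of _ U]) simp
    qed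
  qed
qed

lemma smooth_SucD:
  "higher_differentiable_on (Suc k) S f \<Longrightarrow> higher_differentiable_on k S f"
proof (induction k arbitrary: f)
  case 0
  then show ?case
    by (auto intro!: continuous_at_imp_continuous_on differentiable_imp_continuous_within)
next
  case (Suc k)
  note unfolded = higher_differentiable_on.simps(2)[of "Suc k" S f, THEN iffD1, OF Suc.prems]
  have "\<forall>v. higher_differentiable_on k S (\<lambda>x. frechet_derivative f (at x) v)"
    using unfolded Suc.IH by blast
  with unfolded show ?case by (subst higher_differentiable_on.simps(2)) blast
qed

lemma smooth_const: "higher_differentiable_on k S (\<lambda>_. c)"
  by (induction k arbitrary: c) auto

lemma smooth_nth:
  assumes "open S" shows "higher_differentiable_on k S (\<lambda>x. x $ i)"
proof (cases k)
  case 0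
  then show ?thesis by (auto intro: continuous_intros)
next
  case (Suc n)
  have "((\<lambda>x::real^'a. x $ i) has_derivative (\<lambda>h. h $ i)) (at x)" for x
    by (rule bounded_linear.has_derivative[OF bounded_linear_vec_nth]) (rule has_derivative_ident)
  then show ?thesis
    unfolding Suc
    by (intro smooth_SucI[OF assms, where f'="\<lambda>x h. h $ i"]
        smooth_const)
qed

lemma smooth_add:
  assumes "open S" "higher_differentiable_on k S f" "higher_differentiable_on k S g"
  shows "higher_differentiable_on k S (\<lambda>x. f x + g x)"
  using assms(2,3)
proof (induction k arbitrary: f g)
  case 0
  then show ?case by (auto intro: continuous_intros)
next
  case (Suc k)
  show ?case
  proof (rule smooth_SucI[OF assms(1)])
    fix x assume "x \<in> S"
    then show "((\<lambda>x. f x + g x) has_derivative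
        (\<lambda>v. frechet_derivative f (at x) v + frechet_derivative g (at x) v)) (at x)"
      using Suc.prems
      by (intro has_derivative_add) (auto simp: frechet_derivative_works[symmetric])
  qed (use Suc in auto)
qed

lemma smooth_mult:
  assumes "open S" "higher_differentiable_on k S f" "higher_differentiable_on k S g"
  shows "higher_differentiable_on k S (\<lambda>x. f x * g x)"
  using assms(2,3)
proof (induction k arbitrary: f g)
  case 0
  then show ?case by (auto intro: continuous_intros)
next
  case (Suc k)
  note lower = Suc.prems[THEN smooth_SucD]
  show ?case
  proof (rule smooth_SucI[OF assms(1)])
    fix x assume "x \<in> S"
    then show "((\<lambda>x. f x * g x) has_derivative
        (\<lambda>v. f x * frechet_derivative g (at x) v + frechet_derivative f (at x) v * g x)) (at x)"
      using Suc.prems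
      by (intro has_derivative_mult) (auto simp: frechet_derivative_works[symmetric])
  next
    fix v
    show "higher_differentiable_on k S
        (\<lambda>x. f x * frechet_derivative g (at x) v + frechet_derivative f (at x) v * g x)"
    proof (rule smooth_add[OF assms(1)])
      show "higher_differentiable_on k S (\<lambda>x. f x * frechet_derivative g (at x) v)"
        by (rule Suc.IH[OF lower(1)]) (use Suc.prems(2) in simp)
      show "higher_differentiable_on k S (\<lambda>x. frechet_derivative f (at x) v * g x)"
        by (rule Suc.IH[OF _ lower(2)]) (use Suc.prems(1) in simp)
    qed
  qed
qed

lemma smooth_diff:
  assumes "open S" "higher_differentiable_on k S f" "higher_differentiable_on k S g"
  shows "higher_differentiable_on k S (\<lambda>x. f x - g x)"
  using assms(2,3)
proof (induction k arbitrary: f g)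
  case 0
  then show ?case by (auto intro: continuous_intros)
next
  case (Suc k)
  show ?case
  proof (rule smooth_SucI[OF assms(1)])
    fix x assume "x \<in> S"
    then show "((\<lambda>x. f x - g x) has_derivative
        (\<lambda>v. frechet_derivative f (at x) v - frechet_derivative g (at x) v)) (at x)"
      using Suc.prems
      by (intro has_derivative_diff) (auto simp: frechet_derivative_works[symmetric])
  qed (use Suc in auto)
qed

text \<open>
  The outer functions come in a family closed under differentiation, so the chain rule stays inside
  the family and the induction on \<open>k\<close> goes through.
\<close>

lemma smooth_compose_family:
  fixes s :: "'p \<Rightarrow> real \<Rightarrow> real"
  assumes "open S" "higher_differentiable_on k S f"
    and der: "\<And>p t. t \<in> T \<Longrightarrow> (s p has_real_derivative s (d p) t) (at t)"
    and im: "\<And>x. x \<in> S \<Longrightarrow> f x \<in> T"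
  shows "higher_differentiable_on k S (\<lambda>x. s p (f x))"
  using assms(2)
proof (induction k arbitrary: p)
  case 0
  have "continuous_on T (s p)"
    using der by (intro continuous_at_imp_continuous_on) (auto dest: DERIV_isCont)
  then show ?case
    using 0 im by (auto intro!: continuous_on_compose2[where g="s p" and f=f])
next
  case (Suc k)
  show ?case
  proof (rule smooth_SucI[OF assms(1)])
    fix x assume x: "x \<in> S"
    have "(f has_derivative frechet_derivative f (at x)) (at x)"
      using Suc.prems x by (auto simp: frechet_derivative_works[symmetric])
    from has_derivative_compose[OF this der[OF im[OF x], unfolded has_field_derivative_def]]
    show "((\<lambda>x. s p (f x)) has_derivative
        (\<lambda>v. s (d p) (f x) * frechet_derivative f (at x) v)) (at x)" .
  next
    fix v
    show "higher_differentiable_on k S (\<lambda>x. s (d p) (f x) * frechet_derivative f (at x) v)"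
    proof (rule smooth_mult[OF assms(1)])
      show "higher_differentiable_on k S (\<lambda>x. s (d p) (f x))"
        by (rule Suc.IH[OF smooth_SucD[OF Suc.prems]])
      show "higher_differentiable_on k S (\<lambda>x. frechet_derivative f (at x) v)"
        using Suc.prems by simp
    qed
  qed
qed

lemma smooth_inverse:
  assumes "open S" "higher_differentiable_on k S f" "\<And>x. x \<in> S \<Longrightarrow> f x \<noteq> 0"
  shows "higher_differentiable_on k S (\<lambda>x. inverse (f x))"
proof -
  let ?s = "\<lambda>(c::real, n::nat) t. c * inverse t ^ n"
  have "(?s p has_real_derivative ?s (- fst p * real (snd p), Suc (snd p)) t) (at t)"
    if "t \<in> - {0}" for t p
  proof -
    obtain c n where p: "p = (c, n)" by force
    show ?thesis
      using that unfolding p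
      by (auto intro!: derivative_eq_intros simp: field_simps)
         (cases n; simp add: field_simps)
  qed
  note family = smooth_compose_family[where s="?s" and T="- {0}" and p="(1, 1)"
      and d="\<lambda>p. (- fst p * real (snd p), Suc (snd p))", OF assms(1,2) this]
  have "higher_differentiable_on k S (\<lambda>x. ?s (1, 1) (f x))"
    by (rule family) (use assms(3) in auto)
  then show ?thesis by simp
qed

text \<open>
  These are \<open>exp (- 1 / t)\<close> (the case \<open>p = 1\<close>) and functions of the same kind that are needed for
  its derivatives; all of them are flat at \<open>0\<close>.
\<close>

definition flat :: "real poly \<Rightarrow> real \<Rightarrow> real" where
  "flat p t = (if t \<le> 0 then 0 else poly p (1 / t) * exp (- (1 / t)))"

lemma flat_tendsto_0: "(flat p \<longlongrightarrow> 0) (at 0)"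
proof -
  have "((\<lambda>u. poly p u * exp (- u)) \<longlongrightarrow> 0) at_top"
  proof -
    have "((\<lambda>u. \<Sum>i\<le>degree p. coeff p i * (u ^ i / exp u)) \<longlongrightarrow> (\<Sum>i\<le>degree p. coeff p i * 0)) at_top"
      by (intro tendsto_intros tendsto_power_div_exp_0)
    then show ?thesis
      by (simp add: poly_altdef sum_distrib_right exp_minus divide_inverse mult.assoc)
  qed
  from filterlim_compose[OF this filterlim_inverse_at_top_right]
  have "((\<lambda>t. poly p (1/t) * exp (- (1/t))) \<longlongrightarrow> 0) (at_right 0)"
    by (simp add: inverse_eq_divide)
  then have "(flat p \<longlongrightarrow> 0) (at_right 0)"
    by (rule tendsto_cong[THEN iffD1, rotated])
       (auto simp: flat_def eventually_at_right_field intro!: exI[of _ 1])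
  moreover have "(flat p \<longlongrightarrow> 0) (at_left 0)"
    by (rule tendsto_cong[THEN iffD1, of "\<lambda>_. 0"])
       (auto simp: flat_def eventually_at_left_field intro!: exI[of _ "-1"])
  ultimately show ?thesis by (simp add: filterlim_split_at)
qed

text \<open>
  Differentiating \<open>poly p (1 / t) * exp (- 1 / t)\<close> multiplies by \<open>1 / t\<^sup>2\<close> and replaces \<open>p\<close> by
  \<open>p - pderiv p\<close>, so the family is closed under differentiation. At \<open>0\<close> the difference quotient is
  again a member of the family, with the polynomial multiplied by the indeterminate.
\<close>

lemma flat_has_derivative:
  "(flat p has_real_derivative flat ([:0, 0, 1:] * (p - pderiv p)) t) (at t)"
proof -
  consider "t < 0" | "t = 0" | "t > 0" by linarith
  then show ?thesis
  proof cases
    case 1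
    have "((\<lambda>_. 0) has_real_derivative 0) (at t)" by simp
    then have "(flat p has_real_derivative 0) (at t)"
      by (rule has_field_derivative_transform_within_open[where S="{..<0}"])
         (use 1 in \<open>auto simp: flat_def\<close>)
    with 1 show ?thesis by (simp add: flat_def)
  next
    case 2
    have "((\<lambda>h. flat p h / h) \<longlongrightarrow> 0) (at 0)"
    proof (rule tendsto_cong[THEN iffD1, OF _ flat_tendsto_0])
      show "\<forall>\<^sub>F h in at 0. flat ([:0, 1:] * p) h = flat p h / h"
        by (auto simp: flat_def eventually_at_filter)
    qed
    then show ?thesis by (simp add: 2 DERIV_def flat_def)
  next
    case 3
    have "((\<lambda>t. poly p (1/t) * exp (- (1/t))) has_real_derivative
        flat ([:0, 0, 1:] * (p - pderiv p)) t) (at t)"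
      using 3 by (auto intro!: derivative_eq_intros DERIV_chain2[OF poly_DERIV]
          simp: flat_def field_simps power2_eq_square)
    then show ?thesis
      by (rule has_field_derivative_transform_within_open[where S="{0<..}"])
         (use 3 in \<open>auto simp: flat_def\<close>)
  qed
qed

lemma flat_1_pos: "t > 0 \<Longrightarrow> flat 1 t > 0"
  and flat_1_eq_0: "t \<le> 0 \<Longrightarrow> flat 1 t = 0"
  and flat_1_nonneg: "flat 1 t \<ge> 0"
  by (auto simp: flat_def)

text \<open>
  A smooth transition from \<open>0\<close> for \<open>t \<le> 0\<close> to \<open>1\<close> for \<open>t \<ge> 1\<close>: as \<open>t\<close> and \<open>1 - t\<close> are not both
  nonpositive, the denominator never vanishes.
\<close>

definition step :: "real \<Rightarrow> real" where
  "step t = flat 1 t * inverse (flat 1 t + flat 1 (1 - t))"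

lemma step_denominator_pos: "flat 1 t + flat 1 (1 - t) > 0"
  using flat_1_pos[of t] flat_1_pos[of "1 - t"] flat_1_nonneg[of t] flat_1_nonneg[of "1 - t"]
  by (cases "t > 0") auto

lemma step_eq_0: "t \<le> 0 \<Longrightarrow> step t = 0"
  by (simp add: step_def flat_1_eq_0)

lemma step_eq_1: "t \<ge> 1 \<Longrightarrow> step t = 1"
  using flat_1_pos[of t] by (simp add: step_def flat_1_eq_0)

lemma step_nonneg: "step t \<ge> 0"
  using step_denominator_pos[of t] by (simp add: step_def flat_1_nonneg)

lemma step_le_1: "step t \<le> 1"
  using step_denominator_pos[of t] flat_1_nonneg[of "1 - t"]
  by (simp add: step_def field_simps)

lemma smooth_step:
  assumes "open S" "higher_differentiable_on k S f"
  shows "higher_differentiable_on k S (\<lambda>x. step (f x))"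
proof -
  have flat: "higher_differentiable_on k S (\<lambda>x. flat p (g x))"
    if "higher_differentiable_on k S g" for p g
    by (rule smooth_compose_family[OF assms(1) that,
          where T=UNIV and s=flat and d="\<lambda>p. [:0, 0, 1:] * (p - pderiv p)"])
       (simp_all only: flat_has_derivative UNIV_I)
  have "higher_differentiable_on k S (\<lambda>x. flat 1 (f x) + flat 1 (1 - f x))"
    by (intro smooth_add[OF assms(1)] flat
        smooth_diff[OF assms(1)] smooth_const assms(2))
  then have "higher_differentiable_on k S (\<lambda>x. inverse (flat 1 (f x) + flat 1 (1 - f x)))"
    by (rule smooth_inverse[OF assms(1)])
       (use step_denominator_pos in \<open>auto simp: less_imp_neq[symmetric]\<close>)
  with flat[OF assms(2), of 1] show ?thesis
    unfolding step_def by (intro smooth_mult[OF assms(1)])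
qed

lemma step_has_bounded_derivative:
  obtains s' B where "\<And>t. (step has_real_derivative s' t) (at t)" "\<And>t. \<bar>s' t\<bar> \<le> B"
proof -
  let ?f = "flat ([:0, 0, 1:] * (1 - pderiv 1))"
  let ?D = "\<lambda>t. flat 1 t + flat 1 (1 - t)"
  define s' where "s' t = ?f t * inverse (?D t) + -
      (inverse (?D t) * (?f t - ?f (1 - t)) * inverse (?D t)) * flat 1 t"
    for t
  have cont: "continuous_on A (flat p)" for A p
    using flat_has_derivative by (intro continuous_at_imp_continuous_on) (auto dest: DERIV_isCont)
  have D0: "?D t \<noteq> 0" for t using step_denominator_pos[of t] by simp
  have dD: "(?D has_real_derivative (?f t - ?f (1 - t))) (at t)" for t
  proof -
    have "((\<lambda>t. flat 1 (1 - t)) has_real_derivative ?f (1 - t) * (- 1)) (at t)"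
      by (rule DERIV_chain2[OF flat_has_derivative]) (auto intro!: derivative_eq_intros)
    from DERIV_add[OF flat_has_derivative[of 1 t] this] show ?thesis by simp
  qed
  have der: "(step has_real_derivative s' t) (at t)" for t
    unfolding step_def[abs_def] s'_def
    by (rule DERIV_mult[OF flat_has_derivative DERIV_inverse'[OF dD D0]])
  have cs: "continuous_on A s'" for A
    unfolding s'_def by (intro continuous_intros cont continuous_on_compose2[OF cont[of UNIV]])
        (use D0 in auto)
  have zero: "s' t = 0" if "t \<notin> {0..1}" for t
  proof -
    let ?c = "if t < 0 then 0 else 1"
    have "(step has_real_derivative 0) (at t)"
      by (rule has_field_derivative_transform_within_open[where f="\<lambda>_. ?c" and
          S="if t < 0 then {..<0} else {1<..}"])
         (use that in \<open>auto simp: step_eq_0 step_eq_1\<close>)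
    then show ?thesis using der DERIV_unique by blast
  qed
  have "bounded (s' ` {0..1})"
    by (intro compact_imp_bounded compact_continuous_image cs) simp
  then obtain B where "\<forall>y\<in>s' ` {0..1}. norm y \<le> B"
    unfolding bounded_iff by blast
  then have B: "\<And>t. t \<in> {0..1} \<Longrightarrow> \<bar>s' t\<bar> \<le> B" by auto
  have "\<bar>s' t\<bar> \<le> B" for t
    using B[of t] B[of 0] zero[of t] by (cases "t \<in> {0..1}") auto
  then show ?thesis using that[of s' B] der by blast
qed

text \<open>
  The transition layers, of width \<open>1 / n\<close>, lie inside the box, so the supports stay in the closed
  box while the functions converge to the indicator of the open one.
\<close>

definition box_bump :: "nat \<Rightarrow> real^'n \<Rightarrow> real^'n \<Rightarrow> real^'n \<Rightarrow> real" where
  "box_bump n a b x = (\<Prod>i\<in>UNIV. step (real n * (x $ i - a $ i)) * step (real n * (b $ i - x $ i)))"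

lemma box_bump_eq_0: "x \<notin> box a b \<Longrightarrow> box_bump n a b x = 0"
proof -
  assume "x \<notin> box a b"
  then obtain i where "x $ i \<le> a $ i \<or> b $ i \<le> x $ i" by (auto simp: mem_box_cart not_less)
  then have "step (real n * (x $ i - a $ i)) * step (real n * (b $ i - x $ i)) = 0"
    by (auto simp: step_eq_0 mult_nonneg_nonpos)
  then show ?thesis unfolding box_bump_def by (intro prod_zero) auto
qed

lemma box_bump_bounds: "0 \<le> box_bump n a b x" "box_bump n a b x \<le> 1"
  unfolding box_bump_def
  by (auto intro!: prod_nonneg prod_le_1 mult_nonneg_nonneg mult_le_one step_nonneg step_le_1)

lemma box_bump_tendsto: "(\<lambda>n. box_bump n a b x) \<longlonglongrightarrow> indicator (box a b) x"
proof (cases "x \<in> box a b")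
  case True
  have ev: "\<forall>\<^sub>F n in sequentially. step (real n * c) = 1" if "c > 0" for c
  proof -
    obtain N where N: "1 / c < real N" using reals_Archimedean2 by blast
    have "step (real n * c) = 1" if "n \<ge> N" for n
    proof (rule step_eq_1)
      have "1 / c \<le> real n" using N that by linarith
      with \<open>c > 0\<close> show "real n * c \<ge> 1" by (simp add: field_simps)
    qed
    then show ?thesis by (auto simp: eventually_sequentially)
  qed
  have "\<forall>\<^sub>F n in sequentially. \<forall>i\<in>UNIV. step (real n * (x $ i - a $ i)) = 1
      \<and> step (real n * (b $ i - x $ i)) = 1"
    using True by (intro eventually_ball_finite ballI eventually_conj ev) (auto simp: mem_box_cart)
  then have "\<forall>\<^sub>F n in sequentially. box_bump n a b x = 1"
    by (rule eventually_mono) (simp add: box_bump_def)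
  with True show ?thesis by (simp add: tendsto_eventually)
qed (simp add: box_bump_eq_0)

lemma smooth_prod:
  assumes "open S" "\<And>i. i \<in> I \<Longrightarrow> higher_differentiable_on k S (f i)"
  shows "higher_differentiable_on k S (\<lambda>x. \<Prod>i\<in>I. f i x)"
  using assms(2)
proof (induction I rule: infinite_finite_induct)
  case (insert i I)
  then show ?case by (simp add: smooth_mult[OF assms(1)])
qed (simp_all add: smooth_const)

lemma smooth_box_bump:
  assumes "open S" shows "higher_differentiable_on k S (box_bump n a b)"
  unfolding box_bump_def[abs_def]
  by (intro smooth_prod smooth_mult smooth_step
      smooth_diff smooth_nth smooth_const assms)

lemma test_functionsI:
  assumes "\<And>k. higher_differentiable_on k UNIV f" "compact K" "K \<subseteq> \<Omega>" "\<And>x. x \<notin> K \<Longrightarrow> f x = 0"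
  shows "f \<in> test_functions \<Omega>"
proof -
  have "closure {x. f x \<noteq> 0} \<subseteq> K"
    using assms(2,4) by (intro closure_minimal) (auto intro: compact_imp_closed)
  moreover from this have "compact (closure {x. f x \<noteq> 0})"
    using compact_Int_closed[OF assms(2) closed_closure] by (metis inf.absorb_iff2)
  ultimately show ?thesis
    using assms by (auto simp: test_functions_def smooth_functions_def)
qed

lemma box_bump_test_function: "cbox a b \<subseteq> \<Omega> \<Longrightarrow> box_bump n a b \<in> test_functions \<Omega>"
  using box_subset_cbox[of a b]
  by (intro test_functionsI[where K="cbox a b"] smooth_box_bump)
     (auto intro: box_bump_eq_0)

section \<open>The fundamental lemma of the calculus of variations\<close>

text \<open>
  Boxes are an intersection-stable generator of the Borel sets, and the sets over which \<open>f\<close>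
  integrates to zero form a Dynkin system; the hypothesis on the whole space provides closure under
  complements.
\<close>

lemma AE_zero_if_box_integrals_zero:
  fixes f :: "'a::euclidean_space \<Rightarrow> real"
  assumes f: "integrable lborel f" and UNIV0: "(\<integral>x. f x \<partial>lborel) = 0"
    and box0: "\<And>a b. (\<integral>x. indicator (box a b) x * f x \<partial>lborel) = 0"
  shows "AE x in lborel. f x = 0"
proof (rule sigma_finite_measure.density_zero[OF sigma_finite_lborel f])
  fix A :: "'a set" assume "A \<in> sets lborel"
  let ?G = "range (\<lambda>(a, b). box a b :: 'a set)"
  have borel: "sets borel = sigma_sets UNIV ?G" by (simp add: borel_eq_box)
  have int: "set_integrable lborel B f" if "B \<in> sigma_sets UNIV ?G" for B
    unfolding set_integrable_def
    using that f by (intro integrable_mult_indicator) (simp_all add: borel)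
  have A: "A \<in> sigma_sets UNIV ?G"
    using \<open>A \<in> sets lborel\<close> by (simp add: borel[symmetric])
  show "(LINT x:A|lborel. f x) = 0"
  proof (rule sigma_sets_induct_disjoint[OF _ _ A])
    show "Int_stable ?G" by (auto simp: Int_stable_def box_Int_box)
    show "(LINT x:B|lborel. f x) = 0" if "B \<in> ?G" for B
      using that box0 by (auto simp: set_lebesgue_integral_def)
    show "(LINT x:UNIV - B|lborel. f x) = 0"
      if "B \<in> sigma_sets UNIV ?G" "(LINT x:B|lborel. f x) = 0" for B
    proof -
      have "(LINT x:B \<union> (UNIV - B)|lborel. f x)
          = (LINT x:B|lborel. f x) + (LINT x:UNIV - B|lborel. f x)"
        by (rule set_integral_Un) (use that int in \<open>auto intro: sigma_sets.Compl\<close>)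
      then show ?thesis using that UNIV0 by (simp add: set_lebesgue_integral_def)
    qed
    show "(LINT x:(\<Union>i. B i)|lborel. f x) = 0"
      if "disjoint_family B" "range B \<subseteq> sigma_sets UNIV ?G" "\<And>i. (LINT x:B i|lborel. f x) = 0"
      for B :: "nat \<Rightarrow> 'a set"
    proof -
      have "(\<Union>i. B i) \<in> sigma_sets UNIV ?G" using that(2) by (intro sigma_sets.Union) auto
      from int[OF this] that(1,2) show ?thesis
        by (subst lebesgue_integral_countable_add)
           (auto simp: that(3) disjoint_family_on_def borel[symmetric] subset_eq)
    qed
  qed (auto simp: set_lebesgue_integral_def)
qed

text \<open>
  Box bumps approximate the indicator of a box, so testing against them sees the integral of \<open>g\<close>
  over every box inside \<open>\<Omega>\<close>.
\<close>

lemma fundamental_lemma_calculus_of_variations: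
  fixes g :: "real^'n \<Rightarrow> real"
  assumes \<Omega>: "open \<Omega>" and g: "locally_integrable \<Omega> g"
    and zero: "\<And>\<eta>. \<eta> \<in> test_functions \<Omega> \<Longrightarrow> (\<integral>x. g x * \<eta> x \<partial>lebesgue_on \<Omega>) = 0"
  shows "AE x in lebesgue_on \<Omega>. g x = 0"
proof -
  have on_cbox: "AE x in lebesgue. x \<in> cbox c d \<longrightarrow> g x = 0" if sub: "cbox c d \<subseteq> \<Omega>" for c d
  proof -
    define F where "F x = indicator (cbox c d) x * g x" for x
    have F: "integrable lebesgue F"
      using g sub unfolding locally_integrable_def set_integrable_def F_def[abs_def] by auto
    \<comment> \<open>A Borel version, since the Dynkin argument only reaches Borel sets.\<close>
    obtain F' where F'[measurable]: "F' \<in> borel_measurable lborel" and ae: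
        "AE x in lborel. F x = F' x"
      using completion_ex_borel_measurable_real[of F lborel] F by auto
    have ae': "AE x in lebesgue. F x = F' x" using ae by (rule AE_completion)
    have "integrable lebesgue F'"
      using F ae' by (subst integrable_cong_AE[symmetric]) (auto intro: measurable_completion)
    then have F'int: "integrable lborel F'" by (simp add: integrable_completion)
    have bnd: "AE x in lebesgue. x \<notin> cbox c d - box c d"
      using negligible_frontier_interval[of c d]
          by (intro AE_not_in) (simp add: negligible_iff_null_sets)
    have bndF: "AE x in lebesgue. x \<in> box c d \<or> F x = 0"
      using bnd by eventually_elim (auto simp: F_def)
    have indicator_box: "indicat_real (box a b) \<in> borel_measurable lebesgue" for a b :: "real^'n"
      by (intro measurable_completion) auto
    have eq: "(\<integral>x. indicator A x * F' x \<partial>lborel) = (\<integral>x. indicator A x * F x \<partial>lebesgue)"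
      if [measurable]: "A \<in> sets borel" for A
    proof -
      have "(\<integral>x. indicator A x * F' x \<partial>lborel) = (\<integral>x. indicator A x * F' x \<partial>lebesgue)"
        by (subst integral_completion) auto
      also have "\<dots> = (\<integral>x. indicator A x * F x \<partial>lebesgue)"
      proof (rule integral_cong_AE)
        show "(\<lambda>x. indicator A x * F' x) \<in> borel_measurable lebesgue"
          by (intro measurable_completion) auto
        have "indicator A \<in> borel_measurable lebesgue" by (intro measurable_completion) auto
        then show "(\<lambda>x. indicator A x * F x) \<in> borel_measurable lebesgue"
          using F by (intro borel_measurable_times) auto
      qed (use ae' in auto)
      finally show ?thesis .
    qed
    have box: "(\<integral>x. indicator (box a b) x * F x \<partial>lebesgue) = 0" if "cbox a b \<subseteq> cbox c d" for a b
    proof -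
      have "(\<lambda>n. \<integral>x. box_bump n a b x * F x \<partial>lebesgue) \<longlonglongrightarrow>
          (\<integral>x. indicator (box a b) x * F x \<partial>lebesgue)"
      proof (rule integral_dominated_convergence[where w="\<lambda>x. \<bar>F x\<bar>"])
        have "continuous_on UNIV (box_bump n a b)" for n
          using smooth_box_bump[of UNIV 0 n a b] by simp
        then have "box_bump n a b \<in> borel_measurable lebesgue" for n
          by (intro measurable_completion) (simp add: borel_measurable_continuous_onI)
        then show "(\<lambda>x. box_bump n a b x * F x) \<in> borel_measurable lebesgue" for n
          using F by (intro borel_measurable_times) auto
        show "AE x in lebesgue. (\<lambda>n. box_bump n a b x * F x) \<longlonglongrightarrow> indicator (box a b) x * F x"
          by (intro AE_I2 tendsto_intros box_bump_tendsto)
        show "AE x in lebesgue. norm (box_bump n a b x * F x) \<le> \<bar>F x\<bar>" for n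
          using box_bump_bounds[of n a b] by (auto simp: abs_mult intro!: mult_left_le_one_le)
      qed (use F in \<open>auto intro!: borel_measurable_times indicator_box\<close>)
      moreover have "(\<integral>x. box_bump n a b x * F x \<partial>lebesgue) = 0" for n
      proof -
        have eqf: "(\<lambda>x. indicator \<Omega> x *\<^sub>R (g x * box_bump n a b x)) = (\<lambda>x. box_bump n a b x * F x)"
        proof
          fix x
          show "indicator \<Omega> x *\<^sub>R (g x * box_bump n a b x) = box_bump n a b x * F x"
            using that sub box_bump_eq_0[of x a b n] box_subset_cbox[of a b]
            by (auto simp: F_def indicator_def)
        qed
        have "(\<integral>x. g x * box_bump n a b x \<partial>lebesgue_on \<Omega>) = 0"
          using that sub by (intro zero box_bump_test_function) auto
        moreover have "(\<integral>x. g x * box_bump n a b x \<partial>lebesgue_on \<Omega>)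
            = (\<integral>x. indicator \<Omega> x *\<^sub>R (g x * box_bump n a b x) \<partial>lebesgue)"
          using \<Omega> by (intro integral_restrict_space) auto
        ultimately show ?thesis by (simp only: eqf)
      qed
      ultimately show ?thesis by (simp add: LIMSEQ_const_iff)
    qed
    have "AE x in lborel. F' x = 0"
    proof (rule AE_zero_if_box_integrals_zero[OF F'int])
      have "(\<integral>x. F' x \<partial>lborel) = (\<integral>x. F x \<partial>lebesgue)" using eq[of UNIV] by simp
      also have "\<dots> = (\<integral>x. indicator (box c d) x * F x \<partial>lebesgue)"
        using F bndF
        by (intro integral_cong_AE borel_measurable_times indicator_box) (auto simp: indicator_def)
      finally show "(\<integral>x. F' x \<partial>lborel) = 0" using box[of c d] by simp
    next
      fix a b :: "real^'n"
      obtain a' b' where ab': "box a b \<inter> box c d = box a' b'" "cbox a b \<inter> cbox c d = cbox a' b'"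
        using box_Int_box[of a b c d] Int_interval[of a b c d] by blast
      have "(\<integral>x. indicator (box a b) x * F' x \<partial>lborel)
          = (\<integral>x. indicator (box a b) x * F x \<partial>lebesgue)"
        by (rule eq) simp
      also have "\<dots> = (\<integral>x. indicator (box a' b') x * F x \<partial>lebesgue)"
        using F bndF
        by (intro integral_cong_AE borel_measurable_times indicator_box)
           (auto simp: indicator_def ab'(1)[symmetric])
      also have "\<dots> = 0" by (rule box) (use ab' in auto)
      finally show "(\<integral>x. indicator (box a b) x * F' x \<partial>lborel) = 0" .
    qed
    then have "AE x in lebesgue. F' x = 0" by (rule AE_completion)
    with ae' show ?thesis by eventually_elim (auto simp: F_def)
  qed
  obtain \<D> :: "(real^'n) set set" where "countable \<D>" and D: "\<D> \<subseteq> Pow \<Omega>"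
      "\<And>X. X \<in> \<D> \<Longrightarrow> \<exists>a b. X = cbox a b" "\<Union>\<D> = \<Omega>"
    using open_countable_Union_open_cbox[OF \<Omega>] by metis
  have "AE x in lebesgue. \<forall>X\<in>\<D>. x \<in> X \<longrightarrow> g x = 0"
    using \<open>countable \<D>\<close>
  proof (rule AE_ball_countable[THEN iffD2, rule_format])
    fix X assume X: "X \<in> \<D>"
    then obtain a b where "X = cbox a b" using D(2) by blast
    with X D(1) on_cbox[of a b] show "AE x in lebesgue. x \<in> X \<longrightarrow> g x = 0" by auto
  qed
  then have "AE x in lebesgue. x \<in> \<Omega> \<longrightarrow> g x = 0" using D(3) by auto
  then show ?thesis using \<Omega> by (subst AE_restrict_space_iff) auto
qed

section \<open>Weak gradients\<close>

lemma test_functionE: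
  assumes "\<eta> \<in> test_functions \<Omega>"
  obtains K where "compact K" "K \<subseteq> \<Omega>" "\<And>x. x \<notin> K \<Longrightarrow> \<eta> x = 0"
    "\<And>x. x \<notin> K \<Longrightarrow> frechet_derivative \<eta> (at x) = (\<lambda>_. 0)"
    "\<And>x. (\<eta> has_derivative frechet_derivative \<eta> (at x)) (at x)"
    "continuous_on UNIV \<eta>" "\<And>v. continuous_on UNIV (\<lambda>x. frechet_derivative \<eta> (at x) v)"
proof -
  define K where "K = closure {x. \<eta> x \<noteq> 0}"
  have "closed K" by (simp add: K_def)
  have smooth: "higher_differentiable_on k UNIV \<eta>" for k
    using assms by (simp add: test_functions_def smooth_functions_def)
  have zero: "\<eta> x = 0" if "x \<notin> K" for x
    using that closure_subset[of "{x. \<eta> x \<noteq> 0}"] by (auto simp: K_def)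
  have der0: "frechet_derivative \<eta> (at x) = (\<lambda>_. 0)" if "x \<notin> K" for x
  proof -
    have "((\<lambda>_. 0) has_derivative (\<lambda>_. 0)) (at x)" by simp
    then have "(\<eta> has_derivative (\<lambda>_. 0)) (at x)"
    proof (rule has_derivative_transform_within_open)
      show "open (- K)" "x \<in> - K" using that \<open>closed K\<close> by auto
    qed (use zero in simp)
    from frechet_derivative_at[OF this] show ?thesis by simp
  qed
  have der: "\<eta> differentiable at x" for x
    using smooth[of "Suc 0"] unfolding higher_differentiable_on.simps by blast
  show ?thesis
  proof (rule that)
    show "compact K" "K \<subseteq> \<Omega>" using assms by (simp_all add: test_functions_def K_def)
    show "(\<eta> has_derivative frechet_derivative \<eta> (at x)) (at x)" for x
      using der frechet_derivative_works by blast
    show "continuous_on UNIV \<eta>" using smooth[of 0] by simp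
    show "continuous_on UNIV (\<lambda>x. frechet_derivative \<eta> (at x) v)" for v
      using smooth[of "Suc 0"] unfolding higher_differentiable_on.simps by blast
  qed (rule zero der0, assumption)+
qed

text \<open>
  Both sides of the defining identity of a weak gradient are integrals of such products. Their
  integrability is what makes the identity additive.
\<close>

lemma locally_integrable_times_integrable:
  fixes f h :: "real^'n \<Rightarrow> real"
  assumes "open \<Omega>" "locally_integrable \<Omega> f" "continuous_on UNIV h" "compact K" "K \<subseteq> \<Omega>"
    "\<And>x. x \<notin> K \<Longrightarrow> h x = 0"
  shows "integrable (lebesgue_on \<Omega>) (\<lambda>x. f x * h x)"
proof -
  have "K \<in> sets lebesgue" using \<open>compact K\<close> by (simp add: borel_compact)
  have "(\<lambda>x. h x * f x) absolutely_integrable_on K"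
  proof (rule absolutely_integrable_bounded_measurable_product[OF bilinear_times])
    show "h \<in> borel_measurable (lebesgue_on K)"
      using assms by (intro continuous_imp_measurable_on_sets_lebesgue)
        (auto intro: continuous_on_subset \<open>K \<in> sets lebesgue\<close>)
    show "bounded (h ` K)"
      using assms by (intro compact_imp_bounded compact_continuous_image)
          (auto intro: continuous_on_subset)
  qed (use assms \<open>K \<in> sets lebesgue\<close> in \<open>auto simp: locally_integrable_def\<close>)
  moreover have "(\<lambda>x. indicator K x *\<^sub>R (h x * f x)) = (\<lambda>x. indicator \<Omega> x *\<^sub>R (f x * h x))"
  proof
    fix x
    show "indicator K x *\<^sub>R (h x * f x) = indicator \<Omega> x *\<^sub>R (f x * h x)"
      using assms(5) assms(6)[of x] by (auto simp: indicator_def)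
  qed
  ultimately show ?thesis
    using assms(1) by (simp add: set_integrable_def integrable_restrict_space)
qed

lemma locally_integrable_component:
  fixes g :: "real^'n \<Rightarrow> real^'m"
  assumes "locally_integrable \<Omega> g"
  shows "locally_integrable \<Omega> (\<lambda>x. g x $ i)"
  unfolding locally_integrable_def
proof (intro allI impI)
  fix K assume "compact K \<and> K \<subseteq> \<Omega>"
  then have "g absolutely_integrable_on K" using assms by (simp add: locally_integrable_def)
  from absolutely_integrable_linear[OF this bounded_linear_vec_nth[of i]]
  show "(\<lambda>x. g x $ i) absolutely_integrable_on K" by (simp add: o_def)
qed

lemma locally_integrable_diff:
  "locally_integrable \<Omega> f \<Longrightarrow> locally_integrable \<Omega> g \<Longrightarrow> locally_integrable \<Omega> (\<lambda>x. f x - g x)"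
  unfolding locally_integrable_def by (auto intro: set_integral_diff)

lemma has_weak_gradient_diff:
  assumes \<Omega>: "open \<Omega>" and w: "has_weak_gradient \<Omega> w g" and v: "has_weak_gradient \<Omega> v h"
  shows "has_weak_gradient \<Omega> (\<lambda>x. w x - v x) (\<lambda>x. g x - h x)"
  unfolding has_weak_gradient_def
proof (intro conjI ballI allI)
  show "locally_integrable \<Omega> (\<lambda>x. w x - v x)" "locally_integrable \<Omega> (\<lambda>x. g x - h x)"
    using w v by (auto simp: has_weak_gradient_def intro: locally_integrable_diff)
next
  fix \<eta> i assume \<eta>: "\<eta> \<in> test_functions \<Omega>"
  then obtain K where K: "compact K" "K \<subseteq> \<Omega>" "\<And>x. x \<notin> K \<Longrightarrow> \<eta> x = 0"
    "\<And>x. x \<notin> K \<Longrightarrow> frechet_derivative \<eta> (at x) = (\<lambda>_. 0)"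
    "continuous_on UNIV \<eta>" "\<And>v. continuous_on UNIV (\<lambda>x. frechet_derivative \<eta> (at x) v)"
    using test_functionE by metis
  note li = w[unfolded has_weak_gradient_def] v[unfolded has_weak_gradient_def]
  have 1: "integrable (lebesgue_on \<Omega>) (\<lambda>x. u x * frechet_derivative \<eta> (at x) (axis i 1))"
    if "locally_integrable \<Omega> u" for u
    by (rule locally_integrable_times_integrable[OF \<Omega> that K(6) K(1,2)]) (simp add: K(4))
  have 2: "integrable (lebesgue_on \<Omega>) (\<lambda>x. u x $ i * \<eta> x)"
    if "locally_integrable \<Omega> u" for u :: "real^'a \<Rightarrow> real^'a"
    by (rule locally_integrable_times_integrable[OF \<Omega> locally_integrable_component[OF that]
        K(5,1,2,3)])
  show "(\<integral>x. (w x - v x) * frechet_derivative \<eta> (at x) (axis i 1) \<partial>lebesgue_on \<Omega>) =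
        - (\<integral>x. (g x - h x) $ i * \<eta> x \<partial>lebesgue_on \<Omega>)"
    using li \<eta> by (simp add: left_diff_distrib 1 2)
qed

lemma has_weak_gradient_unique:
  assumes \<Omega>: "open \<Omega>" and "has_weak_gradient \<Omega> w g" "has_weak_gradient \<Omega> w h"
  shows "AE x in lebesgue_on \<Omega>. g x = h x"
proof -
  have d: "has_weak_gradient \<Omega> (\<lambda>x. 0) (\<lambda>x. g x - h x)"
    using has_weak_gradient_diff[OF assms] by simp
  have "AE x in lebesgue_on \<Omega>. (g x - h x) $ i = 0" for i
  proof (rule fundamental_lemma_calculus_of_variations[OF \<Omega>])
    show "locally_integrable \<Omega> (\<lambda>x. (g x - h x) $ i)"
      using d by (intro locally_integrable_component) (simp add: has_weak_gradient_def)
    show "(\<integral>x. (g x - h x) $ i * \<eta> x \<partial>lebesgue_on \<Omega>) = 0" if "\<eta> \<in> test_functions \<Omega>" for \<eta>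
      using d that unfolding has_weak_gradient_def by fastforce
  qed
  then have "AE x in lebesgue_on \<Omega>. \<forall>i. (g x - h x) $ i = 0"
    by (simp add: AE_all_countable)
  then show ?thesis by eventually_elim (simp add: vec_eq_iff)
qed

lemma has_weak_gradient_weak_gradient:
  "has_weak_gradient \<Omega> w g \<Longrightarrow> has_weak_gradient \<Omega> w (weak_gradient \<Omega> w)"
  unfolding weak_gradient_def by (rule someI[of "has_weak_gradient \<Omega> w"])

text \<open>
  Properties that ignore null sets can be read off any weak gradient, in particular off a classical
  gradient, in place of the chosen one.
\<close>

lemma weak_gradient_AE_eq:
  assumes "open \<Omega>" "has_weak_gradient \<Omega> w g"
  shows "AE x in lebesgue_on \<Omega>. weak_gradient \<Omega> w x = g x"
  using has_weak_gradient_unique[OF assms(1) has_weak_gradient_weak_gradient[OF assms(2)]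
      assms(2)] .

lemma weak_gradient_diff_AE_eq:
  assumes "open \<Omega>" "w \<in> W11 \<Omega>" "v \<in> W11 \<Omega>"
  shows "AE x in lebesgue_on \<Omega>.
    weak_gradient \<Omega> (\<lambda>x. w x - v x) x = weak_gradient \<Omega> w x - weak_gradient \<Omega> v x"
  using assms
  by (auto simp: W11_def intro!: weak_gradient_AE_eq has_weak_gradient_diff
      intro: has_weak_gradient_weak_gradient)

lemma borel_measurable_lebesgue_on_AE:
  fixes f :: "real^'n \<Rightarrow> 'b::euclidean_space"
  assumes \<Omega>: "\<Omega> \<in> sets lebesgue" and f: "f \<in> borel_measurable (lebesgue_on \<Omega>)"
    and ae: "AE x in lebesgue_on \<Omega>. f x = g x"
  shows "g \<in> borel_measurable (lebesgue_on \<Omega>)"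
proof -
  have "(\<lambda>x. indicator \<Omega> x *\<^sub>R f x) \<in> borel_measurable lebesgue"
    using f \<Omega> by (simp add: borel_measurable_restrict_space_iff)
  moreover have "AE x in lebesgue. indicator \<Omega> x *\<^sub>R f x = indicator \<Omega> x *\<^sub>R g x"
    using ae \<Omega> by (subst (asm) AE_restrict_space_iff)
        (auto simp: indicator_def elim: eventually_mono)
  ultimately have "(\<lambda>x. indicator \<Omega> x *\<^sub>R g x) \<in> borel_measurable lebesgue"
    by (rule borel_measurable_AE)
  with \<Omega> show ?thesis by (simp add: borel_measurable_restrict_space_iff)
qed

lemma integrable_weak_gradient:
  assumes "open \<Omega>" "has_weak_gradient \<Omega> w g" "integrable (lebesgue_on \<Omega>) g"
  shows "integrable (lebesgue_on \<Omega>) (weak_gradient \<Omega> w)"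
proof -
  have ae: "AE x in lebesgue_on \<Omega>. g x = weak_gradient \<Omega> w x"
    using weak_gradient_AE_eq[OF assms(1,2)] by eventually_elim simp
  have "weak_gradient \<Omega> w \<in> borel_measurable (lebesgue_on \<Omega>)"
    by (rule borel_measurable_lebesgue_on_AE[OF _ _ ae]) (use assms in auto)
  with ae assms(3) show ?thesis
    using integrable_cong_AE_imp[OF assms(3)] by fastforce
qed

section \<open>Integration in the plane along coordinate lines\<close>

abbreviation pt :: "real \<Rightarrow> real \<Rightarrow> real^2" where
  "pt t s \<equiv> vector [t, s]"

lemma pt_eq_axis: "pt t s = t *\<^sub>R axis 1 1 + s *\<^sub>R axis 2 1"
  by (simp add: vec_eq_iff forall_2 axis_def)

lemma continuous_on_pt [continuous_intros]:
  assumes "continuous_on A f" "continuous_on A g"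
  shows "continuous_on A (\<lambda>x. pt (f x) (g x))"
  unfolding pt_eq_axis by (intro continuous_intros assms)

lemma measurable_pt [measurable]: "(\<lambda>z. pt (fst z) (snd z)) \<in> borel_measurable (borel \<Otimes>\<^sub>M borel)"
  unfolding borel_prod
  by (intro borel_measurable_continuous_onI continuous_intros)

lemma measurable_pt' [measurable (raw)]:
  assumes "f \<in> borel_measurable M" "g \<in> borel_measurable M"
  shows "(\<lambda>z. pt (f z) (g z)) \<in> borel_measurable M"
  unfolding pt_eq_axis using assms by measurable

lemma Basis_plane: "(Basis :: (real^2) set) = {axis 1 1, axis 2 1}"
  by (auto simp: Basis_vec_def) (metis exhaust_2)

text \<open>
  Fubini's theorem for pairs is transported to \<^typ>\<open>real^2\<close> through this representation.
\<close>

lemma lborel_plane: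
  "(lborel :: (real^2) measure) = distr (lborel \<Otimes>\<^sub>M lborel) borel (\<lambda>z. pt (fst z) (snd z))"
proof (rule lborel_eqI)
  fix l u :: "real^2"
  assume le: "\<And>b. b \<in> Basis \<Longrightarrow> l \<bullet> b \<le> u \<bullet> b"
  have "(\<lambda>z. pt (fst z) (snd z)) -` box l u = {l $ 1<..<u $ 1} \<times> {l $ 2<..<u $ 2}"
    by (auto simp: mem_box_cart forall_2)
  moreover have "l $ 1 \<le> u $ 1" "l $ 2 \<le> u $ 2"
    using le[of "axis 1 1"] le[of "axis 2 1"] by (auto simp: Basis_plane inner_axis)
  moreover have "axis 1 (1::real) \<noteq> (axis 2 1 :: real^2)" by (simp add: axis_eq_axis)
  ultimately show "emeasure (distr (lborel \<Otimes>\<^sub>M lborel) borel (\<lambda>z. pt (fst z) (snd z))) (box l u)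
      = (\<Prod>b\<in>Basis. (u - l) \<bullet> b)"
    by (subst emeasure_distr)
       (auto simp: Basis_plane inner_axis space_pair_measure lborel.emeasure_pair_measure_Times
           ennreal_mult
          inner_diff_left)
qed simp

lemma nn_integral_plane:
  assumes [measurable]: "f \<in> borel_measurable borel"
  shows "(\<integral>\<^sup>+x. f x \<partial>lborel) = (\<integral>\<^sup>+s. \<integral>\<^sup>+t. f (pt t s) \<partial>lborel \<partial>lborel)" (is ?A)
    and "(\<integral>\<^sup>+x. f x \<partial>lborel) = (\<integral>\<^sup>+t. \<integral>\<^sup>+s. f (pt t s) \<partial>lborel \<partial>lborel)" (is ?B)
proof -
  have eq: "(\<integral>\<^sup>+x. f x \<partial>lborel) = (\<integral>\<^sup>+z. f (pt (fst z) (snd z)) \<partial>(lborel \<Otimes>\<^sub>M lborel))"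
    by (subst lborel_plane) (simp add: nn_integral_distr)
  show ?B unfolding eq by (subst lborel.nn_integral_fst[symmetric]) auto
  show ?A unfolding eq by (subst lborel_pair.nn_integral_snd[symmetric]) auto
qed

lemma integral_plane:
  fixes f :: "real^2 \<Rightarrow> real"
  assumes f: "integrable lborel f"
  shows "(\<integral>x. f x \<partial>lborel) = (\<integral>s. \<integral>t. f (pt t s) \<partial>lborel \<partial>lborel)" (is ?A)
    and "(\<integral>x. f x \<partial>lborel) = (\<integral>t. \<integral>s. f (pt t s) \<partial>lborel \<partial>lborel)" (is ?B)
proof -
  have [measurable]: "f \<in> borel_measurable borel" using f by auto
  have eq: "(\<integral>x. f x \<partial>lborel) = (\<integral>z. f (pt (fst z) (snd z)) \<partial>(lborel \<Otimes>\<^sub>M lborel))"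
    by (subst lborel_plane) (simp add: integral_distr)
  have "integrable (lborel \<Otimes>\<^sub>M lborel) (\<lambda>z. f (pt (fst z) (snd z)))"
    using f by (subst (asm) lborel_plane) (simp add: integrable_distr_eq)
  then have int: "integrable (lborel \<Otimes>\<^sub>M lborel) (\<lambda>(t, s). f (pt t s))"
    by (simp add: case_prod_beta')
  show ?A unfolding eq using lborel_pair.integral_snd[OF int] by (simp add: case_prod_beta')
  show ?B unfolding eq using lborel_pair.integral_fst'[OF int] by (simp add: case_prod_beta')
qed

text \<open>
  The fundamental theorem for the Henstock-Kurzweil integral accepts any everywhere defined
  derivative. If \<open>h'\<close> is not Lebesgue integrable, its Bochner integral is \<open>0\<close> by convention, so the
  conclusion holds in that case as well.
\<close>

lemma integral_derivative_zero:
  fixes h h' :: "real \<Rightarrow> real"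
  assumes der: "\<And>t. (h has_real_derivative h' t) (at t)"
    and zero: "\<And>t. t \<notin> {a<..<b} \<Longrightarrow> h t = 0" "\<And>t. t \<notin> {a..b} \<Longrightarrow> h' t = 0" and "a \<le> b"
  shows "(\<integral>t. h' t \<partial>lborel) = 0"
proof (cases "integrable lborel h'")
  case True
  have "(h' has_integral (h b - h a)) {a..b}"
    using der \<open>a \<le> b\<close>
    by (intro fundamental_theorem_of_calculus)
       (auto simp: has_real_derivative_iff_has_vector_derivative[symmetric] intro: DERIV_subset)
  then have "(h' has_integral 0) {a..b}" using zero(1)[of a] zero(1)[of b] by simp
  then have "(h' has_integral 0) UNIV"
    by (rule has_integral_on_superset[OF _ zero(2)]) auto
  with has_integral_integral_lborel[OF True] show ?thesis
    by (rule has_integral_unique)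
qed (rule not_integrable_integral_eq)

lemma GDERIV_line:
  assumes "GDERIV f (p + t *\<^sub>R v) :> d"
  shows "((\<lambda>t. f (p + t *\<^sub>R v)) has_real_derivative (d \<bullet> v)) (at t)"
proof -
  have "((\<lambda>t. p + t *\<^sub>R v) has_derivative (\<lambda>h. h *\<^sub>R v)) (at t)"
    by (auto intro!: derivative_eq_intros)
  from has_derivative_compose[OF this assms[unfolded gderiv_def]]
  show ?thesis
    by (simp add: has_field_derivative_def inner_commute mult.commute[of _ "d \<bullet> v"])
qed

text \<open>
  In each coordinate direction a single line passes through the origin. On every other line \<open>f\<close> is
  differentiable throughout and the one-dimensional statement applies.
\<close>

lemma integral_gradient_zero:
  fixes f :: "real^2 \<Rightarrow> real" and g :: "real^2 \<Rightarrow> real^2"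
  assumes der: "\<And>x. x \<noteq> 0 \<Longrightarrow> GDERIV f x :> g x"
    and zero: "\<And>x. x \<notin> square \<Longrightarrow> f x = 0" "\<And>x. x \<notin> square \<Longrightarrow> g x = 0"
    and int: "integrable lborel g"
  shows "(\<integral>x. g x $ i \<partial>lborel) = 0"
proof -
  have inti: "integrable lborel (\<lambda>x. g x $ i)" for i
    using integrable_bounded_linear[OF bounded_linear_vec_nth int] .
  have ae: "AE s in lborel. s \<noteq> (0::real)" by (rule AE_lborel_singleton)
  have pt0: "pt t s = 0 \<longleftrightarrow> t = 0 \<and> s = 0" for t s by (simp add: vec_eq_iff forall_2)
  have off: "pt t s \<notin> square" if "t \<notin> {-1<..<1} \<or> s \<notin> {-1<..<1}" for t s
    using that by (auto simp: square_def forall_2)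
  have 1: "(\<integral>t. g (pt t s) $ 1 \<partial>lborel) = 0" if "s \<noteq> 0" for s
  proof (rule integral_derivative_zero[where a="-1" and b=1])
    fix t
    have "pt 0 s + t *\<^sub>R axis 1 1 = pt t s" for t
      by (simp add: pt_eq_axis)
    then show "((\<lambda>t. f (pt t s)) has_real_derivative g (pt t s) $ 1) (at t)"
      using GDERIV_line[of f "pt 0 s" t "axis 1 1" "g (pt t s)"] der[of "pt t s"] that
      by (simp add: inner_axis pt0)
  next
    show "f (pt t s) = 0" if "t \<notin> {-1<..<1}" for t using that by (intro zero off) simp
    show "g (pt t s) $ 1 = 0" if "t \<notin> {-1..1}" for t using that by (subst zero) (auto intro!: off)
  qed simp
  have 2: "(\<integral>s. g (pt t s) $ 2 \<partial>lborel) = 0" if "t \<noteq> 0" for t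
  proof (rule integral_derivative_zero[where a="-1" and b=1])
    fix s
    have "pt t 0 + s *\<^sub>R axis 2 1 = pt t s" for s
      by (simp add: pt_eq_axis)
    then show "((\<lambda>s. f (pt t s)) has_real_derivative g (pt t s) $ 2) (at s)"
      using GDERIV_line[of f "pt t 0" s "axis 2 1" "g (pt t s)"] der[of "pt t s"] that
      by (simp add: inner_axis pt0)
  next
    show "f (pt t s) = 0" if "s \<notin> {-1<..<1}" for s using that by (intro zero off) simp
    show "g (pt t s) $ 2 = 0" if "s \<notin> {-1..1}" for s using that by (subst zero) (auto intro!: off)
  qed simp
  have "AE s in lborel. (\<integral>t. g (pt t s) $ 1 \<partial>lborel) = 0"
    using ae by eventually_elim (rule 1)
  then have "(\<integral>x. g x $ 1 \<partial>lborel) = 0"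
    unfolding integral_plane(1)[OF inti] by (rule integral_eq_zero_AE)
  moreover have "AE t in lborel. (\<integral>s. g (pt t s) $ 2 \<partial>lborel) = 0"
    using ae by eventually_elim (rule 2)
  then have "(\<integral>x. g x $ 2 \<partial>lborel) = 0"
    unfolding integral_plane(2)[OF inti] by (rule integral_eq_zero_AE)
  ultimately show ?thesis using exhaust_2[of i] by auto
qed

lemma measurable_nth [measurable]: "(\<lambda>x::real^'n. x $ i) \<in> borel_measurable borel"
  by (intro borel_measurable_continuous_onI continuous_intros)

section \<open>Integrability on cones\<close>

abbreviation vertical_cone :: "(real^2) set" where
  "vertical_cone \<equiv> {x. \<bar>x $ 1\<bar> \<le> \<bar>x $ 2\<bar> \<and> \<bar>x $ 2\<bar> \<le> 1}"

abbreviation horizontal_cone :: "(real^2) set" where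
  "horizontal_cone \<equiv> {x. \<bar>x $ 2\<bar> \<le> \<bar>x $ 1\<bar> \<and> \<bar>x $ 1\<bar> \<le> 1}"

lemma nn_integral_even_finite:
  fixes k :: "real \<Rightarrow> ennreal"
  assumes [measurable]: "(\<lambda>s. k \<bar>s\<bar>) \<in> borel_measurable borel" and k0: "k 0 = 0"
    and fin: "(\<integral>\<^sup>+s\<in>{0<..}. k s \<partial>lborel) < \<infinity>"
  shows "(\<integral>\<^sup>+s. k \<bar>s\<bar> \<partial>lborel) < \<infinity>"
proof -
  have "(\<integral>\<^sup>+s. k \<bar>s\<bar> \<partial>lborel) =
      (\<integral>\<^sup>+s. k \<bar>s\<bar> * indicator {0<..} s + k \<bar>s\<bar> * indicator {..<0} s \<partial>lborel)"
    using k0 by (intro nn_integral_cong) (auto simp: indicator_def not_less split: if_splits)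
  also have "\<dots> = (\<integral>\<^sup>+s. k \<bar>s\<bar> * indicator {0<..} s \<partial>lborel)
      + (\<integral>\<^sup>+s. k \<bar>s\<bar> * indicator {..<0} s \<partial>lborel)"
    by (intro nn_integral_add) auto
  also have "(\<integral>\<^sup>+s. k \<bar>s\<bar> * indicator {..<0} s \<partial>lborel)
      = (\<integral>\<^sup>+s. k \<bar>s\<bar> * indicator {0<..} s \<partial>lborel)"
    by (subst nn_integral_real_affine[where c="-1" and t=0])
        (auto simp: indicator_def intro!: nn_integral_cong)
  also have "(\<integral>\<^sup>+s. k \<bar>s\<bar> * indicator {0<..} s \<partial>lborel) = (\<integral>\<^sup>+s\<in>{0<..}. k s \<partial>lborel)"
    by (intro nn_integral_cong) (auto simp: indicator_def)
  finally show ?thesis using fin by (simp add: ennreal_add_less_top)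
qed

text \<open>
  The horizontal slice of the vertical cone at height \<open>s\<close> has length \<open>2 * \<bar>s\<bar>\<close>. This is the origin
  of the factor \<open>r\<close> in the two convergence hypotheses of the theorem.
\<close>

lemma cone_integral_finite:
  fixes F :: "real \<Rightarrow> ennreal"
  assumes F[measurable]: "(\<lambda>s. F \<bar>s\<bar>) \<in> borel_measurable borel"
    and fin: "(\<integral>\<^sup>+r\<in>{0<..1}. F (1 / r) * ennreal r \<partial>lborel) < \<infinity>"
  shows "(\<integral>\<^sup>+x\<in>vertical_cone. F (1 / \<bar>x $ 2\<bar>) \<partial>(lborel :: (real^2) measure)) < \<infinity>" (is "?A < _")
    and "(\<integral>\<^sup>+x\<in>horizontal_cone. F (1 / \<bar>x $ 1\<bar>) \<partial>(lborel :: (real^2) measure)) < \<infinity>" (is "?B < _")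
proof -
  have F'[measurable]: "(\<lambda>s. F (1 / \<bar>s\<bar>)) \<in> borel_measurable borel"
    using measurable_compose[OF _ F, of "\<lambda>s. 1 / s" borel] by simp
  have Fi[measurable]: "(\<lambda>x::real^2. F (1 / \<bar>x $ i\<bar>)) \<in> borel_measurable borel" for i
    using measurable_compose[OF measurable_nth F', of i] by simp
  let ?k = "\<lambda>r. F (1 / r) * indicator {..1} r * ennreal (2 * r)"
  let ?I = "\<integral>\<^sup>+s. \<integral>\<^sup>+t. F (1 / \<bar>s\<bar>) * indicator {..1} \<bar>s\<bar> * indicator {- \<bar>s\<bar>..\<bar>s\<bar>} t \<partial>lborel
      \<partial>lborel"
  have "?I = (\<integral>\<^sup>+s. ?k \<bar>s\<bar> \<partial>lborel)"
    by (intro nn_integral_cong) (simp add: nn_integral_cmult)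
  also have "\<dots> < \<infinity>"
  proof (rule nn_integral_even_finite)
    have "(\<integral>\<^sup>+r\<in>{0<..}. ?k r \<partial>lborel) = (\<integral>\<^sup>+r. 2 *
        (F (1 / \<bar>r\<bar>) * ennreal \<bar>r\<bar> * indicator {0<..1} r) \<partial>lborel)"
      by (intro nn_integral_cong) (auto simp: indicator_def ennreal_mult mult_ac)
    also have "\<dots> = 2 * (\<integral>\<^sup>+r. F (1 / \<bar>r\<bar>) * ennreal \<bar>r\<bar> * indicator {0<..1} r \<partial>lborel)"
      by (intro nn_integral_cmult) auto
    also have "(\<integral>\<^sup>+r. F (1 / \<bar>r\<bar>) * ennreal \<bar>r\<bar> * indicator {0<..1} r \<partial>lborel)
        = (\<integral>\<^sup>+r\<in>{0<..1}. F (1 / r) * ennreal r \<partial>lborel)"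
      by (intro nn_integral_cong) (auto simp: indicator_def)
    finally show "(\<integral>\<^sup>+r\<in>{0<..}. ?k r \<partial>lborel) < \<infinity>"
      using fin by (simp add: ennreal_mult_less_top)
  qed simp_all
  finally have I: "?I < \<infinity>" .
  have "?A = ?I"
    by (subst nn_integral_plane(1)) (auto intro!: nn_integral_cong simp: indicator_def)
  with I show "?A < \<infinity>" by simp
  have "?B = ?I"
    by (subst nn_integral_plane(2)) (auto intro!: nn_integral_cong simp: indicator_def)
  with I show "?B < \<infinity>" by simp
qed

lemma abs_nth_le_norm: "\<bar>(x::real^2) $ i\<bar> \<le> norm x"
  using component_le_norm_cart .

text \<open>
  Each point lies in the cone in which the absolute value of one of its coordinates dominates, and
  there \<open>norm x\<close> is bounded below by that coordinate.
\<close>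

lemma integrable_inverse_norm_square:
  "integrable lborel (\<lambda>x::real^2. indicator square x * (1 / norm x))"
proof -
  have sq[measurable]: "square \<in> sets borel"
    unfolding square_def by measurable
  have fin: "(\<integral>\<^sup>+r\<in>{0<..1}. ennreal (1 / r) * ennreal r \<partial>lborel) < \<infinity>"
  proof -
    have "(\<integral>\<^sup>+r\<in>{0<..1}. ennreal (1 / r) * ennreal r \<partial>lborel)
        = (\<integral>\<^sup>+r. indicator {0<..1::real} r \<partial>lborel)"
      by (intro nn_integral_cong) (auto simp: indicator_def ennreal_mult'[symmetric])
    then show ?thesis by simp
  qed
  note cone = cone_integral_finite[of ennreal, OF _ fin]
  let ?A = vertical_cone
  let ?B = horizontal_cone
  have "(\<integral>\<^sup>+x. ennreal (norm (indicator square x * (1 / norm x))) \<partial>(lborel :: (real^2) measure))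
     \<le> (\<integral>\<^sup>+x. ennreal (1 / \<bar>x $ 2\<bar>) * indicator ?A x + ennreal (1 / \<bar>x $ 1\<bar>) * indicator ?B x
         \<partial>lborel)"
  proof (rule nn_integral_mono)
    fix x :: "real^2"
    have le: "1 / norm x \<le> 1 / \<bar>x $ i\<bar>" if "x $ i \<noteq> 0" for i
      using abs_nth_le_norm[of x i] that by (intro frac_le) auto
    have sq: "x \<in> square \<Longrightarrow> \<bar>x $ 1\<bar> < 1 \<and> \<bar>x $ 2\<bar> < 1" by (auto simp: square_def abs_less_iff)
    have x0: "x $ 1 = 0 \<Longrightarrow> x $ 2 = 0 \<Longrightarrow> x = 0" by (simp add: vec_eq_iff forall_2)
    show "ennreal (norm (indicator square x * (1 / norm x)))
        \<le> ennreal (1 / \<bar>x $ 2\<bar>) * indicator ?A x + ennreal (1 / \<bar>x $ 1\<bar>) * indicator ?B x"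
    proof (cases "x \<in> square \<and> x \<noteq> 0")
      case True
      then consider "x \<in> ?A" "x $ 2 \<noteq> 0" | "x \<in> ?B" "x $ 1 \<noteq> 0"
        using sq x0 by fastforce
      then show ?thesis
      proof cases
        case 1
        then have "ennreal (norm (indicator square x * (1 / norm x)))
            \<le> ennreal (1 / \<bar>x $ 2\<bar>) * indicator ?A x"
          using True le[of 2] by (auto simp: indicator_def intro!: ennreal_leI)
        then show ?thesis by (rule order_trans) simp
      next
        case 2
        then have "ennreal (norm (indicator square x * (1 / norm x)))
            \<le> ennreal (1 / \<bar>x $ 1\<bar>) * indicator ?B x"
          using True le[of 1] by (auto simp: indicator_def intro!: ennreal_leI)
        then show ?thesis by (rule order_trans) simp
      qed
    qed (auto simp: indicator_def)
  qed
  also have "\<dots> = (\<integral>\<^sup>+x\<in>?A. ennreal (1 / \<bar>x $ 2\<bar>) \<partial>lborel) +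
      (\<integral>\<^sup>+x\<in>?B. ennreal (1 / \<bar>x $ 1\<bar>) \<partial>lborel)"
    by (intro nn_integral_add) measurable
  also have "\<dots> < \<infinity>" using cone by (simp add: ennreal_add_less_top)
  finally show ?thesis by (intro integrableI_bounded) auto
qed

section \<open>Functions with a singularity at the origin\<close>

lemma open_square: "open square"
proof -
  have "square = box (vector [-1, -1]) (vector [1, 1] :: real^2)"
    by (auto simp: square_def mem_box_cart forall_2)
  then show ?thesis by (metis open_box)
qed

lemma square_borel [measurable]: "square \<in> sets borel"
  using open_square by simp

lemma norm_square_le: "x \<in> square \<Longrightarrow> norm x \<le> 2"
  using norm_le_l1_cart[of x] by (auto simp: square_def sum_2 forall_2)

lemma measurable_off_origin:
  fixes f :: "real^2 \<Rightarrow> 'b::euclidean_space"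
  assumes f: "continuous_on (square - {0}) f" and [measurable]: "K \<in> sets borel" and "K \<subseteq> square"
  shows "(\<lambda>x. indicator K x *\<^sub>R f x) \<in> borel_measurable borel"
proof -
  have [measurable]: "(\<lambda>x. indicator (square - {0}) x *\<^sub>R f x) \<in> borel_measurable borel"
    by (rule borel_measurable_continuous_on_indicator[OF _ f]) measurable
  have "(\<lambda>x. indicator K x *\<^sub>R f x) =
      (\<lambda>x. if x = 0 then indicator K 0 *\<^sub>R f 0 else indicator K x *\<^sub>R
          (indicator (square - {0}) x *\<^sub>R f x))"
    using \<open>K \<subseteq> square\<close> by (auto simp: indicator_def fun_eq_iff)
  also have "\<dots> \<in> borel_measurable borel" by measurable
  finally show ?thesis .
qed

lemma integrable_off_origin:
  fixes f :: "real^2 \<Rightarrow> 'b::euclidean_space"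
  assumes f: "continuous_on (square - {0}) f" and K: "K \<in> sets borel" "K \<subseteq> square"
    and bound: "\<And>x. x \<in> K \<Longrightarrow> x \<noteq> 0 \<Longrightarrow> norm (f x) \<le> C / norm x"
  shows "integrable lborel (\<lambda>x. indicator K x *\<^sub>R f x)"
proof (rule Bochner_Integration.integrable_bound)
  show "integrable lborel (\<lambda>x::real^2. C * (indicator square x * (1 / norm x)))"
    by (intro integrable_mult_right integrable_inverse_norm_square)
  show "(\<lambda>x. indicator K x *\<^sub>R f x) \<in> borel_measurable lborel"
    using measurable_off_origin[OF f K] by simp
  have "norm (indicator K x *\<^sub>R f x) \<le> norm (C * (indicator square x * (1 / norm x)))" if
      "x \<noteq> 0" for x
    using bound[of x] that K(2) by (auto simp: indicator_def intro!:
        order_trans[OF _ divide_right_mono[OF abs_ge_self]])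
  then show "AE x in lborel. norm (indicator K x *\<^sub>R f x)
      \<le> norm (C * (indicator square x * (1 / norm x)))"
    using AE_lborel_singleton[of "0::real^2"] by (auto elim: eventually_mono)
qed

lemma absolutely_integrable_on_lborelI:
  fixes f :: "real^'n \<Rightarrow> 'b::euclidean_space"
  assumes "integrable lborel (\<lambda>x. indicator K x *\<^sub>R f x)"
  shows "f absolutely_integrable_on K"
  unfolding set_integrable_def
  using assms borel_measurable_integrable[OF assms] by (subst integrable_completion) auto

lemma GDERIV_frechet_derivative:
  fixes f :: "real^'n \<Rightarrow> real"
  assumes "(f has_derivative D) (at x)"
  shows "GDERIV f x :> (\<chi> i. D (axis i 1))"
proof -
  have "D h = h \<bullet> (\<chi> i. D (axis i 1))" for h
  proof -
    interpret bounded_linear D using assms by (rule has_derivative_bounded_linear)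
    have "D h = D (\<Sum>i\<in>UNIV. h $ i *\<^sub>R axis i 1)"
      using basis_expansion[of h] by (simp add: scalar_mult_eq_scaleR)
    then show ?thesis by (simp add: sum scaleR inner_vec_def)
  qed
  then have "D = (\<lambda>h. h \<bullet> (\<chi> i. D (axis i 1)))" by blast
  with assms show ?thesis by (simp add: gderiv_def)
qed

lemma GDERIV_transform_within_open:
  assumes "GDERIV f x :> d" "open S" "x \<in> S" "\<And>y. y \<in> S \<Longrightarrow> f y = g y"
  shows "GDERIV g x :> d"
  using assms unfolding gderiv_def by (rule has_derivative_transform_within_open)

lemma GDERIV_imp_frechet_derivative:
  fixes f :: "real^'n \<Rightarrow> real"
  shows "GDERIV f x :> d \<Longrightarrow> frechet_derivative f (at x) (axis i 1) = d $ i"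
  by (simp add: gderiv_def frechet_derivative_at[symmetric] inner_axis')

definition gradient :: "(real^'n \<Rightarrow> real) \<Rightarrow> real^'n \<Rightarrow> real^'n" where
  "gradient f x = (\<chi> i. frechet_derivative f (at x) (axis i 1))"

lemma GDERIV_imp_gradient:
  fixes f :: "real^'n \<Rightarrow> real"
  shows "GDERIV f x :> d \<Longrightarrow> gradient f x = d"
  by (simp add: gradient_def vec_eq_iff GDERIV_imp_frechet_derivative)

lemma continuous_on_gradient:
  assumes "\<And>v. continuous_on S (\<lambda>x. frechet_derivative f (at x) v)"
  shows "continuous_on S (gradient f)"
  unfolding gradient_def[abs_def] using assms by (intro continuous_on_vec_lambda)

lemma test_function_gradientE:
  assumes "\<eta> \<in> test_functions \<Omega>"
  obtains K where "compact K" "K \<subseteq> \<Omega>" "\<And>x. x \<notin> K \<Longrightarrow> \<eta> x = 0" "\<And>x. x \<notin> K \<Longrightarrow> gradient \<eta> x = 0"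
    "\<And>x. GDERIV \<eta> x :> gradient \<eta> x" "continuous_on UNIV \<eta>" "continuous_on UNIV (gradient \<eta>)"
proof -
  from assms obtain K where K: "compact K" "K \<subseteq> \<Omega>" "\<And>x. x \<notin> K \<Longrightarrow> \<eta> x = 0"
    "\<And>x. x \<notin> K \<Longrightarrow> frechet_derivative \<eta> (at x) = (\<lambda>_. 0)"
    "\<And>x. (\<eta> has_derivative frechet_derivative \<eta> (at x)) (at x)"
    "continuous_on UNIV \<eta>" "\<And>v. continuous_on UNIV (\<lambda>x. frechet_derivative \<eta> (at x) v)"
    using test_functionE by metis
  show ?thesis
  proof (rule that[OF K(1,2,3)])
    show "gradient \<eta> x = 0" if "x \<notin> K" for x
      using K(4)[OF that] by (simp add: gradient_def vec_eq_iff)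
    show "GDERIV \<eta> x :> gradient \<eta> x" for x
      unfolding gradient_def by (rule GDERIV_frechet_derivative[OF K(5)])
    show "continuous_on UNIV (gradient \<eta>)" by (rule continuous_on_gradient[OF K(7)])
  qed (use K(6) in auto)
qed

lemma continuous_UNIV_bounded_on_compact:
  fixes f :: "'a::euclidean_space \<Rightarrow> 'b::real_normed_vector"
  assumes "continuous_on UNIV f" "compact K"
  obtains M where "M \<ge> 0" "\<And>x. x \<in> K \<Longrightarrow> norm (f x) \<le> M"
proof -
  have "bounded (f ` K)"
    using assms by (intro compact_imp_bounded compact_continuous_image)
        (auto intro: continuous_on_subset)
  then obtain M where "\<forall>y\<in>f ` K. norm y \<le> M" unfolding bounded_iff by blast
  then show ?thesis by (intro that[of "max 0 M"]) (auto simp: max.coboundedI2)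
qed

text \<open>
  Multiplied by a test function, \<open>f\<close> remains differentiable off the origin and its gradient is
  dominated by a multiple of \<open>1 / norm x\<close>, hence integrable. Therefore \<open>integral_gradient_zero\<close>
  applies to the product, and it is the integration by parts formula.
\<close>

lemma has_weak_gradient_off_origin:
  assumes der: "\<And>x. x \<in> square \<Longrightarrow> x \<noteq> 0 \<Longrightarrow> GDERIV f x :> g x"
    and cont: "continuous_on (square - {0}) g"
    and bound: "\<And>K. compact K \<Longrightarrow> K \<subseteq> square \<Longrightarrow>
      \<exists>C. \<forall>x\<in>K - {0}. \<bar>f x\<bar> \<le> C / norm x \<and> norm (g x) \<le> C / norm x"
  shows "has_weak_gradient square f g"
proof -
  have contf: "continuous_on (square - {0}) f"
    using der by (intro continuous_at_imp_continuous_on)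
      (auto simp: gderiv_def intro: has_derivative_continuous)
  have "f absolutely_integrable_on K \<and> g absolutely_integrable_on K" if K: "compact K"
      "K \<subseteq> square" for K
  proof -
    obtain C where C: "\<And>x. x \<in> K \<Longrightarrow> x \<noteq> 0 \<Longrightarrow> \<bar>f x\<bar> \<le> C / norm x \<and> norm (g x) \<le> C / norm x"
      using bound[OF K] by blast
    have "K \<in> sets borel" using K by (simp add: borel_compact)
    from integrable_off_origin[OF contf this K(2), of C]
        integrable_off_origin[OF cont this K(2), of C]
    show ?thesis using C by (auto intro: absolutely_integrable_on_lborelI)
  qed
  then have lif: "locally_integrable square f" and lig: "locally_integrable square g"
    by (auto simp: locally_integrable_def)
  show ?thesis
    unfolding has_weak_gradient_def
  proof (intro conjI lif lig ballI allI)
    fix \<eta> i assume "\<eta> \<in> test_functions square"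
    then obtain K where K: "compact K" "K \<subseteq> square" "\<And>x. x \<notin> K \<Longrightarrow> \<eta> x = 0"
        "\<And>x. x \<notin> K \<Longrightarrow> gradient \<eta> x = 0"
      and \<eta>: "\<And>x. GDERIV \<eta> x :> gradient \<eta> x" "continuous_on UNIV \<eta>"
          "continuous_on UNIV (gradient \<eta>)"
      using test_function_gradientE by metis
    obtain C where C: "\<And>x. x \<in> K \<Longrightarrow> x \<noteq> 0 \<Longrightarrow> \<bar>f x\<bar> \<le> C / norm x \<and> norm (g x) \<le> C / norm x"
      using bound[OF K(1,2)] by blast
    obtain M1 where M1: "M1 \<ge> 0" "\<And>x. x \<in> K \<Longrightarrow> norm (\<eta> x) \<le> M1"
      using continuous_UNIV_bounded_on_compact[OF \<eta>(2) K(1)] by metis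
    obtain M2 where M2: "M2 \<ge> 0" "\<And>x. x \<in> K \<Longrightarrow> norm (gradient \<eta> x) \<le> M2"
      using continuous_UNIV_bounded_on_compact[OF \<eta>(3) K(1)] by metis
    define G where "G x = indicator K x *\<^sub>R (f x *\<^sub>R gradient \<eta> x + \<eta> x *\<^sub>R g x)" for x
    have intG: "integrable lborel G"
      unfolding G_def[abs_def]
    proof (rule integrable_off_origin)
      show "continuous_on (square - {0}) (\<lambda>x. f x *\<^sub>R gradient \<eta> x + \<eta> x *\<^sub>R g x)"
        by (intro continuous_intros contf cont continuous_on_subset[OF \<eta>(2)]
            continuous_on_subset[OF \<eta>(3)]) auto
      fix x assume x: "x \<in> K" "x \<noteq> 0"
      have "norm (f x *\<^sub>R gradient \<eta> x + \<eta> x *\<^sub>R g x)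
          \<le> \<bar>f x\<bar> * norm (gradient \<eta> x) + \<bar>\<eta> x\<bar> * norm (g x)"
        using norm_triangle_ineq[of "f x *\<^sub>R gradient \<eta> x" "\<eta> x *\<^sub>R g x"] by simp
      also have "\<dots> \<le> (C / norm x) * M2 + M1 * (C / norm x)"
        using C[OF x] M1 M2 x by (intro add_mono mult_mono) auto
      also have "\<dots> = C * (M1 + M2) / norm x" using x by (simp add: field_simps)
      finally show "norm (f x *\<^sub>R gradient \<eta> x + \<eta> x *\<^sub>R g x) \<le> C * (M1 + M2) / norm x" .
    qed (use K in \<open>auto simp: borel_compact\<close>)
    let ?F = "\<lambda>x. if x \<in> square then f x * \<eta> x else 0"
    have "(\<integral>x. G x $ i \<partial>lborel) = 0"
    proof (rule integral_gradient_zero[where f="?F"])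
      fix x :: "real^2" assume "x \<noteq> 0"
      show "GDERIV ?F x :> G x"
      proof (cases "x \<in> square")
        case True
        have "GDERIV (\<lambda>x. f x * \<eta> x) x :> f x *\<^sub>R gradient \<eta> x + \<eta> x *\<^sub>R g x"
          by (intro GDERIV_mult der \<eta> True \<open>x \<noteq> 0\<close>)
        also have "f x *\<^sub>R gradient \<eta> x + \<eta> x *\<^sub>R g x = G x"
          using K(3,4)[of x] by (auto simp: G_def indicator_def)
        finally show ?thesis
          by (rule GDERIV_transform_within_open[OF _ open_square True]) simp
      next
        case False
        have "GDERIV (\<lambda>_. 0) x :> (0::real^2)" by (rule GDERIV_const)
        then have "GDERIV ?F x :> 0"
        proof (rule GDERIV_transform_within_open)
          show "open (- K)" "x \<in> - K" using K False by (auto intro: compact_imp_closed)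
        qed (use K(3) in auto)
        then show ?thesis using False K(2) by (auto simp: G_def indicator_def)
      qed
    next
      show "G x = 0" if "x \<notin> square" for x using that K(2) by (auto simp: G_def indicator_def)
    qed (simp_all add: intG)
    have Gi: "G x $ i = indicator square x *\<^sub>R
        (f x * frechet_derivative \<eta> (at x) (axis i 1) + g x $ i * \<eta> x)" for x
    proof (cases "x \<in> K")
      case True
      with K(2) show ?thesis by (auto simp: G_def gradient_def)
    next
      case False
      then show ?thesis using K(3,4)[OF False] by (auto simp: G_def gradient_def vec_eq_iff)
    qed
    have "(\<integral>x. f x * frechet_derivative \<eta> (at x) (axis i 1) + g x $ i * \<eta> x \<partial>lebesgue_on square)
        = (\<integral>x. G x $ i \<partial>lebesgue)"
      by (subst integral_restrict_space) (simp_all add: Gi)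
    also have "\<dots> = (\<integral>x. G x $ i \<partial>lborel)"
      using intG by (intro integral_completion) auto
    also have "\<dots> = 0" by fact
    finally have "(\<integral>x. f x * frechet_derivative \<eta> (at x) (axis i 1) + g x $ i * \<eta> x \<partial>lebesgue_on
        square) = 0" .
    moreover have "integrable (lebesgue_on square)
        (\<lambda>x. f x * frechet_derivative \<eta> (at x) (axis i 1))"
    proof (rule locally_integrable_times_integrable[OF open_square lif _ K(1,2)])
      show "continuous_on UNIV (\<lambda>x. frechet_derivative \<eta> (at x) (axis i 1))"
        using continuous_on_component[OF \<eta>(3), of i] by (simp add: gradient_def)
      show "frechet_derivative \<eta> (at x) (axis i 1) = 0" if "x \<notin> K" for x
        using K(4)[OF that] by (simp add: gradient_def vec_eq_iff)
    qed
    moreover have "integrable (lebesgue_on square) (\<lambda>x. g x $ i * \<eta> x)"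
      by (rule locally_integrable_times_integrable[OF open_square
          locally_integrable_component[OF lig] \<eta>(2) K(1,2,3)])
    ultimately show "(\<integral>x. f x * frechet_derivative \<eta> (at x) (axis i 1) \<partial>lebesgue_on square)
        = - (\<integral>x. g x $ i * \<eta> x \<partial>lebesgue_on square)"
      by simp
  qed
qed

lemma smooth_GDERIV:
  assumes "higher_differentiable_on (Suc 0) S f" "x \<in> S"
  shows "GDERIV f x :> gradient f x"
proof -
  have "f differentiable at x" using assms unfolding higher_differentiable_on.simps by blast
  then show ?thesis
    unfolding gradient_def using frechet_derivative_works by (intro GDERIV_frechet_derivative) blast
qed

text \<open>
  A smooth function is bounded on compact sets, and a constant is at most a multiple of
  \<open>1 / norm x\<close> on the square.
\<close>

lemma smooth_function_has_weak_gradient: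
  assumes "f \<in> smooth_functions square"
  shows "has_weak_gradient square f (gradient f)"
    and "\<And>x. x \<in> square \<Longrightarrow> GDERIV f x :> gradient f x"
    and "continuous_on square (gradient f)" and "continuous_on square f"
proof -
  have smooth: "higher_differentiable_on k square f" for k
    using assms by (simp add: smooth_functions_def)
  show der: "GDERIV f x :> gradient f x" if "x \<in> square" for x
    by (rule smooth_GDERIV[OF smooth that])
  show cont: "continuous_on square (gradient f)"
    using smooth[of "Suc 0"] unfolding higher_differentiable_on.simps
        by (intro continuous_on_gradient) blast
  show contf: "continuous_on square f" using smooth[of 0] by simp
  show "has_weak_gradient square f (gradient f)"
  proof (rule has_weak_gradient_off_origin)
    fix K assume K: "compact K" "K \<subseteq> (square :: (real^2) set)"
    have "bounded (f ` K)" "bounded (gradient f ` K)"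
      using continuous_on_subset[OF contf K(2)] continuous_on_subset[OF cont K(2)] K(1)
      by (simp_all add: compact_imp_bounded compact_continuous_image)
    then obtain B1 B2 where B: "\<forall>y\<in>f ` K. norm y \<le> B1" "\<forall>y\<in>gradient f ` K. norm y \<le> B2"
      unfolding bounded_iff by blast
    have le: "c \<le> 2 * max B1 B2 / norm x" if "x \<in> K" "x \<noteq> 0" "c \<le> max B1 B2"
        "0 \<le> c" for c and x :: "real^2"
    proof -
      have "c * norm x \<le> max B1 B2 * 2"
        using that K(2) norm_square_le[of x] by (intro mult_mono) auto
      then show ?thesis using that by (simp add: field_simps)
    qed
    show "\<exists>C. \<forall>x\<in>K - {0}. \<bar>f x\<bar> \<le> C / norm x \<and> norm (gradient f x) \<le> C / norm x"
    proof (intro exI[of _ "2 * max B1 B2"] ballI)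
      fix x assume x: "x \<in> K - {0}"
      then have "\<bar>f x\<bar> \<le> max B1 B2" "norm (gradient f x) \<le> max B1 B2"
        using B by (auto simp: max.coboundedI1 max.coboundedI2)
      with x le[of x] show "\<bar>f x\<bar> \<le> 2 * max B1 B2 / norm x \<and> norm (gradient f x)
          \<le> 2 * max B1 B2 / norm x"
        by auto
    qed
  qed (use der continuous_on_subset[OF cont] in auto)
qed

section \<open>The ray field\<close>

text \<open>
  This is the gradient of \<open>x $ 1 / \<bar>x $ 2\<bar>\<close> rotated by a right angle, restricted to the vertical
  cone. It flows upwards along the lines through the origin, from the lower half of the cone to the
  upper one, and is divergence free across the origin.
\<close>

definition ray_field :: "real^2 \<Rightarrow> real^2" where
  "ray_field x = (if \<bar>x $ 1\<bar> < \<bar>x $ 2\<bar> then (1 / \<bar>x $ 2\<bar>) *\<^sub>R pt (x $ 1 / x $ 2) 1 else 0)"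

lemma measurable_ray_field [measurable]: "ray_field \<in> borel_measurable borel"
  unfolding ray_field_def[abs_def] by measurable

lemma norm_pt_le: "norm (pt t s) \<le> \<bar>t\<bar> + \<bar>s\<bar>"
  using norm_le_l1_cart[of "pt t s"] by (simp add: sum_2)

lemma norm_ray_field_le: "norm (ray_field x) \<le> 2 * (1 / \<bar>x $ 2\<bar>)"
proof (cases "\<bar>x $ 1\<bar> < \<bar>x $ 2\<bar>")
  case True
  then have "\<bar>x $ 1 / x $ 2\<bar> \<le> 1" by (simp add: field_simps)
  with norm_pt_le[of "x $ 1 / x $ 2" 1] have "norm (pt (x $ 1 / x $ 2) 1) \<le> 2" by simp
  with True show ?thesis by (simp add: ray_field_def divide_right_mono)
qed (simp add: ray_field_def)

lemma nn_integral_ray_field_finite: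
  "(\<integral>\<^sup>+x\<in>{x. \<bar>x $ 2\<bar> \<le> 1}. norm (ray_field x) \<partial>lborel) < \<infinity>"
proof -
  have fin: "(\<integral>\<^sup>+r\<in>{0<..1}. ennreal (2 * (1 / r)) * ennreal r \<partial>lborel) < \<infinity>"
  proof -
    have "(\<integral>\<^sup>+r\<in>{0<..1}. ennreal (2 * (1 / r)) * ennreal r \<partial>lborel)
        = (\<integral>\<^sup>+r. 2 * indicator {0<..1::real} r \<partial>lborel)"
      by (intro nn_integral_cong) (auto simp: indicator_def ennreal_mult'[symmetric])
    then show ?thesis by (simp add: nn_integral_cmult)
  qed
  have "(\<integral>\<^sup>+x\<in>{x. \<bar>x $ 2\<bar> \<le> 1}. norm (ray_field x) \<partial>lborel)
    \<le> (\<integral>\<^sup>+x\<in>vertical_cone. ennreal (2 * (1 / \<bar>x $ 2\<bar>)) \<partial>(lborel :: (real^2) measure))"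
  proof (rule nn_integral_mono)
    fix x :: "real^2"
    show "ennreal (norm (ray_field x)) * indicator {x. \<bar>x $ 2\<bar> \<le> 1} x
      \<le> ennreal (2 * (1 / \<bar>x $ 2\<bar>)) * indicator vertical_cone x"
    proof (cases "\<bar>x $ 1\<bar> \<le> \<bar>x $ 2\<bar>")
      case True
      then show ?thesis using norm_ray_field_le[of x]
          by (auto simp: indicator_def intro!: ennreal_leI)
    qed (auto simp: ray_field_def)
  qed
  also have "\<dots> < \<infinity>"
    using cone_integral_finite(1)[of "\<lambda>r. ennreal (2 * r)", OF _ fin] by simp
  finally show ?thesis .
qed

lemma integrable_ray_field_inner_lborel:
  fixes g :: "real^2 \<Rightarrow> real^2"
  assumes cont: "continuous_on UNIV g" and [measurable]: "A \<in> sets borel"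
    and A: "A \<subseteq> {x. \<bar>x $ 2\<bar> \<le> 1}"
  shows "integrable lborel (\<lambda>x. indicator A x * (ray_field x \<bullet> g x))" (is "integrable _ ?h")
proof (rule integrableI_bounded)
  have [measurable]: "g \<in> borel_measurable borel"
    using cont by (rule borel_measurable_continuous_onI)
  obtain M where M: "M \<ge> 0" "\<And>x. x \<in> cbox (pt (-1) (-1)) (pt 1 1) \<Longrightarrow> norm (g x) \<le> M"
    using continuous_UNIV_bounded_on_compact[OF cont compact_cbox] by metis
  have "(\<integral>\<^sup>+x. ennreal (norm (?h x)) \<partial>lborel)
    \<le> (\<integral>\<^sup>+x. ennreal M * (ennreal (norm (ray_field x)) * indicator {x. \<bar>x $ 2\<bar> \<le> 1} x) \<partial>lborel)"
  proof (rule nn_integral_mono)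
    fix x :: "real^2"
    show "ennreal (norm (?h x))
      \<le> ennreal M * (ennreal (norm (ray_field x)) * indicator {x. \<bar>x $ 2\<bar> \<le> 1} x)"
    proof (cases "x \<in> A \<and> \<bar>x $ 1\<bar> < \<bar>x $ 2\<bar>")
      case True
      then have "x \<in> cbox (pt (-1) (-1)) (pt 1 1)" "\<bar>x $ 2\<bar> \<le> 1"
        using A by (auto simp: mem_box_cart forall_2)
      then have "\<bar>ray_field x \<bullet> g x\<bar> \<le> M * norm (ray_field x)"
        using Cauchy_Schwarz_ineq2[of "ray_field x" "g x"] M(2)[of x]
          mult_right_mono[of "norm (g x)" M "norm (ray_field x)"]
        by (simp add: mult.commute)
      with True \<open>\<bar>x $ 2\<bar> \<le> 1\<close> show ?thesis
        using M(1) by (simp add: ennreal_mult[symmetric] ennreal_leI)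
    next
      case False
      then have h0: "?h x = 0" by (auto simp: ray_field_def)
      show ?thesis unfolding h0 by simp
    qed
  qed
  also have "\<dots> = ennreal M * (\<integral>\<^sup>+x\<in>{x. \<bar>x $ 2\<bar> \<le> 1}. norm (ray_field x) \<partial>lborel)"
    by (intro nn_integral_cmult) measurable
  also have "\<dots> < \<infinity>" using nn_integral_ray_field_finite by (simp add: ennreal_mult_less_top)
  finally show "(\<integral>\<^sup>+x. ennreal (norm (?h x)) \<partial>lborel) < \<infinity>" .
  show "?h \<in> borel_measurable lborel" by measurable
qed

text \<open>
  In the coordinates \<open>(\<tau>, s) \<mapsto> (\<tau> * s, s)\<close> the cone is the strip \<open>\<bar>\<tau>\<bar> < 1\<close>, the Jacobian is \<open>\<bar>s\<bar>\<close>,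
  and the field is the velocity of the line \<open>s \<mapsto> (\<tau> * s, s)\<close> divided by that Jacobian. So the
  pairing with a gradient is the integral over \<open>\<tau>\<close> of the increments of the potential along these
  lines.
\<close>

lemma integral_ray_field_gradient:
  assumes der: "\<And>x. GDERIV f x :> g x" and cont: "continuous_on UNIV g"
    and ab: "-1 \<le> \<alpha>" "\<alpha> \<le> \<beta>" "\<beta> \<le> 1"
  shows "(\<integral>x. indicator {x. x $ 2 \<in> {\<alpha>..\<beta>}} x * (ray_field x \<bullet> g x) \<partial>lborel)
    = (\<integral>\<tau>. indicator {-1<..<1} \<tau> * (f (pt (\<tau> * \<beta>) \<beta>) - f (pt (\<tau> * \<alpha>) \<alpha>)) \<partial>lborel)"
proof -
  have [measurable]: "g \<in> borel_measurable borel"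
    using cont by (rule borel_measurable_continuous_onI)
  obtain M where M: "M \<ge> 0" "\<And>x. x \<in> cbox (pt (-1) (-1)) (pt 1 1) \<Longrightarrow> norm (g x) \<le> M"
    using continuous_UNIV_bounded_on_compact[OF cont compact_cbox] by metis
  let ?h = "\<lambda>x. indicator {x. x $ 2 \<in> {\<alpha>..\<beta>}} x * (ray_field x \<bullet> g x)"
  have int: "integrable lborel ?h"
    by (rule integrable_ray_field_inner_lborel[OF cont]) (use ab in auto)
  let ?H = "\<lambda>\<tau> s. indicator {-1<..<1} \<tau> * indicator {\<alpha>..\<beta>} s * (pt \<tau> 1 \<bullet> g (pt (\<tau> * s) s))"
  have inner: "(\<integral>t. ?h (pt t s) \<partial>lborel) = (\<integral>\<tau>. ?H \<tau> s \<partial>lborel)" if "s \<noteq> 0" for s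
  proof -
    \<comment> \<open>The substitution \<open>t = s * \<tau>\<close> cancels the density of the field.\<close>
    have "(\<integral>t. ?h (pt t s) \<partial>lborel) = \<bar>s\<bar> *\<^sub>R (\<integral>\<tau>. ?h (pt (0 + s * \<tau>) s) \<partial>lborel)"
      by (rule lborel_integral_real_affine[OF that])
    also have "\<dots> = (\<integral>\<tau>. \<bar>s\<bar> * ?h (pt (0 + s * \<tau>) s) \<partial>lborel)" by simp
    also have "\<dots> = (\<integral>\<tau>. ?H \<tau> s \<partial>lborel)"
    proof (intro Bochner_Integration.integral_cong refl)
      fix \<tau>
      have "\<bar>s * \<tau>\<bar> < \<bar>s\<bar> \<longleftrightarrow> -1 < \<tau> \<and> \<tau> < 1" using that by (auto simp: abs_mult abs_less_iff)
      then have "\<bar>s\<bar> *\<^sub>R ray_field (pt (0 + s * \<tau>) s) = indicator {-1<..<1} \<tau> *\<^sub>R pt \<tau> 1"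
        using that by (auto simp: ray_field_def indicator_def)
      then have "\<bar>s\<bar> * (ray_field (pt (0 + s * \<tau>) s) \<bullet> g (pt (\<tau> * s) s))
          = indicator {-1<..<1} \<tau> * (pt \<tau> 1 \<bullet> g (pt (\<tau> * s) s))"
        by (metis inner_scaleR_left)
      then show "\<bar>s\<bar> * ?h (pt (0 + s * \<tau>) s) = ?H \<tau> s"
        by (auto simp: indicator_def mult.commute)
    qed
    finally show ?thesis .
  qed
  have "(\<integral>x. ?h x \<partial>lborel) = (\<integral>s. \<integral>t. ?h (pt t s) \<partial>lborel \<partial>lborel)"
    by (rule integral_plane(1)[OF int])
  also have "\<dots> = (\<integral>s. \<integral>\<tau>. ?H \<tau> s \<partial>lborel \<partial>lborel)"
    using AE_lborel_singleton[of "0::real"] inner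
    by (intro integral_cong_AE) (auto elim: eventually_mono)
  also have "\<dots> = (\<integral>\<tau>. \<integral>s. ?H \<tau> s \<partial>lborel \<partial>lborel)"
  proof (rule lborel_pair.Fubini_integral)
    show "integrable (lborel \<Otimes>\<^sub>M lborel) (\<lambda>(\<tau>, s). ?H \<tau> s)"
    proof (rule Bochner_Integration.integrable_bound)
      show "integrable (lborel \<Otimes>\<^sub>M lborel) (\<lambda>z. 2 * M * indicator ({-1<..<1::real} \<times> {\<alpha>..\<beta>}) z)"
        by (intro integrable_mult_right integrable_real_indicator)
           (use ab in \<open>auto simp: lborel.emeasure_pair_measure_Times ennreal_mult_less_top\<close>)
      have "norm (?H \<tau> s) \<le> norm (2 * M * indicator ({-1<..<1::real} \<times> {\<alpha>..\<beta>}) (\<tau>, s))" for \<tau> s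
      proof (cases "\<tau> \<in> {-1<..<1} \<and> s \<in> {\<alpha>..\<beta>}")
        case True
        then have "\<bar>\<tau>\<bar> < 1" "\<bar>s\<bar> \<le> 1" using ab by auto
        then have "\<bar>\<tau> * s\<bar> \<le> 1 * 1" unfolding abs_mult by (intro mult_mono) auto
        then have "norm (g (pt (\<tau> * s) s)) \<le> M"
          using \<open>\<bar>s\<bar> \<le> 1\<close> by (intro M) (auto simp: mem_box_cart forall_2 abs_le_iff)
        moreover have "norm (pt \<tau> 1) \<le> 2" using norm_pt_le[of \<tau> 1] \<open>\<bar>\<tau>\<bar> < 1\<close> by simp
        ultimately have "norm (pt \<tau> 1) * norm (g (pt (\<tau> * s) s)) \<le> 2 * M" by (intro mult_mono) auto
        with True Cauchy_Schwarz_ineq2[of "pt \<tau> 1" "g (pt (\<tau> * s) s)"] M(1) show ?thesis by simp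
      qed (auto simp: indicator_def)
      then show "AE z in lborel \<Otimes>\<^sub>M lborel. norm (case z of (\<tau>, s) \<Rightarrow> ?H \<tau> s)
          \<le> norm (2 * M * indicator ({-1<..<1::real} \<times> {\<alpha>..\<beta>}) z)" by auto
    qed measurable
  qed
  also have "\<dots> = (\<integral>\<tau>. indicator {-1<..<1} \<tau> * (f (pt (\<tau> * \<beta>) \<beta>) - f (pt (\<tau> * \<alpha>) \<alpha>)) \<partial>lborel)"
  proof (intro Bochner_Integration.integral_cong refl)
    fix \<tau> :: real
    have line: "0 + s *\<^sub>R pt \<tau> 1 = pt (\<tau> * s) s" for s
      by (simp add: vec_eq_iff forall_2)
    have d: "((\<lambda>s. f (pt (\<tau> * s) s)) has_real_derivative pt \<tau> 1 \<bullet> g (pt (\<tau> * s) s)) (at s)" for s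
      using GDERIV_line[of f 0 s "pt \<tau> 1" "g (pt (\<tau> * s) s)"] der unfolding line
          by (simp add: inner_commute)
    have c: "continuous_on UNIV (\<lambda>s. pt \<tau> 1 \<bullet> g (pt (\<tau> * s) s))"
      by (intro continuous_intros continuous_on_compose2[OF cont]) auto
    have "(\<integral>s. (pt \<tau> 1 \<bullet> g (pt (\<tau> * s) s)) * indicator {\<alpha>..\<beta>} s \<partial>lborel)
        = f (pt (\<tau> * \<beta>) \<beta>) - f (pt (\<tau> * \<alpha>) \<alpha>)"
      using c by (intro integral_FTC_Icc_real ab d) (auto simp: continuous_on_eq_continuous_at)
    then show "(\<integral>s. ?H \<tau> s \<partial>lborel) = indicator {-1<..<1} \<tau> * (f (pt (\<tau> * \<beta>) \<beta>) - f (pt (\<tau> * \<alpha>) \<alpha>))"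
      by (simp add: mult.assoc mult.commute[of "indicator {\<alpha>..\<beta>} _"])
  qed
  finally show ?thesis .
qed

section \<open>Orlicz functions and their conjugates\<close>

lemma borel_measurable_mono_ennreal:
  fixes k :: "real \<Rightarrow> ennreal"
  assumes "mono k"
  shows "k \<in> borel_measurable borel"
proof (rule borel_measurableI_greater)
  fix y
  have "is_interval {x. y < k x}"
    unfolding is_interval_1 using assms by (auto dest: monoD less_le_trans)
  then show "{x \<in> space borel. y < k x} \<in> sets borel"
    by (simp add: real_interval_borel_measurable)
qed

lemma borel_measurable_abs_mono:
  fixes k :: "real \<Rightarrow> ennreal"
  assumes "\<And>s t. 0 \<le> s \<Longrightarrow> s \<le> t \<Longrightarrow> k s \<le> k t"
  shows "(\<lambda>s. k \<bar>s\<bar>) \<in> borel_measurable borel"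
proof -
  have "mono (\<lambda>s. k (max 0 s))" by (intro monoI assms) auto
  then have "(\<lambda>s. k (max 0 \<bar>s\<bar>)) \<in> borel_measurable borel"
    by (intro measurable_compose[OF _ borel_measurable_mono_ennreal]) auto
  then show ?thesis by simp
qed

lemma orlicz_function_scale:
  assumes "orlicz_function \<phi>" "t \<ge> 0" "0 \<le> u" "u \<le> 1"
  shows "\<phi> (u * t) \<le> ennreal u * \<phi> t"
proof -
  have *: "\<forall>s\<ge>0. \<forall>t\<ge>0. \<forall>u\<in>{0..1}. \<phi> ((1 - u) * s + u * t) \<le> ennreal (1 - u) * \<phi> s + ennreal u * \<phi> t"
    and 0: "\<phi> 0 = 0"
    using assms(1) unfolding orlicz_function_def by blast+
  have "\<phi> ((1 - u) * 0 + u * t) \<le> ennreal (1 - u) * \<phi> 0 + ennreal u * \<phi> t"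
    using assms(2-4) by (intro *[rule_format]) auto
  with 0 show ?thesis by simp
qed

lemma orlicz_function_mono:
  assumes "orlicz_function \<phi>" "0 \<le> s" "s \<le> t"
  shows "\<phi> s \<le> \<phi> t"
proof (cases "t = 0")
  case False
  then have "\<phi> ((s / t) * t) \<le> ennreal (s / t) * \<phi> t"
    using assms by (intro orlicz_function_scale) auto
  also have "\<dots> \<le> 1 * \<phi> t"
    using assms by (intro mult_right_mono) (auto simp: ennreal_le_1 divide_le_eq)
  finally show ?thesis using False by simp
qed (use assms in simp)

lemma orlicz_conj_mono:
  assumes "s \<le> s'"
  shows "orlicz_conj \<psi> s \<le> orlicz_conj \<psi> s'"
  unfolding orlicz_conj_def
  using assms by (intro e2ennreal_mono SUP_mono)
      (auto intro!: bexI ereal_minus_mono mult_right_mono)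

lemma orlicz_conj_antimono:
  assumes "\<And>t. t \<ge> 0 \<Longrightarrow> \<psi> t \<le> \<psi>' t"
  shows "orlicz_conj \<psi>' s \<le> orlicz_conj \<psi> s"
  unfolding orlicz_conj_def
  using assms by (intro e2ennreal_mono SUP_mono)
      (auto intro!: bexI ereal_minus_mono simp: less_eq_ennreal.rep_eq[symmetric])

lemma orlicz_conj_0: "orlicz_conj \<psi> 0 = 0"
proof -
  have "(SUP t\<in>{0..}. ereal (0 * t) - enn2ereal (\<psi> t)) \<le> 0"
    by (intro SUP_least) (simp add: zero_ereal_def[symmetric])
  then show ?thesis unfolding orlicz_conj_def by (rule e2ennreal_neg)
qed

lemma orlicz_conj_scale:
  assumes "\<psi> 0 = 0" "0 \<le> u" "u \<le> 1"
  shows "orlicz_conj \<psi> (u * s) \<le> ennreal u * orlicz_conj \<psi> s"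
proof -
  let ?S = "\<lambda>s. SUP t\<in>{0..}. ereal (s * t) - enn2ereal (\<psi> t)"
  have S0: "0 \<le> ?S s" 
    by (rule SUP_upper2[of 0]) (simp_all add: assms(1) zero_ereal_def[symmetric]
        zero_ennreal.rep_eq)
  have "?S (u * s) \<le> ereal u * ?S s"
  proof (rule SUP_least)
    fix t :: real assume t: "t \<in> {0..}"
    have "ereal (u * s * t) - enn2ereal (\<psi> t) \<le> ereal u * (ereal (s * t) - enn2ereal (\<psi> t))"
    proof (cases "\<psi> t" rule: ennreal_cases)
      case (real p)
      have "u * p \<le> 1 * p" using real assms by (intro mult_right_mono) auto
      then show ?thesis using real by (simp add: enn2ereal_ennreal algebra_simps)
    next
      case top
      then show ?thesis by simp
    qed
    also have "\<dots> \<le> ereal u * ?S s"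
      using assms t by (intro ereal_mult_left_mono SUP_upper) auto
    finally show "ereal (u * s * t) - enn2ereal (\<psi> t) \<le> ereal u * ?S s" .
  qed
  then have "e2ennreal (?S (u * s)) \<le> e2ennreal (ereal u * ?S s)" by (rule e2ennreal_mono)
  also have "\<dots> = ennreal u * e2ennreal (?S s)"
    using S0 assms(2)
    by (cases "?S s"; cases "u = 0") (auto simp: ennreal_mult ennreal_mult_top
        zero_ereal_def[symmetric] e2ennreal_neg)
  finally show ?thesis by (simp add: orlicz_conj_def)
qed

lemma orlicz_conj_young:
  assumes "t \<ge> 0"
  shows "ennreal (s * t) \<le> orlicz_conj \<psi> s + \<psi> t"
proof (cases "\<psi> t" rule: ennreal_cases)
  case (real p)
  have "ereal (s * t) - enn2ereal (\<psi> t) \<le> (SUP t\<in>{0..}. ereal (s * t) - enn2ereal (\<psi> t))"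
    using assms by (intro SUP_upper) auto
  then have "e2ennreal (ereal (s * t) - enn2ereal (\<psi> t)) \<le> orlicz_conj \<psi> s"
    unfolding orlicz_conj_def by (rule e2ennreal_mono)
  then have "ennreal (s * t - p) \<le> orlicz_conj \<psi> s"
    using real by (simp add: enn2ereal_ennreal e2ennreal_ereal)
  then have "ennreal (s * t - p) + ennreal p \<le> orlicz_conj \<psi> s + \<psi> t"
    using real by (intro add_mono) auto
  moreover have "ennreal (s * t) \<le> ennreal (s * t - p) + ennreal p"
  proof (cases "s * t - p \<ge> 0")
    case True
    then show ?thesis using real by (simp add: ennreal_plus[symmetric] del: ennreal_plus)
  next
    case False
    then show ?thesis by (simp add: ennreal_neg ennreal_leI)
  qed
  ultimately show ?thesis by (rule order_trans[rotated])
qed simp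

text \<open>
  Convergence at the origin forces \<open>F\<close> to be finite everywhere, since an infinite value would by
  monotonicity make the integrand infinite on an interval. By monotonicity again \<open>F (1 / r)\<close> is
  bounded for \<open>r\<close> away from \<open>0\<close>.
\<close>

lemma unit_interval_integral_finite:
  fixes F :: "real \<Rightarrow> ennreal"
  assumes mono: "\<And>s t. 0 \<le> s \<Longrightarrow> s \<le> t \<Longrightarrow> F s \<le> F t"
    and conv: "converges_at_0 (\<lambda>r. F (1 / r) * ennreal r)"
  shows "(\<integral>\<^sup>+r\<in>{0<..1}. F (1 / r) * ennreal r \<partial>lborel) < \<infinity>"
proof -
  obtain \<delta> where \<delta>: "\<delta> > 0" and fin: "(\<integral>\<^sup>+r\<in>{0<..<\<delta>}. F (1 / r) * ennreal r \<partial>lborel) < \<infinity>"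
    using conv unfolding converges_at_0_def by blast
  have [measurable]: "(\<lambda>r. F (1 / \<bar>r\<bar>)) \<in> borel_measurable borel"
    using measurable_compose[OF _ borel_measurable_abs_mono[OF mono], of "\<lambda>s. 1 / s" borel] by simp
  have abs: "(\<integral>\<^sup>+r\<in>A. F (1 / r) * ennreal r \<partial>lborel) = (\<integral>\<^sup>+r\<in>A. F (1 / \<bar>r\<bar>) * ennreal r \<partial>lborel)"
    if "A \<subseteq> {0<..}" for A
    using that by (intro nn_integral_cong) (auto simp: indicator_def)
  define \<rho> where "\<rho> = \<delta> / 2"
  have \<rho>: "0 < \<rho>" "\<rho> < \<delta>" using \<delta> by (auto simp: \<rho>_def)
  have "F (1 / \<rho>) < \<infinity>"
  proof (rule ccontr)
    assume "\<not> F (1 / \<rho>) < \<infinity>"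
    then have top: "F (1 / r) = \<infinity>" if "0 < r" "r \<le> \<rho>" for r
      using mono[of "1 / \<rho>" "1 / r"] that \<rho> by (simp add: frac_le less_top[symmetric] top_unique)
    have "\<infinity> * ennreal \<rho> = (\<integral>\<^sup>+r. \<infinity> * indicator {0<..\<rho>} r \<partial>lborel)"
      using \<rho> by (subst nn_integral_cmult) auto
    also have "\<dots> \<le> (\<integral>\<^sup>+r\<in>{0<..<\<delta>}. F (1 / r) * ennreal r \<partial>lborel)"
      using \<rho> by (intro nn_integral_mono) (auto simp: indicator_def top ennreal_top_mult)
    finally show False using fin \<rho> by (simp add: ennreal_top_mult top_unique)
  qed
  have "(\<integral>\<^sup>+r\<in>{0<..1}. F (1 / r) * ennreal r \<partial>lborel)
      \<le> (\<integral>\<^sup>+r. F (1 / \<bar>r\<bar>) * ennreal r * indicator {0<..<\<delta>} r + F (1 / \<rho>) * indicator {0<..1} r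
          \<partial>lborel)"
  proof (rule nn_integral_mono)
    fix r :: real
    show "F (1 / r) * ennreal r * indicator {0<..1} r
      \<le> F (1 / \<bar>r\<bar>) * ennreal r * indicator {0<..<\<delta>} r + F (1 / \<rho>) * indicator {0<..1} r"
    proof (cases "r \<in> {0<..1}")
      case True
      have "F (1 / r) * ennreal r \<le> F (1 / \<rho>) * 1" if "r \<ge> \<delta>"
        using True that \<rho> mono[of "1 / r" "1 / \<rho>"]
        by (intro mult_mono) (auto simp: frac_le)
      with True show ?thesis by (cases "r < \<delta>") (auto simp: indicator_def)
    qed simp
  qed
  also have "\<dots> = (\<integral>\<^sup>+r\<in>{0<..<\<delta>}. F (1 / \<bar>r\<bar>) * ennreal r \<partial>lborel) + F (1 / \<rho>)"
    by (subst nn_integral_add) (auto simp: nn_integral_cmult)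
  also have "\<dots> < \<infinity>"
    using fin abs[of "{0<..<\<delta>}"] \<open>F (1 / \<rho>) < \<infinity>\<close> by (simp add: subset_eq)
  finally show ?thesis .
qed

text \<open>
  If a multiple of \<open>f\<close> has finite modular, dividing further by that value brings the modular below
  \<open>1\<close>. The majorant \<open>h\<close> is there because the modular of a conjugate function is easier to dominate
  than to compute.
\<close>

lemma luxemburg_norm_finite:
  fixes f :: "real^'n \<Rightarrow> 'b::real_normed_vector"
  assumes scale: "\<And>x t u. t \<ge> 0 \<Longrightarrow> 0 \<le> u \<Longrightarrow> u \<le> 1 \<Longrightarrow> \<Phi> x (u * t) \<le> ennreal u * \<Phi> x t"
    and "c > 0" and le: "AE x in lebesgue_on \<Omega>. \<Phi> x (norm (f x) / c) \<le> h x"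
    and [measurable]: "h \<in> borel_measurable (lebesgue_on \<Omega>)"
    and fin: "(\<integral>\<^sup>+x. h x \<partial>lebesgue_on \<Omega>) < \<infinity>"
  shows "luxemburg_norm \<Omega> \<Phi> f < \<infinity>"
proof -
  define I where "I = enn2real (\<integral>\<^sup>+x. h x \<partial>lebesgue_on \<Omega>)"
  have I: "(\<integral>\<^sup>+x. h x \<partial>lebesgue_on \<Omega>) = ennreal I" "I \<ge> 0"
    using fin by (auto simp: I_def)
  define m where "m = max 1 I"
  have m: "m \<ge> 1" "m \<ge> I" by (auto simp: m_def)
  have "(\<integral>\<^sup>+x. \<Phi> x (norm (f x /\<^sub>R (c * m))) \<partial>lebesgue_on \<Omega>)
      \<le> (\<integral>\<^sup>+x. ennreal (1 / m) * h x \<partial>lebesgue_on \<Omega>)"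
  proof (rule nn_integral_mono_AE)
    show "AE x in lebesgue_on \<Omega>. \<Phi> x (norm (f x /\<^sub>R (c * m))) \<le> ennreal (1 / m) * h x"
      using le
    proof eventually_elim
      fix x assume "\<Phi> x (norm (f x) / c) \<le> h x"
      then have "ennreal (1 / m) * \<Phi> x (norm (f x) / c) \<le> ennreal (1 / m) * h x"
        by (rule mult_left_mono) simp
      moreover have "\<Phi> x ((1 / m) * (norm (f x) / c)) \<le> ennreal (1 / m) * \<Phi> x (norm (f x) / c)"
        using \<open>c > 0\<close> m by (intro scale) auto
      moreover have "norm (f x /\<^sub>R (c * m)) = (1 / m) * (norm (f x) / c)"
        using \<open>c > 0\<close> m by (simp add: divide_inverse abs_mult)
      ultimately show "\<Phi> x (norm (f x /\<^sub>R (c * m))) \<le> ennreal (1 / m) * h x"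
        by (simp only: order_trans)
    qed
  qed
  also have "\<dots> = ennreal (1 / m) * ennreal I"
    by (subst nn_integral_cmult) (simp_all add: I)
  also have "\<dots> \<le> 1"
    using m I(2) by (simp add: ennreal_mult[symmetric] ennreal_le_1)
  finally have "luxemburg_norm \<Omega> \<Phi> f \<le> ennreal (c * m)"
    unfolding luxemburg_norm_def using \<open>c > 0\<close> m by (intro Inf_lower) auto
  then show ?thesis by (rule le_less_trans) simp
qed

section \<open>Duality with the ray field\<close>

lemma nn_integral_lebesgue_on_square:
  "(\<integral>\<^sup>+x. h x \<partial>lebesgue_on square) = (\<integral>\<^sup>+x. h x * indicator square x \<partial>lborel)"
  by (simp add: nn_integral_restrict_space nn_integral_completion)

lemma nn_integral_lebesgue_on_square_le:
  "(\<integral>\<^sup>+x. h x \<partial>lebesgue_on square) \<le> (\<integral>\<^sup>+x. h x \<partial>lborel)"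
  unfolding nn_integral_lebesgue_on_square
  by (intro nn_integral_mono) (auto simp: indicator_def)

lemma borel_imp_lebesgue_on:
  "f \<in> borel_measurable borel \<Longrightarrow> f \<in> borel_measurable (lebesgue_on S)"
  by (intro measurable_restrict_space1 measurable_completion) simp

lemma measurable_weight [measurable]: "weight \<in> borel_measurable borel"
  unfolding weight_def[abs_def] by measurable

locale competing_phases =
  fixes \<phi> \<psi> :: "real \<Rightarrow> ennreal"
  assumes orlicz: "orlicz_function \<phi>" "orlicz_function \<psi>"
    and finite: "\<And>t. t \<ge> 0 \<Longrightarrow> \<phi> t < \<infinity>" "\<And>t. t \<ge> 0 \<Longrightarrow> \<psi> t < \<infinity>"
    and phi_conv: "converges_at_0 (\<lambda>r. \<phi> (1 / r) * ennreal r)"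
    and psi_conj_conv: "converges_at_0 (\<lambda>r. orlicz_conj \<psi> (1 / r) * ennreal r)"
begin

abbreviation "\<Phi> \<equiv> double_phase \<phi> \<psi>"

lemma psi_0: "\<psi> 0 = 0" and phi_0: "\<phi> 0 = 0"
  using orlicz unfolding orlicz_function_def by blast+

lemma Phi_0: "\<Phi> x 0 = 0"
  by (simp add: double_phase_def psi_0 phi_0)

lemma Phi_mono: "0 \<le> s \<Longrightarrow> s \<le> t \<Longrightarrow> \<Phi> x s \<le> \<Phi> x t"
  unfolding double_phase_def by (intro add_mono mult_left_mono orlicz_function_mono orlicz) auto

lemma Phi_scale:
  assumes "t \<ge> 0" "0 \<le> u" "u \<le> 1"
  shows "\<Phi> x (u * t) \<le> ennreal u * \<Phi> x t"
proof -
  have "\<Phi> x (u * t) \<le> ennreal u * \<phi> t + ennreal (weight x) * (ennreal u * \<psi> t)"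
    unfolding double_phase_def using assms
    by (intro add_mono mult_left_mono orlicz_function_scale orlicz) auto
  then show ?thesis by (simp add: double_phase_def distrib_left mult_ac)
qed

lemma measurable_phi_abs [measurable]: "(\<lambda>s. \<phi> \<bar>s\<bar>) \<in> borel_measurable borel"
  and measurable_psi_abs [measurable]: "(\<lambda>s. \<psi> \<bar>s\<bar>) \<in> borel_measurable borel"
  and measurable_psi_conj_abs [measurable]: "(\<lambda>s. orlicz_conj \<psi> \<bar>s\<bar>) \<in> borel_measurable borel"
  using orlicz by (auto intro!: borel_measurable_abs_mono orlicz_function_mono orlicz_conj_mono)

lemma measurable_Phi_norm:
  fixes g :: "real^2 \<Rightarrow> 'b::euclidean_space"
  assumes g: "g \<in> borel_measurable (lebesgue_on square)"
  shows "(\<lambda>x. \<Phi> x (norm (g x))) \<in> borel_measurable (lebesgue_on square)"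
proof -
  have 1: "(\<lambda>x. k \<bar>norm (g x)\<bar>) \<in> borel_measurable (lebesgue_on square)"
    if "(\<lambda>s. k \<bar>s\<bar>) \<in> borel_measurable borel" for k :: "real \<Rightarrow> ennreal"
    by (rule measurable_compose[OF measurable_compose[OF g borel_measurable_norm] that])
  have "(\<lambda>x. \<phi> \<bar>norm (g x)\<bar> + ennreal (weight x) * \<psi> \<bar>norm (g x)\<bar>) \<in> borel_measurable
      (lebesgue_on square)"
    by (intro borel_measurable_add borel_measurable_times_ennreal 1 measurable_phi_abs
        measurable_psi_abs
        borel_imp_lebesgue_on) measurable
  then show ?thesis by (simp add: double_phase_def)
qed

text \<open>
  Integrable majorants for the modulars of \<open>ray_field\<close> in the dual space and of the gradient of the
  competitor. Their finiteness is where the two convergence hypotheses enter.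
\<close>

definition dual_bound :: "real^2 \<Rightarrow> ennreal" where
  "dual_bound x = orlicz_conj \<psi> (1 / \<bar>x $ 2\<bar>) * indicator vertical_cone x"

definition primal_bound :: "real^2 \<Rightarrow> ennreal" where
  "primal_bound x = \<phi> (1 / \<bar>x $ 1\<bar>) * indicator horizontal_cone x + (\<phi> 1 + \<psi> 1)"

lemma measurable_dual_bound [measurable]: "dual_bound \<in> borel_measurable borel"
proof -
  have "(\<lambda>x::real^2. orlicz_conj \<psi> \<bar>1 / x $ 2\<bar>) \<in> borel_measurable borel"
    by (intro measurable_compose[OF _ measurable_psi_conj_abs]) measurable
  then have [measurable]: "(\<lambda>x::real^2. orlicz_conj \<psi> (1 / \<bar>x $ 2\<bar>)) \<in> borel_measurable borel"
      by simp
  show ?thesis unfolding dual_bound_def[abs_def] by measurable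
qed

lemma measurable_phi_inverse [measurable]: "(\<lambda>x::real^2. \<phi> (1 / \<bar>x $ 1\<bar>)) \<in> borel_measurable borel"
proof -
  have "(\<lambda>x::real^2. \<phi> \<bar>1 / x $ 1\<bar>) \<in> borel_measurable borel"
    by (intro measurable_compose[OF _ measurable_phi_abs]) measurable
  then show ?thesis by simp
qed

lemma measurable_primal_bound [measurable]: "primal_bound \<in> borel_measurable borel"
  unfolding primal_bound_def[abs_def] by measurable

lemma dual_bound_finite: "(\<integral>\<^sup>+x. dual_bound x \<partial>lebesgue_on square) < \<infinity>"
proof -
  have "(\<integral>\<^sup>+x. dual_bound x \<partial>lborel) < \<infinity>"
    unfolding dual_bound_def
    by (intro cone_integral_finite measurable_psi_conj_abs unit_interval_integral_finite
        orlicz_conj_mono psi_conj_conv)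
  with nn_integral_lebesgue_on_square_le show ?thesis by (rule le_less_trans)
qed

lemma primal_bound_finite: "(\<integral>\<^sup>+x. primal_bound x \<partial>lebesgue_on square) < \<infinity>"
proof -
  have "(\<integral>\<^sup>+x\<in>horizontal_cone. \<phi> (1 / \<bar>x $ 1\<bar>) \<partial>(lborel :: (real^2) measure)) < \<infinity>"
    by (intro cone_integral_finite measurable_phi_abs unit_interval_integral_finite
        orlicz_function_mono orlicz phi_conv)
  with nn_integral_lebesgue_on_square_le
  have "(\<integral>\<^sup>+x\<in>horizontal_cone. \<phi> (1 / \<bar>x $ 1\<bar>) \<partial>lebesgue_on square) < \<infinity>"
    by (rule le_less_trans)
  moreover have "emeasure (lebesgue_on square) (space (lebesgue_on square)) < \<infinity>"
  proof -
    have "square \<subseteq> cbox (pt (-1) (-1)) (pt 1 1)"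
        by (auto simp: square_def mem_box_cart forall_2 less_imp_le)
    then have "emeasure lborel square \<le> emeasure lborel (cbox (pt (-1) (-1)) (pt 1 1 :: real^2))"
      by (intro emeasure_mono) auto
    also have "\<dots> < \<infinity>" by (rule emeasure_lborel_cbox_finite)
    finally show ?thesis by (simp add: emeasure_restrict_space space_restrict_space)
  qed
  moreover have "\<phi> 1 + \<psi> 1 < \<infinity>" using finite(1)[of 1] finite(2)[of 1]
      by (simp add: ennreal_add_less_top)
  ultimately have "(\<integral>\<^sup>+x\<in>horizontal_cone. \<phi> (1 / \<bar>x $ 1\<bar>) \<partial>lebesgue_on square)
      + (\<integral>\<^sup>+x. \<phi> 1 + \<psi> 1 \<partial>lebesgue_on square) < \<infinity>"
    by (simp add: ennreal_mult_less_top ennreal_add_less_top)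
  also have "(\<integral>\<^sup>+x\<in>horizontal_cone. \<phi> (1 / \<bar>x $ 1\<bar>) \<partial>lebesgue_on square)
      + (\<integral>\<^sup>+x. \<phi> 1 + \<psi> 1 \<partial>lebesgue_on square) = (\<integral>\<^sup>+x. primal_bound x \<partial>lebesgue_on square)"
    unfolding primal_bound_def
    by (intro nn_integral_add[symmetric] borel_imp_lebesgue_on) measurable
  finally show ?thesis .
qed

text \<open>
  Where the field does not vanish the weight is \<open>1\<close>, so the integrand dominates \<open>\<psi>\<close> and its
  conjugate is dominated by that of \<open>\<psi>\<close>. The factor \<open>1 / 2\<close> compensates the \<open>2\<close> in
  \<open>norm_ray_field_le\<close>.
\<close>

lemma orlicz_conj_ray_field_le:
  assumes x: "x \<in> square" and "0 \<le> t" "t \<le> norm (ray_field x) / 2"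
  shows "orlicz_conj (\<Phi> x) t \<le> dual_bound x" and "t > 0 \<Longrightarrow> orlicz_conj \<psi> t \<le> dual_bound x"
proof -
  have *: "orlicz_conj \<psi> t \<le> dual_bound x" if "\<bar>x $ 1\<bar> < \<bar>x $ 2\<bar>"
  proof -
    have "t \<le> 1 / \<bar>x $ 2\<bar>" using assms(3) norm_ray_field_le[of x] by simp
    then have "orlicz_conj \<psi> t \<le> orlicz_conj \<psi> (1 / \<bar>x $ 2\<bar>)" by (rule orlicz_conj_mono)
    moreover have "\<bar>x $ 2\<bar> \<le> 1" using x by (auto simp: square_def forall_2 abs_le_iff less_imp_le)
    ultimately show ?thesis using that by (simp add: dual_bound_def)
  qed
  have cone: "\<bar>x $ 1\<bar> < \<bar>x $ 2\<bar>" if "t > 0"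
    using that assms(3) by (auto simp: ray_field_def split: if_splits)
  show "orlicz_conj \<psi> t \<le> dual_bound x" if "t > 0" using * cone that by blast
  show "orlicz_conj (\<Phi> x) t \<le> dual_bound x"
  proof (cases "t > 0")
    case True
    then have "weight x = 1" using cone by (simp add: weight_def)
    then have "orlicz_conj (\<Phi> x) t \<le> orlicz_conj \<psi> t"
      by (intro orlicz_conj_antimono) (simp add: double_phase_def)
    also have "\<dots> \<le> dual_bound x" using * cone True by blast
    finally show ?thesis .
  next
    case False
    then show ?thesis using assms(2) orlicz_conj_0 by simp
  qed
qed

lemma ray_field_in_dual_space:
  "(\<lambda>x. s *\<^sub>R ray_field x) \<in> orlicz_space square (\<lambda>x. orlicz_conj (\<Phi> x))"
proof -
  have "luxemburg_norm square (\<lambda>x. orlicz_conj (\<Phi> x)) (\<lambda>x. s *\<^sub>R ray_field x) < \<infinity>"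
  proof (rule luxemburg_norm_finite)
    show "orlicz_conj (\<Phi> x) (u * t) \<le> ennreal u * orlicz_conj (\<Phi> x) t" if "0 \<le> u" "u \<le> 1" for x t u
      using that by (intro orlicz_conj_scale Phi_0)
    show "AE x in lebesgue_on square. orlicz_conj (\<Phi> x)
        (norm (s *\<^sub>R ray_field x) / (2 * (\<bar>s\<bar> + 1))) \<le> dual_bound x"
    proof (rule AE_I2)
      fix x assume "x \<in> space (lebesgue_on square)"
      moreover have "\<bar>s\<bar> * norm (ray_field x) \<le> (\<bar>s\<bar> + 1) * norm (ray_field x)"
        by (intro mult_right_mono) auto
      ultimately show "orlicz_conj (\<Phi> x) (norm (s *\<^sub>R ray_field x) / (2 * (\<bar>s\<bar> + 1)))
          \<le> dual_bound x"
        by (intro orlicz_conj_ray_field_le) (auto simp: field_simps)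
    qed
  qed (use dual_bound_finite in \<open>auto intro: borel_imp_lebesgue_on\<close>)
  then show ?thesis
    unfolding orlicz_space_def by (auto intro!: borel_imp_lebesgue_on)
qed

definition ray_const :: real where
  "ray_const = 2 * (enn2real (\<integral>\<^sup>+x. dual_bound x \<partial>lebesgue_on square) + 1)"

lemma ray_const_nonneg: "ray_const \<ge> 0"
  by (simp add: ray_const_def)

text \<open>
  Young's inequality for \<open>\<psi>\<close>, applied to \<open>ray_field x / 2\<close> and \<open>g x / \<gamma>\<close> with \<open>\<gamma> < \<epsilon>\<close> admissible in
  the Luxemburg norm of \<open>g\<close>, and then integrated.
\<close>

lemma ray_field_hoelder:
  fixes g :: "real^2 \<Rightarrow> real^2"
  assumes g: "g \<in> borel_measurable (lebesgue_on square)" and \<epsilon>: "\<epsilon> > 0"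
    and norm: "luxemburg_norm square \<Phi> g < ennreal \<epsilon>"
  shows "(\<integral>\<^sup>+x. norm (ray_field x) * norm (g x) \<partial>lebesgue_on square) \<le> ennreal (ray_const * \<epsilon>)"
proof -
  define J where "J = enn2real (\<integral>\<^sup>+x. dual_bound x \<partial>lebesgue_on square)"
  have J: "(\<integral>\<^sup>+x. dual_bound x \<partial>lebesgue_on square) = ennreal J" "J \<ge> 0"
    using dual_bound_finite by (auto simp: J_def)
  obtain \<gamma> where \<gamma>: "\<gamma> > 0" "\<gamma> < \<epsilon>" "(\<integral>\<^sup>+x. \<Phi> x (norm (g x /\<^sub>R \<gamma>)) \<partial>lebesgue_on square) \<le> 1"
    using norm unfolding luxemburg_norm_def Inf_less_iff by (auto simp: ennreal_less_iff)
  have "(\<integral>\<^sup>+x. norm (ray_field x) * norm (g x) \<partial>lebesgue_on square)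
      \<le> (\<integral>\<^sup>+x. ennreal (2 * \<gamma>) * (dual_bound x + \<Phi> x (norm (g x /\<^sub>R \<gamma>))) \<partial>lebesgue_on square)"
  proof (rule nn_integral_mono)
    fix x assume "x \<in> space (lebesgue_on square)"
    then have x: "x \<in> square" by (simp add: space_restrict_space)
    let ?s = "norm (ray_field x) / 2" and ?t = "norm (g x /\<^sub>R \<gamma>)"
    have "ennreal (?s * ?t) \<le> dual_bound x + \<Phi> x ?t"
    proof (cases "?s > 0")
      case True
      then have "weight x = 1" by (auto simp: ray_field_def weight_def split: if_splits)
      have "ennreal (?s * ?t) \<le> orlicz_conj \<psi> ?s + \<psi> ?t" by (rule orlicz_conj_young) simp
      also have "\<dots> \<le> dual_bound x + \<Phi> x ?t"
        using orlicz_conj_ray_field_le(2)[OF x _ _ True] \<open>weight x = 1\<close>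
        by (intro add_mono) (auto simp: double_phase_def)
      finally show ?thesis .
    qed simp
    then have "ennreal (2 * \<gamma>) * ennreal (?s * ?t) \<le> ennreal (2 * \<gamma>) * (dual_bound x + \<Phi> x ?t)"
      by (rule mult_left_mono) simp
    moreover have "ennreal (2 * \<gamma>) * ennreal (?s * ?t) = ennreal (norm (ray_field x) * norm (g x))"
      using \<gamma>(1) by (simp add: ennreal_mult[symmetric])
    ultimately show "ennreal (norm (ray_field x) * norm (g x))
        \<le> ennreal (2 * \<gamma>) * (dual_bound x + \<Phi> x ?t)"
      by simp
  qed
  also have "\<dots> = ennreal (2 * \<gamma>) * ((\<integral>\<^sup>+x. dual_bound x \<partial>lebesgue_on square)
      + (\<integral>\<^sup>+x. \<Phi> x (norm (g x /\<^sub>R \<gamma>)) \<partial>lebesgue_on square))"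
  proof -
    have 1: "(\<lambda>x. \<Phi> x (norm (g x /\<^sub>R \<gamma>))) \<in> borel_measurable (lebesgue_on square)"
      using g by (intro measurable_Phi_norm borel_measurable_scaleR) auto
    have 2: "dual_bound \<in> borel_measurable (lebesgue_on square)"
      by (intro borel_imp_lebesgue_on) measurable
    show ?thesis
      using 1 2 by (subst nn_integral_cmult) (auto simp: nn_integral_add)
  qed
  also have "\<dots> \<le> ennreal (2 * \<epsilon>) * (ennreal J + 1)"
    using \<gamma> J by (intro mult_mono add_mono) (auto intro: ennreal_leI)
  also have "\<dots> = ennreal (2 * (J + 1) * \<epsilon>)"
    using J(2) \<epsilon> by (simp add: ennreal_mult[symmetric] ennreal_1[symmetric]
        ennreal_plus[symmetric] mult_ac del: ennreal_1 ennreal_plus)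
  finally show ?thesis by (simp add: ray_const_def J_def)
qed

end

section \<open>Tame functions and the conical step\<close>

text \<open>
  The bounds are invariant under dilations of the plane. This keeps the constant fixed when a
  cutoff is scaled down to the origin, and it lets products of tame functions be tame.
\<close>

definition tame :: "real \<Rightarrow> (real^2 \<Rightarrow> real) \<Rightarrow> bool" where
  "tame C f \<longleftrightarrow> (\<forall>k. higher_differentiable_on k (- {0}) f) \<and>
     (\<forall>x. x \<noteq> 0 \<longrightarrow> \<bar>f x\<bar> \<le> C \<and> norm (gradient f x) \<le> C / norm x)"

lemma open_punctured_plane: "open (- {0 :: real^2})"
  by (simp add: open_Compl)

lemma tame_GDERIV: "tame C f \<Longrightarrow> x \<noteq> 0 \<Longrightarrow> GDERIV f x :> gradient f x"
  unfolding tame_def by (intro smooth_GDERIV[of "- {0}"]) auto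

lemma tame_continuous_gradient:
  assumes "tame C f" shows "continuous_on (- {0}) (gradient f)"
proof -
  have "higher_differentiable_on (Suc 0) (- {0}) f" using assms unfolding tame_def by blast
  then show ?thesis unfolding higher_differentiable_on.simps by (intro continuous_on_gradient) blast
qed

lemma tame_continuous:
  assumes "tame C f" shows "continuous_on (- {0}) f"
  using assms higher_differentiable_on.simps(1) unfolding tame_def by blast

lemma tame_nonneg:
  assumes "tame C f" shows "C \<ge> 0"
proof -
  have "pt 1 1 \<noteq> 0" by (simp add: vec_eq_iff forall_2)
  then have "\<bar>f (pt 1 1)\<bar> \<le> C" using assms unfolding tame_def by blast
  then show ?thesis by linarith
qed

lemma tame_mono: "tame C f \<Longrightarrow> C \<le> D \<Longrightarrow> tame D f"
  unfolding tame_def by (meson divide_right_mono norm_ge_zero order_trans)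

lemma tame_mult:
  assumes f: "tame C f" and g: "tame D g"
  shows "tame (2 * C * D) (\<lambda>x. f x * g x)"
  unfolding tame_def
proof (intro conjI allI impI)
  show "higher_differentiable_on k (- {0}) (\<lambda>x. f x * g x)" for k
    using f g unfolding tame_def by (intro smooth_mult open_punctured_plane) auto
next
  fix x :: "real^2" assume x: "x \<noteq> 0"
  note CD = tame_nonneg[OF f] tame_nonneg[OF g]
  have b: "\<bar>f x\<bar> \<le> C" "norm (gradient f x) \<le> C / norm x" "\<bar>g x\<bar> \<le> D"
      "norm (gradient g x) \<le> D / norm x"
    using f g x by (auto simp: tame_def)
  have "\<bar>f x * g x\<bar> \<le> C * D" unfolding abs_mult using b CD by (intro mult_mono) auto
  moreover have "0 \<le> C * D" using CD by simp
  ultimately show "\<bar>f x * g x\<bar> \<le> 2 * C * D" by simp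
  have "gradient (\<lambda>x. f x * g x) x = f x *\<^sub>R gradient g x + g x *\<^sub>R gradient f x"
    by (intro GDERIV_imp_gradient GDERIV_mult tame_GDERIV[OF f x] tame_GDERIV[OF g x])
  then have "norm (gradient (\<lambda>x. f x * g x) x)
      \<le> \<bar>f x\<bar> * norm (gradient g x) + \<bar>g x\<bar> * norm (gradient f x)"
    using norm_triangle_ineq[of "f x *\<^sub>R gradient g x" "g x *\<^sub>R gradient f x"] by simp
  also have "\<dots> \<le> C * (D / norm x) + D * (C / norm x)"
    using b CD by (intro add_mono mult_mono) auto
  finally show "norm (gradient (\<lambda>x. f x * g x) x) \<le> 2 * C * D / norm x" by (simp add: field_simps)
qed

lemma tame_bound_on_square:
  assumes "tame C f" "x \<in> square" "x \<noteq> 0"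
  shows "\<bar>f x\<bar> \<le> 2 * C / norm x" "norm (gradient f x) \<le> 2 * C / norm x"
proof -
  have b: "\<bar>f x\<bar> \<le> C" "norm (gradient f x) \<le> C / norm x" using assms by (auto simp: tame_def)
  have C: "C \<ge> 0" by (rule tame_nonneg[OF assms(1)])
  have "C * norm x \<le> C * 2" using C norm_square_le[OF assms(2)] by (intro mult_left_mono) auto
  then have "C \<le> 2 * C / norm x" using assms(3) by (simp add: field_simps)
  with b show "\<bar>f x\<bar> \<le> 2 * C / norm x" by simp
  have "C / norm x \<le> 2 * C / norm x" using C by (intro divide_right_mono) auto
  with b show "norm (gradient f x) \<le> 2 * C / norm x" by simp
qed

lemma tame_has_weak_gradient:
  assumes "tame C f" shows "has_weak_gradient square f (gradient f)"
proof (rule has_weak_gradient_off_origin)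
  show "continuous_on (square - {0}) (gradient f)"
    by (rule continuous_on_subset[OF tame_continuous_gradient[OF assms]]) auto
  show "\<exists>C. \<forall>x\<in>K - {0}. \<bar>f x\<bar> \<le> C / norm x \<and> norm (gradient f x) \<le> C / norm x" if "K \<subseteq> square" for K
    using tame_bound_on_square[OF assms] that by (intro exI[of _ "2 * C"]) auto
qed (rule tame_GDERIV[OF assms])

lemma integrable_lebesgue_on_squareI:
  fixes f :: "real^2 \<Rightarrow> 'b::euclidean_space"
  assumes "integrable lborel (\<lambda>x. indicator square x *\<^sub>R f x)"
  shows "integrable (lebesgue_on square) f"
  using absolutely_integrable_on_lborelI[OF assms]
  by (simp add: set_integrable_def integrable_restrict_space)

lemma tame_integrable:
  assumes "tame C f"
  shows "integrable (lebesgue_on square) f" "integrable (lebesgue_on square) (gradient f)"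
  using tame_bound_on_square[OF assms]
  by (auto intro!: integrable_lebesgue_on_squareI integrable_off_origin[where C="2 * C"]
      continuous_on_subset[OF tame_continuous_gradient[OF assms]]
          continuous_on_subset[OF tame_continuous[OF assms]])

lemma tame_W11: "tame C f \<Longrightarrow> f \<in> W11 square"
  unfolding W11_def using tame_integrable tame_has_weak_gradient by blast

lemma tame_cmult:
  assumes "tame C f" shows "tame (\<bar>c\<bar> * C) (\<lambda>x. c * f x)"
  unfolding tame_def
proof (intro conjI allI impI)
  show "higher_differentiable_on k (- {0}) (\<lambda>x. c * f x)" for k
    using assms unfolding tame_def
    by (intro smooth_mult smooth_const open_punctured_plane) auto
next
  fix x :: "real^2" assume x: "x \<noteq> 0"
  have b: "\<bar>f x\<bar> \<le> C" "norm (gradient f x) \<le> C / norm x" using assms x by (auto simp: tame_def)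
  show "\<bar>c * f x\<bar> \<le> \<bar>c\<bar> * C" using b(1) by (simp add: abs_mult mult_left_mono)
  have "gradient (\<lambda>x. c * f x) x = c *\<^sub>R gradient f x + f x *\<^sub>R 0"
    by (intro GDERIV_imp_gradient GDERIV_mult GDERIV_const tame_GDERIV[OF assms x])
  then show "norm (gradient (\<lambda>x. c * f x) x) \<le> \<bar>c\<bar> * C / norm x"
    using mult_left_mono[OF b(2), of "\<bar>c\<bar>"] by simp
qed

lemma test_function_tame:
  assumes "\<eta> \<in> test_functions square"
  obtains C where "tame C \<eta>"
proof -
  obtain K where K: "compact K" "K \<subseteq> square" "\<And>x. x \<notin> K \<Longrightarrow> \<eta> x = 0" "\<And>x. x \<notin> K \<Longrightarrow> gradient \<eta> x = 0"
    and \<eta>: "continuous_on UNIV \<eta>" "continuous_on UNIV (gradient \<eta>)"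
    using test_function_gradientE[OF assms] by metis
  obtain M1 where M1: "M1 \<ge> 0" "\<And>x. x \<in> K \<Longrightarrow> norm (\<eta> x) \<le> M1"
    using continuous_UNIV_bounded_on_compact[OF \<eta>(1) K(1)] by metis
  obtain M2 where M2: "M2 \<ge> 0" "\<And>x. x \<in> K \<Longrightarrow> norm (gradient \<eta> x) \<le> M2"
    using continuous_UNIV_bounded_on_compact[OF \<eta>(2) K(1)] by metis
  have "tame (M1 + 2 * M2) \<eta>"
    unfolding tame_def
  proof (intro conjI allI impI)
    show "higher_differentiable_on k (- {0}) \<eta>" for k
    proof (rule smooth_subset)
      show "higher_differentiable_on k UNIV \<eta>" using assms
          by (simp add: test_functions_def smooth_functions_def)
    qed simp
  next
    fix x :: "real^2" assume x: "x \<noteq> 0"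
    show "\<bar>\<eta> x\<bar> \<le> M1 + 2 * M2" using M1 M2(1) K(3)[of x] by (cases "x \<in> K") force+
    show "norm (gradient \<eta> x) \<le> (M1 + 2 * M2) / norm x"
    proof (cases "x \<in> K")
      case True
      have "norm (gradient \<eta> x) * norm x \<le> M2 * 2"
        using M2 True K(2) norm_square_le[of x] by (intro mult_mono) auto
      then have "norm (gradient \<eta> x) * norm x \<le> M1 + 2 * M2" using M1(1) by simp
      then show ?thesis using x by (simp add: field_simps)
    next
      case False
      then show ?thesis using K(4)[OF False] M1(1) M2(1) by simp
    qed
  qed
  then show ?thesis by (rule that)
qed

text \<open>
  A function of the angle: \<open>1\<close> in the upper and \<open>0\<close> in the lower half of the vertical cone, with
  the transition in the horizontal cones, where the weight vanishes.
\<close>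

definition conical_step :: "real^2 \<Rightarrow> real" where
  "conical_step x = (if \<bar>x $ 1\<bar> < \<bar>x $ 2\<bar> then (if x $ 2 > 0 then 1 else 0)
     else step ((1 + x $ 2 / \<bar>x $ 1\<bar>) / 2))"

text \<open>
  Off the vertical axis a single smooth formula is valid, because \<open>step\<close> is already constant where
  the line \<open>x $ 2 = x $ 1\<close> or \<open>x $ 2 = - x $ 1\<close> is crossed. The sign \<open>\<sigma>\<close> treats both half planes at
  once.
\<close>

lemma conical_step_eq_step:
  assumes "\<sigma> \<in> {-1, 1}" "\<sigma> * x $ 1 > 0"
  shows "conical_step x = step ((1 + \<sigma> * (x $ 2 * inverse (x $ 1))) * (1 / 2))"
proof -
  have abs: "\<bar>x $ 1\<bar> = \<sigma> * x $ 1" and inv: "inverse \<sigma> = \<sigma>" using assms by auto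
  have eq: "\<sigma> * (x $ 2 * inverse (x $ 1)) = x $ 2 / \<bar>x $ 1\<bar>"
    using inv by (simp add: abs divide_inverse mult_ac)
  have "x $ 1 \<noteq> 0" using assms by auto
  show ?thesis
  proof (cases "\<bar>x $ 1\<bar> < \<bar>x $ 2\<bar>")
    case True
    show ?thesis
    proof (cases "x $ 2 > 0")
      case pos: True
      then have "x $ 2 / \<bar>x $ 1\<bar> \<ge> 1" using True \<open>x $ 1 \<noteq> 0\<close> by (simp add: field_simps)
      then show ?thesis using True pos unfolding eq by (simp add: conical_step_def step_eq_1)
    next
      case False
      then have "x $ 2 / \<bar>x $ 1\<bar> \<le> -1" using True \<open>x $ 1 \<noteq> 0\<close> by (simp add: field_simps)
      then show ?thesis using True False unfolding eq by (simp add: conical_step_def step_eq_0)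
    qed
  qed (simp add: conical_step_def eq)
qed

lemma open_cone: "open {x::real^2. \<bar>x $ 1\<bar> < c * x $ 2}"
  by (intro open_Collect_less continuous_intros)

lemma open_half_plane: "open {x::real^2. \<sigma> * x $ 1 > 0}"
  by (intro open_Collect_less continuous_intros)

lemma conical_step_top: "\<bar>x $ 1\<bar> < x $ 2 \<Longrightarrow> conical_step x = 1"
  and conical_step_bottom: "\<bar>x $ 1\<bar> < - x $ 2 \<Longrightarrow> conical_step x = 0"
  by (auto simp: conical_step_def)

lemma punctured_plane_cases:
  assumes "x \<noteq> (0::real^2)"
  obtains "\<bar>x $ 1\<bar> < x $ 2" | "\<bar>x $ 1\<bar> < - x $ 2"
    | \<sigma> where "\<sigma> \<in> {-1, 1::real}" "\<sigma> * x $ 1 > 0" "\<bar>x $ 2\<bar> \<le> \<bar>x $ 1\<bar>"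
proof (cases "\<bar>x $ 1\<bar> < \<bar>x $ 2\<bar>")
  case True
  then show ?thesis using that(1,2) by (cases "x $ 2 > 0") auto
next
  case False
  then have "x $ 1 \<noteq> 0" using assms by (auto simp: vec_eq_iff forall_2)
  then show ?thesis using False that(3)[of 1] that(3)[of "-1"] by (cases "x $ 1 > 0") auto
qed

lemma gradient_conical_step_vertical:
  assumes "\<bar>x $ 1\<bar> < \<bar>x $ 2\<bar>"
  shows "gradient conical_step x = 0"
proof (rule GDERIV_imp_gradient)
  let ?c = "if x $ 2 > 0 then 1 else (0::real)" and ?s = "if x $ 2 > 0 then 1 else (-1::real)"
  have "GDERIV (\<lambda>_::real^2. ?c) x :> 0" by (rule GDERIV_const)
  then show "GDERIV conical_step x :> 0"
    by (rule GDERIV_transform_within_open[OF _ open_cone[of ?s]])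
       (use assms in \<open>auto simp: conical_step_top conical_step_bottom split: if_splits\<close>)
qed

text \<open>
  The function is homogeneous of degree \<open>0\<close>, so its gradient is homogeneous of degree \<open>- 1\<close>.
\<close>

lemma tame_conical_step: "\<exists>C. tame C conical_step"
proof -
  obtain s' B where s': "\<And>t. (step has_real_derivative s' t) (at t)" "\<And>t. \<bar>s' t\<bar> \<le> B"
    using step_has_bounded_derivative by metis
  have B: "B \<ge> 0" using s'(2)[of 0] by linarith
  have nth: "GDERIV (\<lambda>x::real^2. x $ i) x :> axis i 1" for i x
    by (simp add: gderiv_def inner_axis bounded_linear.has_derivative[OF bounded_linear_vec_nth
        has_derivative_ident])
  have "tame (1 + 2 * B) conical_step"
    unfolding tame_def
  proof (intro conjI allI impI)
    fix k
    have "\<exists>U. open U \<and> x \<in> U \<and> higher_differentiable_on k U conical_step" if x: "x \<noteq> 0" for x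
      using x
    proof (cases rule: punctured_plane_cases)
      case 1
      have "higher_differentiable_on k {x::real^2. \<bar>x $ 1\<bar> < 1 * x $ 2} conical_step"
        by (rule smooth_cong[OF open_cone _ smooth_const[of _ _ 1]])
           (simp add: conical_step_top)
      with 1 open_cone[of 1] show ?thesis
          by (intro exI[of _ "{x::real^2. \<bar>x $ 1\<bar> < 1 * x $ 2}"]) simp
    next
      case 2
      have "higher_differentiable_on k {x::real^2. \<bar>x $ 1\<bar> < (-1) * x $ 2} conical_step"
        by (rule smooth_cong[OF open_cone _ smooth_const[of _ _ 0]])
           (simp add: conical_step_bottom)
      with 2 open_cone[of "-1"] show ?thesis
          by (intro exI[of _ "{x::real^2. \<bar>x $ 1\<bar> < (-1) * x $ 2}"]) simp
    next
      case (3 \<sigma>)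
      let ?U = "{x::real^2. \<sigma> * x $ 1 > 0}"
      have "higher_differentiable_on k ?U
          (\<lambda>x. step ((1 + \<sigma> * (x $ 2 * inverse (x $ 1))) * (1 / 2)))"
        by (intro smooth_step smooth_mult smooth_add
            smooth_inverse smooth_nth smooth_const
            open_half_plane) auto
      then have "higher_differentiable_on k ?U conical_step"
        by (rule smooth_cong[OF open_half_plane, rotated])
            (use 3 in \<open>simp add: conical_step_eq_step\<close>)
      with 3 open_half_plane show ?thesis by (intro exI[of _ ?U]) simp
    qed
    then show "higher_differentiable_on k (- {0}) conical_step"
      by (intro smooth_local) simp
  next
    fix x :: "real^2" assume x: "x \<noteq> 0"
    show "\<bar>conical_step x\<bar> \<le> 1 + 2 * B"
      using B step_nonneg step_le_1 by (simp add: conical_step_def add_increasing2)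
    show "norm (gradient conical_step x) \<le> (1 + 2 * B) / norm x"
      using x
    proof (cases rule: punctured_plane_cases)
      case (3 \<sigma>)
      then have x1: "x $ 1 \<noteq> 0" by auto
      let ?q = "\<lambda>x::real^2. (1 + \<sigma> * (x $ 2 * inverse (x $ 1))) * (1 / 2)"
      let ?dq = "(\<sigma> / 2) *\<^sub>R (x $ 2 *\<^sub>R (- (inverse (x $ 1))\<^sup>2 *\<^sub>R axis 1 1) + inverse (x $ 1) *\<^sub>R
          axis 2 1) :: real^2"
      have "GDERIV ?q x :> (1 + \<sigma> * (x $ 2 * inverse (x $ 1))) *\<^sub>R 0 + (1 / 2) *\<^sub>R
          (0 + (\<sigma> *\<^sub>R (x $ 2 *\<^sub>R (- (inverse (x $ 1))\<^sup>2 *\<^sub>R axis 1 1) + inverse (x $ 1) *\<^sub>R axis 2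
              1)
          + (x $ 2 * inverse (x $ 1)) *\<^sub>R 0))"
        by (intro GDERIV_mult GDERIV_add GDERIV_const GDERIV_inverse nth x1)
      then have "GDERIV ?q x :> ?dq" by (rule GDERIV_subst) (simp add: scaleR_add_right)
      from GDERIV_DERIV_compose[OF this s'(1)]
      have "GDERIV conical_step x :> s' (?q x) *\<^sub>R ?dq"
        by (rule GDERIV_transform_within_open[OF _ open_half_plane[of \<sigma>]])
           (use 3 in \<open>simp_all add: conical_step_eq_step\<close>)
      then have "norm (gradient conical_step x) = \<bar>s' (?q x)\<bar> * norm ?dq"
        by (simp only: GDERIV_imp_gradient norm_scaleR)
      also have "\<dots> \<le> B * (1 / \<bar>x $ 1\<bar>)"
      proof (intro mult_mono s')
        have "norm ?dq \<le> (1 / 2) * (norm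
            (x $ 2 *\<^sub>R (- (inverse (x $ 1))\<^sup>2 *\<^sub>R axis 1 (1::real) :: real^2))
            + norm (inverse (x $ 1) *\<^sub>R axis 2 (1::real) :: real^2))"
          using 3 norm_triangle_ineq[of "x $ 2 *\<^sub>R (- (inverse (x $ 1))\<^sup>2 *\<^sub>R (axis 1 1 :: real^2))"
              "inverse (x $ 1) *\<^sub>R axis 2 1"] by auto
        also have "\<dots> = (1 / 2) * (\<bar>x $ 2\<bar> / \<bar>x $ 1\<bar> * (1 / \<bar>x $ 1\<bar>) + 1 / \<bar>x $ 1\<bar>)"
          by (simp add: power2_eq_square abs_mult inverse_eq_divide)
        also have "\<dots> \<le> (1 / 2) * (1 * (1 / \<bar>x $ 1\<bar>) + 1 / \<bar>x $ 1\<bar>)"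
          using 3 x1 by (intro mult_left_mono add_right_mono mult_right_mono) auto
        finally show "norm ?dq \<le> 1 / \<bar>x $ 1\<bar>" by simp
      qed (use B in auto)
      also have "\<dots> \<le> (1 + 2 * B) / norm x"
      proof -
        \<comment> \<open>In the horizontal cones \<open>\<bar>x $ 1\<bar>\<close> is comparable to \<open>norm x\<close>.\<close>
        have "norm x \<le> 2 * \<bar>x $ 1\<bar>" using norm_le_l1_cart[of x] 3 by (simp add: sum_2)
        then have "B * norm x \<le> B * (2 * \<bar>x $ 1\<bar>)" using B by (intro mult_left_mono)
        also have "\<dots> \<le> (1 + 2 * B) * \<bar>x $ 1\<bar>" by (simp add: algebra_simps)
        finally show ?thesis using x x1 by (simp add: field_simps)
      qed
      finally show ?thesis .
    qed (use B in \<open>simp_all add: gradient_conical_step_vertical\<close>)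
  qed
  then show ?thesis by blast
qed

section \<open>Cutoffs\<close>

text \<open>
  For positive \<open>c\<close> this is \<open>1\<close> on the square of half side \<open>1 / (4 * c)\<close>, with support in the square
  of half side \<open>1 / (2 * c)\<close>.
\<close>

definition cutoff :: "real \<Rightarrow> real^2 \<Rightarrow> real" where
  "cutoff c x = (\<Prod>i\<in>UNIV. step (2 - 4 * (c * x $ i)) * step (2 + 4 * (c * x $ i)))"

lemma cutoff_eq_0:
  assumes "\<bar>c * x $ i\<bar> \<ge> 1 / 2"
  shows "cutoff c x = 0"
proof -
  have "step (2 - 4 * (c * x $ i)) * step (2 + 4 * (c * x $ i)) = 0"
    using assms by (cases "c * x $ i \<ge> 0") (auto simp: step_eq_0)
  then show ?thesis unfolding cutoff_def by (intro prod_zero) auto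
qed

lemma cutoff_eq_1:
  assumes "\<And>i. \<bar>c * x $ i\<bar> \<le> 1 / 4"
  shows "cutoff c x = 1"
proof -
  have "step (2 - 4 * (c * x $ i)) * step (2 + 4 * (c * x $ i)) = 1" for i
    using assms[of i] by (simp add: step_eq_1 abs_le_iff)
  then show ?thesis unfolding cutoff_def by simp
qed

lemma cutoff_scale: "cutoff c x = cutoff 1 (c *\<^sub>R x)"
  by (simp add: cutoff_def)

lemma smooth_cutoff:
  assumes "open S" shows "higher_differentiable_on k S (cutoff c)"
  unfolding cutoff_def[abs_def]
  by (intro smooth_prod smooth_mult smooth_step
      smooth_diff smooth_add smooth_nth
      smooth_const assms)

abbreviation half_box :: "(real^2) set" where
  "half_box \<equiv> cbox (pt (-1/2) (-1/2)) (pt (1/2) (1/2))"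

lemma half_box_square: "half_box \<subseteq> square"
  by (auto simp: square_def mem_box_cart forall_2)

lemma cutoff_outside_half_box:
  assumes "c \<ge> 1" "x \<notin> half_box"
  shows "cutoff c x = 0"
proof -
  obtain i where "\<bar>x $ i\<bar> > 1 / 2" using assms(2) by (force simp: mem_box_cart forall_2)
  then have "\<bar>c * x $ i\<bar> \<ge> 1 * (1 / 2)" unfolding abs_mult using assms(1) by (intro mult_mono) auto
  then show ?thesis by (intro cutoff_eq_0[of _ _ i]) simp
qed

lemma cutoff_test_function: "c \<ge> 1 \<Longrightarrow> cutoff c \<in> test_functions square"
  by (rule test_functionsI[OF smooth_cutoff compact_cbox half_box_square])
     (auto intro: cutoff_outside_half_box)

lemma cutoff_GDERIV: "GDERIV (cutoff c) x :> gradient (cutoff c) x"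
  by (rule smooth_GDERIV[OF smooth_cutoff[OF open_UNIV]]) simp

lemma tame_cutoff: "\<exists>C. \<forall>c\<ge>1. tame C (cutoff c)"
proof -
  obtain C where C: "tame C (cutoff 1)"
    using test_function_tame[OF cutoff_test_function[of 1]] by auto
  have "tame C (cutoff c)" if c: "c \<ge> 1" for c
    unfolding tame_def
  proof (intro conjI allI impI)
    show "higher_differentiable_on k (- {0}) (cutoff c)" for k
      by (rule smooth_cutoff[OF open_punctured_plane])
  next
    fix x :: "real^2" assume "x \<noteq> 0"
    then have cx: "c *\<^sub>R x \<noteq> 0" using c by simp
    have b: "\<bar>cutoff 1 (c *\<^sub>R x)\<bar> \<le> C" "norm (gradient (cutoff 1) (c *\<^sub>R x)) \<le> C / norm (c *\<^sub>R x)"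
      using C cx unfolding tame_def by blast+
    show "\<bar>cutoff c x\<bar> \<le> C" using b(1) cutoff_scale[of c x] by simp
    have "((\<lambda>x::real^2. c *\<^sub>R x) has_derivative (\<lambda>h. c *\<^sub>R h)) (at x)"
      by (auto intro!: derivative_eq_intros)
    from has_derivative_compose[OF this cutoff_GDERIV[of 1, unfolded gderiv_def]]
    have "GDERIV (\<lambda>x. cutoff 1 (c *\<^sub>R x)) x :> c *\<^sub>R gradient (cutoff 1) (c *\<^sub>R x)"
      unfolding gderiv_def by simp
    then have "GDERIV (cutoff c) x :> c *\<^sub>R gradient (cutoff 1) (c *\<^sub>R x)"
      by (simp only: cutoff_scale[of c, symmetric])
    then have "norm (gradient (cutoff c) x) = c * norm (gradient (cutoff 1) (c *\<^sub>R x))"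
      using c by (simp add: GDERIV_imp_gradient)
    also have "\<dots> \<le> c * (C / norm (c *\<^sub>R x))" using b(2) c by (intro mult_left_mono) auto
    also have "\<dots> = C / norm x" using c by simp
    finally show "norm (gradient (cutoff c) x) \<le> C / norm x" .
  qed
  then show ?thesis by blast
qed

lemma L1_norm_weak_gradient:
  assumes "has_weak_gradient square f g"
  shows "L1_norm square (weak_gradient square f) = L1_norm square g"
  unfolding L1_norm_def
  using weak_gradient_AE_eq[OF open_square assms]
      by (intro nn_integral_cong_AE) (auto elim: eventually_mono)

text \<open>
  Removing \<open>f\<close> near the origin at scale \<open>1 / n\<close> leaves a test function. The removed part is tame
  with a constant that does not depend on \<open>n\<close>, so its gradient is dominated by a fixed multiple of
  the integrable function \<open>1 / norm x\<close>, and it lives on squares that shrink to a point.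
\<close>

lemma tame_W11_0:
  assumes f: "tame C f" and K: "compact K" "K \<subseteq> square" "\<And>x. x \<notin> K \<Longrightarrow> f x = 0"
  shows "f \<in> W11_0 square"
proof -
  obtain D where D: "\<And>c. c \<ge> 1 \<Longrightarrow> tame D (cutoff c)" using tame_cutoff by blast
  \<comment> \<open>The part to be removed; the index is shifted because cutoffs need a scale of at least \<open>1\<close>.\<close>
  define d where "d n x = cutoff (real (Suc n)) x * f x" for n x
  let ?v = "\<lambda>n x. f x - d n x"
  define E where "E = 2 * D * C"
  have d: "tame E (d n)" for n
    unfolding d_def[abs_def] E_def by (intro tame_mult D f) simp
  have v: "?v n \<in> test_functions square" for n
  proof (rule test_functionsI[OF _ K(1,2)])
    show "f x - d n x = 0" if "x \<notin> K" for x using K(3)[OF that] by (simp add: d_def)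
    fix k
    show "higher_differentiable_on k UNIV (?v n)"
    proof (rule smooth_local)
      fix x :: "real^2"
      show "\<exists>U. open U \<and> x \<in> U \<and> higher_differentiable_on k U (?v n)"
      proof (cases "x = 0")
        case False
        have "higher_differentiable_on k (- {0}) (?v n)"
          using f d[of n] unfolding tame_def by (intro smooth_diff open_punctured_plane) auto
        with False open_punctured_plane show ?thesis by (intro exI[of _ "- {0}"]) simp
      next
        case True
        let ?U = "box (pt (- 1 / (4 * real (Suc n))) (- 1 / (4 * real (Suc n))))
            (pt (1 / (4 * real (Suc n))) (1 / (4 * real (Suc n)))) :: (real^2) set"
        have one: "cutoff (real (Suc n)) y = 1" if "y \<in> ?U" for y
        proof (rule cutoff_eq_1)
          fix i
          have "\<bar>y $ i\<bar> \<le> 1 / (4 * real (Suc n))"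
            using that exhaust_2[of i] by (auto simp: mem_box_cart forall_2 abs_le_iff less_imp_le)
          then have "real (Suc n) * \<bar>y $ i\<bar> \<le> real (Suc n) * (1 / (4 * real (Suc n)))"
            by (rule mult_left_mono) simp
          also have "\<dots> = 1 / 4" by simp
          finally show "\<bar>real (Suc n) * y $ i\<bar> \<le> 1 / 4" by (simp only: abs_mult abs_of_nat)
        qed
        have "higher_differentiable_on k ?U (?v n)"
          by (rule smooth_cong[OF open_box _ smooth_const[of _ _ 0]])
             (simp only: d_def one mult_1_left diff_self)
        moreover have "x \<in> ?U" using True by (simp add: mem_box_cart forall_2)
        ultimately show ?thesis using open_box by blast
      qed
    qed
  qed
  have lim: "(\<lambda>n. \<integral>\<^sup>+x. ennreal (\<bar>d n x\<bar> + norm (gradient (d n) x)) \<partial>lebesgue_on square)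
      \<longlonglongrightarrow> (\<integral>\<^sup>+x. 0 \<partial>lebesgue_on square)"
  proof (rule nn_integral_dominated_convergence[where w="\<lambda>x. ennreal (4 * E * (1 / norm x))"])
    show "(\<lambda>x. ennreal (\<bar>d n x\<bar> + norm (gradient (d n) x))) \<in> borel_measurable
        (lebesgue_on square)" for n
      using tame_integrable[OF d[of n]]
      by (intro measurable_compose[OF _ measurable_ennreal] borel_measurable_add
          borel_measurable_abs
          measurable_compose[OF _ borel_measurable_norm] borel_measurable_integrable)
    have ae: "AE x in lebesgue_on square. x \<in> square \<and> x \<noteq> (0::real^2)"
      using AE_completion[OF AE_lborel_singleton[of "0::real^2"]]
      by (subst AE_restrict_space_iff) auto
    show "AE x in lebesgue_on square. ennreal (\<bar>d n x\<bar> + norm (gradient (d n) x))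
        \<le> ennreal (4 * E * (1 / norm x))" for n
      using ae
    proof eventually_elim
      fix x assume "x \<in> square \<and> x \<noteq> (0::real^2)"
      then have "\<bar>d n x\<bar> + norm (gradient (d n) x) \<le> 2 * E / norm x + 2 * E / norm x"
        by (intro add_mono tame_bound_on_square[OF d[of n]]) auto
      also have "\<dots> = 4 * E * (1 / norm x)" by (simp add: add_divide_distrib[symmetric])
      finally show "ennreal (\<bar>d n x\<bar> + norm (gradient (d n) x)) \<le> ennreal (4 * E * (1 / norm x))"
        by (rule ennreal_leI)
    qed
    show "(\<integral>\<^sup>+x. ennreal (4 * E * (1 / norm x)) \<partial>lebesgue_on square) < \<infinity>"
    proof -
      have E: "E \<ge> 0" by (rule tame_nonneg[OF d[of 0]])
      have "(\<integral>\<^sup>+x. ennreal (4 * E * (1 / norm x)) \<partial>lebesgue_on square)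
        = (\<integral>\<^sup>+x. ennreal (norm (4 * E * (indicator square x * (1 / norm x))))
            \<partial>(lborel :: (real^2) measure))"
        unfolding nn_integral_lebesgue_on_square using E
        by (intro nn_integral_cong) (auto simp: indicator_def abs_mult)
      also have "\<dots> < \<infinity>"
        using integrable_mult_right[OF integrable_inverse_norm_square, of "4 * E"]
        unfolding integrable_iff_bounded by blast
      finally show ?thesis .
    qed
    show "AE x in lebesgue_on square. (\<lambda>n. ennreal (\<bar>d n x\<bar> + norm (gradient (d n) x))) \<longlonglongrightarrow> 0"
      using ae
    proof eventually_elim
      fix x assume x: "x \<in> square \<and> x \<noteq> (0::real^2)"
      then obtain i where "x $ i \<noteq> 0" by (auto simp: vec_eq_iff)
      obtain N where N: "1 / \<bar>x $ i\<bar> < real N" using reals_Archimedean2 by blast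
      have "d n x = 0 \<and> gradient (d n) x = 0" if "n \<ge> N" for n
      proof -
        let ?U = "{y::real^2. 1 / 2 < \<bar>real (Suc n) * y $ i\<bar>}"
        have op: "open ?U" by (intro open_Collect_less continuous_intros)
        have "1 / \<bar>x $ i\<bar> < real (Suc n)" using N that by linarith
        then have "1 < real (Suc n) * \<bar>x $ i\<bar>"
            using \<open>x $ i \<noteq> 0\<close> pos_divide_less_eq[of "\<bar>x $ i\<bar>" 1 "real (Suc n)"] by simp
        then have xU: "x \<in> ?U" by (simp only: mem_Collect_eq abs_mult abs_of_nat)
        have zero: "d n y = 0" if "y \<in> ?U" for y
          using that cutoff_eq_0[of "real (Suc n)" y i] by (simp add: d_def less_imp_le)
        have "GDERIV (\<lambda>_::real^2. 0::real) x :> 0" by (rule GDERIV_const)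
        then have "GDERIV (d n) x :> 0"
          by (rule GDERIV_transform_within_open[OF _ op xU]) (simp add: zero)
        with zero[OF xU] show ?thesis by (simp add: GDERIV_imp_gradient)
      qed
      then have "\<forall>\<^sub>F n in sequentially. ennreal (\<bar>d n x\<bar> + norm (gradient (d n) x)) = 0"
        by (auto simp: eventually_sequentially intro!: exI[of _ N])
      then show "(\<lambda>n. ennreal (\<bar>d n x\<bar> + norm (gradient (d n) x))) \<longlonglongrightarrow> 0" by (rule tendsto_eventually)
    qed
  qed (auto intro!: borel_imp_lebesgue_on)
  have norm: "W11_norm square (d n) = (\<integral>\<^sup>+x. ennreal (\<bar>d n x\<bar> + norm (gradient (d n) x))
      \<partial>lebesgue_on square)" for n
  proof -
    have "(\<integral>\<^sup>+x. ennreal (\<bar>d n x\<bar> + norm (gradient (d n) x)) \<partial>lebesgue_on square)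
      = (\<integral>\<^sup>+x. ennreal (norm (d n x)) + ennreal (norm (gradient (d n) x)) \<partial>lebesgue_on square)"
      by (intro nn_integral_cong) (simp add: ennreal_plus)
    also have "\<dots> = L1_norm square (d n) + L1_norm square (gradient (d n))"
      unfolding L1_norm_def
      using tame_integrable[OF d[of n]]
      by (intro nn_integral_add measurable_compose[OF _ measurable_ennreal]
          measurable_compose[OF _ borel_measurable_norm] borel_measurable_integrable)
    finally show ?thesis
      by (simp add: W11_norm_def L1_norm_weak_gradient[OF tame_has_weak_gradient[OF d]])
  qed
  show ?thesis
    unfolding W11_0_def norm_closure_def
  proof (intro CollectI conjI allI impI)
    show "f \<in> W11 square" by (rule tame_W11[OF f])
    fix \<epsilon> :: ennreal assume "0 < \<epsilon>"
    then have "\<forall>\<^sub>F n in sequentially. W11_norm square (d n) < \<epsilon>"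
      using order_tendstoD(2)[OF lim, of \<epsilon>] by (simp add: norm)
    then obtain n where "W11_norm square (d n) < \<epsilon>" by (auto simp: eventually_sequentially)
    moreover have "(\<lambda>x. f x - ?v n x) = d n" by auto
    ultimately show "\<exists>v\<in>test_functions square. W11_norm square (\<lambda>x. f x - v x) < \<epsilon>"
      using v[of n] by (intro bexI[of _ "?v n"]) simp_all
  qed
qed

section \<open>The pairing with the ray field\<close>

lemma integral_lebesgue_on_square:
  fixes h :: "real^2 \<Rightarrow> real"
  assumes [measurable]: "h \<in> borel_measurable borel"
  shows "(\<integral>x. h x \<partial>lebesgue_on square) = (\<integral>x. indicator square x * h x \<partial>lborel)"
proof -
  have "(\<integral>x. h x \<partial>lebesgue_on square) = (\<integral>x. indicator square x *\<^sub>R h x \<partial>lebesgue)"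
    by (intro integral_restrict_space) simp
  also have "\<dots> = (\<integral>x. indicator square x *\<^sub>R h x \<partial>lborel)"
    by (intro integral_completion) measurable
  finally show ?thesis by simp
qed

text \<open>
  On the full square every line runs from boundary to boundary, and the increments of \<open>f\<close> vanish.
  On the upper half each line starts at the origin and contributes \<open>- f 0\<close>; the lines are indexed
  by an interval of length \<open>2\<close>.
\<close>

lemma ray_field_pairing:
  assumes der: "\<And>x. GDERIV f x :> g x" and cont: "continuous_on UNIV g"
    and zero: "\<And>x. x \<notin> square \<Longrightarrow> f x = 0" "\<And>x. x \<notin> square \<Longrightarrow> g x = 0"
  shows "(\<integral>x. ray_field x \<bullet> g x \<partial>lebesgue_on square) = 0"
    and "(\<integral>x. indicator {x. x $ 2 > 0} x * (ray_field x \<bullet> g x) \<partial>lebesgue_on square) = - 2 * f 0"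
proof -
  have [measurable]: "g \<in> borel_measurable borel"
    using cont by (rule borel_measurable_continuous_onI)
  have out: "f (pt t s) = 0" if "\<bar>s\<bar> \<ge> 1" for t s
    using that by (intro zero) (auto simp: square_def forall_2 abs_if split: if_splits)
  have pt0: "pt 0 0 = 0" by (simp add: vec_eq_iff forall_2)
  have "(\<integral>x. ray_field x \<bullet> g x \<partial>lebesgue_on square)
      = (\<integral>x. indicator square x * (ray_field x \<bullet> g x) \<partial>lborel)"
    by (rule integral_lebesgue_on_square) measurable
  also have "\<dots> = (\<integral>x. indicator {x. x $ 2 \<in> {-1..1}} x * (ray_field x \<bullet> g x) \<partial>lborel)"
  proof (intro Bochner_Integration.integral_cong refl)
    fix x :: "real^2"
    show "indicator square x * (ray_field x \<bullet> g x)
        = indicator {x. x $ 2 \<in> {-1..1}} x * (ray_field x \<bullet> g x)"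
      using zero(2)[of x] by (cases "x \<in> square") (auto simp: indicator_def square_def forall_2)
  qed
  also have "\<dots> = (\<integral>\<tau>. indicator {-1<..<1} \<tau> * (f (pt (\<tau> * 1) 1) - f (pt (\<tau> * (-1)) (-1))) \<partial>lborel)"
    by (intro integral_ray_field_gradient der cont) auto
  also have "\<dots> = 0" by (simp add: out)
  finally show "(\<integral>x. ray_field x \<bullet> g x \<partial>lebesgue_on square) = 0" .
  have "(\<integral>x. indicator {x. x $ 2 > 0} x * (ray_field x \<bullet> g x) \<partial>lebesgue_on square)
      = (\<integral>x. indicator square x * (indicator {x. x $ 2 > 0} x * (ray_field x \<bullet> g x)) \<partial>lborel)"
    by (rule integral_lebesgue_on_square) measurable
  also have "\<dots> = (\<integral>x. indicator {x. x $ 2 \<in> {0..1}} x * (ray_field x \<bullet> g x) \<partial>lborel)"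
  proof (intro Bochner_Integration.integral_cong refl)
    fix x :: "real^2"
    show "indicator square x * (indicator {x. x $ 2 > 0} x * (ray_field x \<bullet> g x))
        = indicator {x. x $ 2 \<in> {0..1}} x * (ray_field x \<bullet> g x)"
    proof (cases "x \<in> square \<and> x $ 2 \<noteq> 0")
      case True
      then have "x $ 2 < 1" by (simp add: square_def)
      with True show ?thesis by (cases "x $ 2 > 0") (auto simp: indicator_def)
    next
      case False
      then have "ray_field x \<bullet> g x = 0" using zero(2)[of x] by (auto simp: ray_field_def)
      then show ?thesis by simp
    qed
  qed
  also have "\<dots> = (\<integral>\<tau>. indicator {-1<..<1} \<tau> * (f (pt (\<tau> * 1) 1) - f (pt (\<tau> * 0) 0)) \<partial>lborel)"
    by (intro integral_ray_field_gradient der cont) auto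
  also have "\<dots> = (\<integral>\<tau>. indicator {-1<..<1::real} \<tau> * (- f 0) \<partial>lborel)" by (simp add: out pt0)
  also have "\<dots> = - 2 * f 0" by simp
  finally show "(\<integral>x. indicator {x. x $ 2 > 0} x * (ray_field x \<bullet> g x) \<partial>lebesgue_on square)
      = - 2 * f 0" .
qed

abbreviation "\<eta> \<equiv> cutoff 1"

lemma eta_continuous: "continuous_on UNIV \<eta>" "continuous_on UNIV (gradient \<eta>)"
  and eta_zero: "x \<notin> square \<Longrightarrow> \<eta> x = 0" "x \<notin> square \<Longrightarrow> gradient \<eta> x = 0"
proof -
  obtain K where K: "K \<subseteq> square" "\<And>x. x \<notin> K \<Longrightarrow> \<eta> x = 0" "\<And>x. x \<notin> K \<Longrightarrow> gradient \<eta> x = 0"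
    and cont: "continuous_on UNIV \<eta>" "continuous_on UNIV (gradient \<eta>)"
    using test_function_gradientE[OF cutoff_test_function[OF order_refl]] by metis
  show "continuous_on UNIV \<eta>" "continuous_on UNIV (gradient \<eta>)" by (rule cont)+
  show "x \<notin> square \<Longrightarrow> \<eta> x = 0" "x \<notin> square \<Longrightarrow> gradient \<eta> x = 0" using K by blast+
qed

lemma eta_measurable [measurable]: "\<eta> \<in> borel_measurable borel"
    "gradient \<eta> \<in> borel_measurable borel"
  using eta_continuous by (auto intro: borel_measurable_continuous_onI)

lemma eta_0: "\<eta> 0 = 1"
  by (rule cutoff_eq_1) simp

lemma eta_bounds: "\<bar>\<eta> x\<bar> \<le> 1"
proof -
  have "0 \<le> \<eta> x" "\<eta> x \<le> 1"
    unfolding cutoff_def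
    by (auto intro!: prod_nonneg prod_le_1 mult_nonneg_nonneg mult_le_one step_nonneg step_le_1)
  then show ?thesis by simp
qed

lemma gradient_eta_bounded: obtains M where "M \<ge> 0" "\<And>x. norm (gradient \<eta> x) \<le> M"
proof -
  obtain M where M: "M \<ge> 0" "\<And>x. x \<in> cbox (pt (-1) (-1)) (pt 1 1) \<Longrightarrow> norm (gradient \<eta> x) \<le> M"
    using continuous_UNIV_bounded_on_compact[OF eta_continuous(2) compact_cbox] by metis
  have "norm (gradient \<eta> x) \<le> M" for x
  proof (cases "x \<in> square")
    case True
    then show ?thesis by (intro M) (auto simp: square_def mem_box_cart forall_2 less_imp_le)
  qed (simp add: eta_zero M(1))
  then show ?thesis using that M(1) by blast
qed

lemma gradient_eta_near_0:
  assumes "\<And>i. \<bar>x $ i\<bar> < 1 / 4"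
  shows "gradient \<eta> x = 0"
proof (rule GDERIV_imp_gradient)
  let ?U = "box (pt (- (1/4)) (- (1/4))) (pt (1/4) (1/4)) :: (real^2) set"
  have "GDERIV (\<lambda>_::real^2. 1::real) x :> 0" by (rule GDERIV_const)
  then show "GDERIV \<eta> x :> 0"
  proof (rule GDERIV_transform_within_open[OF _ open_box])
    show "x \<in> ?U" using assms[of 1] assms[of 2] by (auto simp: mem_box_cart forall_2)
    fix y assume "y \<in> ?U"
    then have "\<bar>1 * y $ i\<bar> \<le> 1 / 4" for i
      using exhaust_2[of i] by (auto simp: mem_box_cart forall_2 abs_le_iff)
    then show "1 = \<eta> y" by (rule cutoff_eq_1[symmetric])
  qed
qed

text \<open>
  The cutoff is constant near the origin, which is the only place where the field is unbounded.
\<close>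

lemma ray_field_gradient_eta_bounded:
  obtains M where "M \<ge> 0" "\<And>x. \<bar>ray_field x \<bullet> gradient \<eta> x\<bar> \<le> M"
proof -
  obtain M where M: "M \<ge> 0" "\<And>x. norm (gradient \<eta> x) \<le> M" using gradient_eta_bounded by blast
  have "\<bar>ray_field x \<bullet> gradient \<eta> x\<bar> \<le> 8 * M" for x
  proof (cases "\<bar>x $ 1\<bar> < \<bar>x $ 2\<bar> \<and> \<bar>x $ 2\<bar> \<ge> 1 / 4")
    case True
    \<comment> \<open>The field has norm at most \<open>2 / \<bar>x $ 2\<bar>\<close>.\<close>
    then have "1 / \<bar>x $ 2\<bar> \<le> 1 / (1 / 4)" by (intro frac_le) auto
    then have "2 * (1 / \<bar>x $ 2\<bar>) \<le> 8" by simp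
    with norm_ray_field_le[of x] have "norm (ray_field x) \<le> 8" by linarith
    then have "norm (ray_field x) * norm (gradient \<eta> x) \<le> 8 * M" using M by (intro mult_mono) auto
    with Cauchy_Schwarz_ineq2[of "ray_field x" "gradient \<eta> x"] show ?thesis by linarith
  next
    case False
    then have "ray_field x \<bullet> gradient \<eta> x = 0"
    proof (cases "\<bar>x $ 1\<bar> < \<bar>x $ 2\<bar>")
      case True
      with False have "\<bar>x $ i\<bar> < 1 / 4" for i using exhaust_2[of i] by auto
      then show ?thesis by (simp add: gradient_eta_near_0)
    qed (simp add: ray_field_def)
    then show ?thesis using M(1) by simp
  qed
  then show ?thesis using that[of "8 * M"] M(1) by simp
qed

lemma ray_field_lebesgue: "ray_field \<in> borel_measurable (lebesgue_on square)"
  and ray_field_gradient_eta_lebesgue: "(\<lambda>x. ray_field x \<bullet> gradient \<eta> x) \<in> borel_measurable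
      (lebesgue_on square)"
  and eta_lebesgue: "\<eta> \<in> borel_measurable (lebesgue_on square)"
  by (rule borel_imp_lebesgue_on, measurable)+

lemma W11_weak_gradient:
  assumes "w \<in> W11 square"
  shows "has_weak_gradient square w (weak_gradient square w)"
    and "integrable (lebesgue_on square) (weak_gradient square w)"
    and "integrable (lebesgue_on square) w"
    and "weak_gradient square w \<in> borel_measurable (lebesgue_on square)"
  using assms has_weak_gradient_weak_gradient integrable_weak_gradient[OF open_square]
  unfolding W11_def by (blast dest: borel_measurable_integrable)+

lemma W11_diff: "w \<in> W11 square \<Longrightarrow> v \<in> W11 square \<Longrightarrow> (\<lambda>x. w x - v x) \<in> W11 square"
  unfolding W11_def
  using has_weak_gradient_diff[OF open_square] Bochner_Integration.integrable_diff by blast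

lemma test_function_W11:
  assumes "v \<in> test_functions square"
  shows "v \<in> W11 square" "has_weak_gradient square v (gradient v)"
  using test_function_tame[OF assms] tame_W11 tame_has_weak_gradient by blast+

lemma integrable_ray_field_inner:
  fixes g :: "real^2 \<Rightarrow> real^2"
  assumes cont: "continuous_on UNIV g"
  shows "integrable (lebesgue_on square) (\<lambda>x. ray_field x \<bullet> g x)"
proof (rule integrable_lebesgue_on_squareI)
  have "square \<subseteq> {x::real^2. \<bar>x $ 2\<bar> \<le> 1}"
      by (auto simp: square_def abs_le_iff less_imp_le minus_le_iff)
  then show "integrable lborel (\<lambda>x. indicator square x *\<^sub>R (ray_field x \<bullet> g x))"
    using integrable_ray_field_inner_lborel[OF cont square_borel] by simp
qed

lemma le_zero_if_le_all_multiples: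
  fixes a C :: real
  assumes C: "C \<ge> 0" and le: "\<And>\<epsilon>. \<epsilon> > 0 \<Longrightarrow> a \<le> 0 + C * \<epsilon>"
  shows "a \<le> 0"
proof (rule field_le_epsilon)
  fix e :: real assume "e > 0"
  then have "a \<le> C * (e / (C + 1))" using le[of "e / (C + 1)"] C by simp
  also have "\<dots> \<le> e" using C \<open>e > 0\<close> by (simp add: field_simps)
  finally show "a \<le> 0 + e" by simp
qed

lemma continuous_on_open_cover_2:
  assumes "open S" "open T" "continuous_on S f" "continuous_on T f" "S \<union> T = UNIV"
  shows "continuous_on UNIV f"
  using continuous_on_open_Un[OF assms(1-4)] assms(5) by simp

context competing_phases
begin

lemma ray_field_functional_bound:
  fixes g :: "real^2 \<Rightarrow> real^2" and \<theta> :: "real^2 \<Rightarrow> real"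
  assumes g: "g \<in> borel_measurable (lebesgue_on square)" and \<epsilon>: "\<epsilon> > 0"
    and norm: "luxemburg_norm square \<Phi> g < ennreal \<epsilon>"
    and \<theta>: "\<theta> \<in> borel_measurable borel" "\<And>x. \<bar>\<theta> x\<bar> \<le> 1"
  shows "integrable (lebesgue_on square) (\<lambda>x. \<theta> x * (ray_field x \<bullet> g x))" (is ?int)
    and "\<bar>\<integral>x. \<theta> x * (ray_field x \<bullet> g x) \<partial>lebesgue_on square\<bar> \<le> ray_const * \<epsilon>" (is ?bound)
proof -
  let ?h = "\<lambda>x. \<theta> x * (ray_field x \<bullet> g x)"
  have "(\<integral>\<^sup>+x. ennreal (norm (?h x)) \<partial>lebesgue_on square)
      \<le> (\<integral>\<^sup>+x. norm (ray_field x) * norm (g x) \<partial>lebesgue_on square)"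
  proof (intro nn_integral_mono ennreal_leI)
    fix x
    have "norm (?h x) \<le> 1 * (norm (ray_field x) * norm (g x))"
      unfolding real_norm_def abs_mult
      using \<theta>(2)[of x] Cauchy_Schwarz_ineq2[of "ray_field x" "g x"] by (intro mult_mono) auto
    then show "norm (?h x) \<le> norm (ray_field x) * norm (g x)" by simp
  qed
  also note ray_field_hoelder[OF g \<epsilon> norm]
  finally have bound: "(\<integral>\<^sup>+x. ennreal (norm (?h x)) \<partial>lebesgue_on square)
      \<le> ennreal (ray_const * \<epsilon>)" .
  have int: "integrable (lebesgue_on square) ?h"
  proof (rule integrableI_bounded)
    show "?h \<in> borel_measurable (lebesgue_on square)"
      using g borel_imp_lebesgue_on[OF \<theta>(1)]
          by (intro borel_measurable_times borel_measurable_inner ray_field_lebesgue)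
    show "(\<integral>\<^sup>+x. ennreal (norm (?h x)) \<partial>lebesgue_on square) < \<infinity>"
      using bound by (rule le_less_trans) simp
  qed
  have "ennreal (norm (integral\<^sup>L (lebesgue_on square) ?h)) \<le> ennreal (ray_const * \<epsilon>)"
    using integral_norm_bound_ennreal[OF int] bound by (rule order_trans)
  then have "norm (integral\<^sup>L (lebesgue_on square) ?h) \<le> ray_const * \<epsilon>"
    using ray_const_nonneg \<epsilon> by (simp add: ennreal_le_iff)
  with int show ?int ?bound by simp_all
qed

text \<open>
  The pairing vanishes on test functions and is continuous by \<open>ray_field_functional_bound\<close>.
\<close>

lemma H1_0_pairing_zero:
  assumes w: "w \<in> H1_0 square \<Phi>"
  shows "(\<integral>x. ray_field x \<bullet> weak_gradient square w x \<partial>lebesgue_on square) = 0"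
proof -
  have wW: "w \<in> W11 square"
    and approx: "\<And>\<epsilon>. \<epsilon> > 0 \<Longrightarrow> \<exists>v\<in>test_functions square. luxemburg_norm square \<Phi>
        (weak_gradient square (\<lambda>x. w x - v x)) < \<epsilon>"
    using w by (auto simp: H1_0_def W1_0_def W11_0_def W1_0_norm_def norm_closure_def)
  let ?I = "\<integral>x. ray_field x \<bullet> weak_gradient square w x \<partial>lebesgue_on square"
  have "\<bar>?I\<bar> \<le> 0 + ray_const * \<epsilon>" if \<epsilon>: "\<epsilon> > 0" for \<epsilon>
  proof -
    obtain v where v: "v \<in> test_functions square"
      and norm: "luxemburg_norm square \<Phi> (weak_gradient square (\<lambda>x. w x - v x)) < ennreal \<epsilon>"
      using approx[of "ennreal \<epsilon>"] \<epsilon> by auto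
    let ?d = "weak_gradient square (\<lambda>x. w x - v x)"
    note vW = test_function_W11[OF v]
    have dm: "?d \<in> borel_measurable (lebesgue_on square)"
      by (rule W11_weak_gradient(4)[OF W11_diff[OF wW vW(1)]])
    have C': "integrable (lebesgue_on square) (\<lambda>x. ray_field x \<bullet> ?d x)"
        "\<bar>\<integral>x. ray_field x \<bullet> ?d x \<partial>lebesgue_on square\<bar> \<le> ray_const * \<epsilon>"
      using ray_field_functional_bound[OF dm \<epsilon> norm, of "\<lambda>_. 1"] by simp_all
    obtain K where v': "K \<subseteq> square" "\<And>x. x \<notin> K \<Longrightarrow> v x = 0" "\<And>x. x \<notin> K \<Longrightarrow> gradient v x = 0"
      "\<And>x. GDERIV v x :> gradient v x" "continuous_on UNIV (gradient v)"
      using test_function_gradientE[OF v] by metis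
    have v0: "(\<integral>x. ray_field x \<bullet> gradient v x \<partial>lebesgue_on square) = 0"
      by (rule ray_field_pairing(1)[OF v'(4,5)]) (use v'(1-3) in blast)+
    have ae: "AE x in lebesgue_on square. ray_field x \<bullet> ?d x
        = ray_field x \<bullet> weak_gradient square w x - ray_field x \<bullet> gradient v x"
      using weak_gradient_diff_AE_eq[OF open_square wW vW(1)]
          weak_gradient_AE_eq[OF open_square vW(2)]
      by eventually_elim (simp add: inner_diff_right)
    have gv: "integrable (lebesgue_on square) (\<lambda>x. ray_field x \<bullet> gradient v x)"
      by (rule integrable_ray_field_inner[OF v'(5)])
    have "?I = (\<integral>x. ray_field x \<bullet> ?d x + ray_field x \<bullet> gradient v x \<partial>lebesgue_on square)"
    proof (rule integral_cong_AE)
      show "(\<lambda>x. ray_field x \<bullet> weak_gradient square w x) \<in> borel_measurable (lebesgue_on square)"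
        by (intro borel_measurable_inner ray_field_lebesgue W11_weak_gradient(4)[OF wW])
    qed (use ae C'(1) gv in \<open>auto elim: eventually_mono\<close>)
    also have "\<dots> = (\<integral>x. ray_field x \<bullet> ?d x \<partial>lebesgue_on square)" using C'(1) gv v0 by simp
    finally show ?thesis using C'(2) by simp
  qed
  then have "\<bar>?I\<bar> \<le> 0" by (rule le_zero_if_le_all_multiples[OF ray_const_nonneg])
  then show ?thesis by simp
qed

text \<open>
  Functions in \<open>H1\<close> carry no boundary condition, so the pairing is localized: the integrand is
  formally the pairing with the gradient of \<open>\<eta> * w\<close>. For smooth \<open>w\<close> that product has compact
  support. The first summand is continuous in the gradient of \<open>w\<close>, the second one in \<open>w\<close> itself
  with respect to the \<open>L1\<close> norm.
\<close>

lemma H1_pairing_zero: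
  assumes w: "w \<in> H1 square \<Phi>"
  shows "(\<integral>x. \<eta> x * (ray_field x \<bullet> weak_gradient square w x) + w x * (ray_field x \<bullet> gradient \<eta> x)
      \<partial>lebesgue_on square) = 0"
proof -
  obtain M where M: "M \<ge> 0" "\<And>x. \<bar>ray_field x \<bullet> gradient \<eta> x\<bar> \<le> M"
    using ray_field_gradient_eta_bounded by blast
  have wW: "w \<in> W11 square"
    and approx: "\<And>\<epsilon>. \<epsilon> > 0 \<Longrightarrow> \<exists>v\<in>smooth_functions square \<inter> W1 square \<Phi>.
        L1_norm square (\<lambda>x. w x - v x) + luxemburg_norm square \<Phi>
            (weak_gradient square (\<lambda>x. w x - v x)) < \<epsilon>"
    using w by (auto simp: H1_def W1_def W1_norm_def norm_closure_def)
  let ?h = "\<lambda>x. \<eta> x * (ray_field x \<bullet> weak_gradient square w x) + w x * (ray_field x \<bullet> gradient \<eta> x)"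
  let ?I = "\<integral>x. ?h x \<partial>lebesgue_on square"
  have "\<bar>?I\<bar> \<le> 0 + (ray_const + M) * \<epsilon>" if \<epsilon>: "\<epsilon> > 0" for \<epsilon>
  proof -
    obtain v where v: "v \<in> smooth_functions square" and vW: "v \<in> W11 square"
      and sum: "L1_norm square (\<lambda>x. w x - v x) + luxemburg_norm square \<Phi>
          (weak_gradient square (\<lambda>x. w x - v x)) < ennreal \<epsilon>"
      using approx[of "ennreal \<epsilon>"] \<epsilon> by (auto simp: W1_def)
    have norm: "luxemburg_norm square \<Phi> (weak_gradient square (\<lambda>x. w x - v x)) < ennreal \<epsilon>"
      and L1: "L1_norm square (\<lambda>x. w x - v x) < ennreal \<epsilon>"
      using sum by (auto intro: le_less_trans[rotated])
    let ?d = "weak_gradient square (\<lambda>x. w x - v x)"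
    have dW: "(\<lambda>x. w x - v x) \<in> W11 square" by (rule W11_diff[OF wW vW])
    have C': "integrable (lebesgue_on square) (\<lambda>x. \<eta> x * (ray_field x \<bullet> ?d x))"
        "\<bar>\<integral>x. \<eta> x * (ray_field x \<bullet> ?d x) \<partial>lebesgue_on square\<bar> \<le> ray_const * \<epsilon>"
      using ray_field_functional_bound[OF W11_weak_gradient(4)[OF dW] \<epsilon> norm eta_measurable(1)
          eta_bounds] by simp_all
    have int_d: "integrable (lebesgue_on square) (\<lambda>x. (w x - v x) * (ray_field x \<bullet> gradient \<eta> x))"
    proof (rule Bochner_Integration.integrable_bound)
      show "integrable (lebesgue_on square) (\<lambda>x. M * (w x - v x))"
        by (intro integrable_mult_right W11_weak_gradient(3)[OF dW])
      show "(\<lambda>x. (w x - v x) * (ray_field x \<bullet> gradient \<eta> x)) \<in> borel_measurable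
          (lebesgue_on square)"
        by (intro borel_measurable_times borel_measurable_integrable[OF W11_weak_gradient(3)[OF dW]]
            ray_field_gradient_eta_lebesgue)
      have "norm ((w x - v x) * (ray_field x \<bullet> gradient \<eta> x)) \<le> norm (M * (w x - v x))" for x
        using mult_left_mono[OF M(2)[of x], of "\<bar>w x - v x\<bar>"] M(1)
            by (simp add: abs_mult mult.commute)
      then show "AE x in lebesgue_on square.
          norm ((w x - v x) * (ray_field x \<bullet> gradient \<eta> x)) \<le> norm (M * (w x - v x))" by simp
    qed
    have bound_d: "\<bar>\<integral>x. (w x - v x) * (ray_field x \<bullet> gradient \<eta> x) \<partial>lebesgue_on square\<bar> \<le> M * \<epsilon>"
    proof -
      have "ennreal (norm (\<integral>x. (w x - v x) * (ray_field x \<bullet> gradient \<eta> x) \<partial>lebesgue_on square))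
        \<le> (\<integral>\<^sup>+x. ennreal (norm ((w x - v x) * (ray_field x \<bullet> gradient \<eta> x))) \<partial>lebesgue_on square)"
        by (rule integral_norm_bound_ennreal[OF int_d])
      also have "\<dots> \<le> (\<integral>\<^sup>+x. ennreal M * ennreal (norm (w x - v x)) \<partial>lebesgue_on square)"
      proof (rule nn_integral_mono)
        fix x
        show "ennreal (norm ((w x - v x) * (ray_field x \<bullet> gradient \<eta> x)))
            \<le> ennreal M * ennreal (norm (w x - v x))"
          using mult_left_mono[OF M(2)[of x], of "\<bar>w x - v x\<bar>"] M(1)
          by (simp add: abs_mult mult.commute ennreal_mult[symmetric] ennreal_leI)
      qed
      also have "\<dots> = ennreal M * L1_norm square (\<lambda>x. w x - v x)"
        unfolding L1_norm_def using W11_weak_gradient(3)[OF dW]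
        by (intro nn_integral_cmult measurable_compose[OF _ measurable_ennreal]
            measurable_compose[OF _ borel_measurable_norm] borel_measurable_integrable)
      also have "\<dots> \<le> ennreal M * ennreal \<epsilon>" using L1 by (intro mult_left_mono) auto
      also have "\<dots> = ennreal (M * \<epsilon>)" using M(1) \<epsilon> by (simp add: ennreal_mult)
      finally show ?thesis using M(1) \<epsilon> by (simp add: ennreal_le_iff)
    qed
    note smooth = smooth_function_has_weak_gradient[OF v]
    let ?F = "\<lambda>x. if x \<in> square then \<eta> x * v x else 0"
    define G where "G x = (if x \<in> square then \<eta> x *\<^sub>R gradient v x + v x *\<^sub>R gradient \<eta> x else 0)"
        for x
    have F0: "?F x = 0" if "x \<notin> half_box" for x using that by (simp add: cutoff_outside_half_box)
    have derF: "GDERIV ?F x :> G x" for x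
    proof (cases "x \<in> square")
      case True
      have "GDERIV (\<lambda>x. \<eta> x * v x) x :> G x"
        using GDERIV_mult[OF cutoff_GDERIV smooth(2)[OF True]] True by (simp add: G_def)
      then show ?thesis by (rule GDERIV_transform_within_open[OF _ open_square True]) simp
    next
      case False
      have "GDERIV (\<lambda>_::real^2. 0::real) x :> 0" by (rule GDERIV_const)
      then have "GDERIV ?F x :> 0"
        by (rule GDERIV_transform_within_open[where S="- half_box"])
           (use False half_box_square F0 in \<open>auto simp: open_Compl\<close>)
      then show ?thesis using False by (simp add: G_def)
    qed
    have G0: "G x = 0" if "x \<notin> half_box" for x
    proof (rule trans[OF GDERIV_imp_gradient[OF derF, symmetric] GDERIV_imp_gradient])
      have "GDERIV (\<lambda>_::real^2. 0::real) x :> 0" by (rule GDERIV_const)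
      then show "GDERIV ?F x :> 0"
        by (rule GDERIV_transform_within_open[where S="- half_box"])
           (use that F0 in \<open>auto simp: open_Compl\<close>)
    qed
    have contG: "continuous_on UNIV G"
    proof (rule continuous_on_open_cover_2[OF open_square, of "- half_box"])
      show "continuous_on square G"
      proof (rule continuous_on_cong[THEN iffD2, OF refl])
        show "continuous_on square (\<lambda>x. \<eta> x *\<^sub>R gradient v x + v x *\<^sub>R gradient \<eta> x)"
          by (intro continuous_intros smooth continuous_on_subset[OF eta_continuous(1)]
              continuous_on_subset[OF eta_continuous(2)]) auto
      qed (simp add: G_def)
      show "continuous_on (- half_box) G"
        by (rule continuous_on_cong[THEN iffD2, OF refl _ continuous_on_const[of _ 0]])
            (simp add: G0)
    qed (use half_box_square in \<open>auto simp: open_Compl\<close>)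
    have intG: "integrable (lebesgue_on square) (\<lambda>x. ray_field x \<bullet> G x)"
      by (rule integrable_ray_field_inner[OF contG])
    have I0: "(\<integral>x. ray_field x \<bullet> G x \<partial>lebesgue_on square) = 0"
      by (rule ray_field_pairing(1)[OF derF contG]) (auto simp: G_def)
    \<comment> \<open>The error terms are small by the two continuity estimates, and the last term integrates to
        zero.\<close>
    have ae: "AE x in lebesgue_on square. ?h x
        = (\<eta> x * (ray_field x \<bullet> ?d x) + (w x - v x) * (ray_field x \<bullet> gradient \<eta> x)) + ray_field x
            \<bullet> G x"
      using weak_gradient_diff_AE_eq[OF open_square wW vW]
          weak_gradient_AE_eq[OF open_square smooth(1)]
        AE_space[of "lebesgue_on square"]
    proof eventually_elim
      fix x assume "weak_gradient square (\<lambda>x. w x - v x) x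
          = weak_gradient square w x - weak_gradient square v x"
        and "weak_gradient square v x = gradient v x" and "x \<in> space (lebesgue_on square)"
      then have "weak_gradient square w x = ?d x + gradient v x" and "x \<in> square"
        by (simp_all add: space_restrict_space)
      then show "?h x = (\<eta> x * (ray_field x \<bullet> ?d x) + (w x - v x) * (ray_field x \<bullet> gradient \<eta> x))
          + ray_field x \<bullet> G x"
        by (simp add: G_def inner_add_right algebra_simps)
    qed
    have "?I = (\<integral>x. (\<eta> x * (ray_field x \<bullet> ?d x) + (w x - v x) * (ray_field x \<bullet> gradient \<eta> x)) +
        ray_field x \<bullet> G x
        \<partial>lebesgue_on square)"
    proof (rule integral_cong_AE[OF _ _ ae])
      show "?h \<in> borel_measurable (lebesgue_on square)"
        by (intro borel_measurable_add borel_measurable_times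
            borel_measurable_inner[OF ray_field_lebesgue]
            ray_field_gradient_eta_lebesgue eta_lebesgue W11_weak_gradient(4)[OF wW]
            borel_measurable_integrable[OF W11_weak_gradient(3)[OF wW]])
    qed (use C'(1) int_d intG in auto)
    also have "\<dots> = (\<integral>x. \<eta> x * (ray_field x \<bullet> ?d x) \<partial>lebesgue_on square)
        + (\<integral>x. (w x - v x) * (ray_field x \<bullet> gradient \<eta> x) \<partial>lebesgue_on square)"
      using C'(1) int_d intG I0 by simp
    finally show ?thesis using C'(2) bound_d by (simp add: algebra_simps)
  qed
  then have "\<bar>?I\<bar> \<le> 0"
    by (rule le_zero_if_le_all_multiples[OF add_nonneg_nonneg[OF ray_const_nonneg M(1)]])
  then show ?thesis by simp
qed

end

section \<open>The competitor and the gap\<close>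

context competing_phases
begin

definition singular :: "real \<Rightarrow> real^2 \<Rightarrow> real" where
  "singular l x = l * (\<eta> x * conical_step x)"

lemma tame_singular: "\<exists>C. tame C (singular l)"
proof -
  obtain A B where "tame A \<eta>" "tame B conical_step"
    using tame_cutoff tame_conical_step by blast
  then show ?thesis unfolding singular_def[abs_def] using tame_cmult tame_mult by blast
qed

lemma gradient_singular_vertical:
  assumes "\<bar>x $ 1\<bar> < \<bar>x $ 2\<bar>"
  shows "gradient (singular l) x = (l * indicator {x. x $ 2 > 0} x) *\<^sub>R gradient \<eta> x"
proof -
  have "x \<noteq> 0" using assms by auto
  obtain B where B: "tame B conical_step" using tame_conical_step by blast
  have "GDERIV (singular l) x :>
      l *\<^sub>R (\<eta> x *\<^sub>R gradient conical_step x + conical_step x *\<^sub>R gradient \<eta> x) +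
          (\<eta> x * conical_step x) *\<^sub>R 0"
    unfolding singular_def[abs_def]
    by (intro GDERIV_mult GDERIV_const cutoff_GDERIV tame_GDERIV[OF B \<open>x \<noteq> 0\<close>])
  then show ?thesis
    using assms by (simp add: GDERIV_imp_gradient gradient_conical_step_vertical conical_step_def
        indicator_def)
qed

text \<open>
  In the vertical cone the competitor is \<open>l * \<eta>\<close> above and \<open>0\<close> below the origin, so only the upper
  halves of the lines contribute to the pairing.
\<close>

lemma ray_field_singular:
  "ray_field x \<bullet> gradient (singular l) x
      = l * (indicator {x. x $ 2 > 0} x * (ray_field x \<bullet> gradient \<eta> x))"
  by (cases "\<bar>x $ 1\<bar> < \<bar>x $ 2\<bar>") (simp_all add: gradient_singular_vertical ray_field_def)

lemma ray_field_singular_value: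
  "singular l x * (ray_field x \<bullet> gradient \<eta> x)
    = l * (indicator {x. x $ 2 > 0} x * (\<eta> x * (ray_field x \<bullet> gradient \<eta> x)))"
  by (cases "\<bar>x $ 1\<bar> < \<bar>x $ 2\<bar>") (auto simp: singular_def conical_step_def ray_field_def
      indicator_def)

lemma singular_pairing:
  "(\<integral>x. ray_field x \<bullet> gradient (singular l) x \<partial>lebesgue_on square) = - 2 * l"
  unfolding ray_field_singular
  using ray_field_pairing(2)[OF cutoff_GDERIV eta_continuous(2) eta_zero] by (simp add: eta_0)

lemma singular_localized_pairing:
  "(\<integral>x. \<eta> x * (ray_field x \<bullet> gradient (singular l) x) + singular l x * (ray_field x \<bullet> gradient \<eta> x)
      \<partial>lebesgue_on square) = - 2 * l"
proof -
  let ?f = "\<lambda>x. \<eta> x * \<eta> x" and ?g = "\<lambda>x. \<eta> x *\<^sub>R gradient \<eta> x + \<eta> x *\<^sub>R gradient \<eta> x"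
  have "(\<integral>x. indicator {x. x $ 2 > 0} x * (ray_field x \<bullet> ?g x) \<partial>lebesgue_on square) = - 2 * ?f 0"
  proof (rule ray_field_pairing(2)[OF GDERIV_mult[OF cutoff_GDERIV cutoff_GDERIV]])
    show "continuous_on UNIV ?g"
      by (intro continuous_on_add continuous_on_scaleR eta_continuous)
    show "?f x = 0" "?g x = 0" if "x \<notin> square" for x using eta_zero[OF that] by simp_all
  qed
  moreover have "\<eta> x * (ray_field x \<bullet> gradient (singular l) x) + singular l x *
      (ray_field x \<bullet> gradient \<eta> x)
      = l * (indicator {x. x $ 2 > 0} x * (ray_field x \<bullet> ?g x))" for x
    unfolding ray_field_singular ray_field_singular_value inner_add_right inner_scaleR_right
    by (simp only: algebra_simps)
  ultimately show ?thesis by (simp add: eta_0)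
qed

lemma singular_W11_0: "singular l \<in> W11_0 square"
proof -
  obtain C where "tame C (singular l)" using tame_singular by blast
  then show ?thesis
    by (rule tame_W11_0[OF _ compact_cbox half_box_square])
        (simp add: singular_def cutoff_outside_half_box)
qed

text \<open>
  The factor \<open>l\<close> normalizes the constant in the gradient bound to \<open>1\<close>, so that the convergence
  hypothesis on \<open>\<phi> (1 / r)\<close> applies directly.
\<close>

lemma norm_gradient_singular:
  obtains l where "l > 0" "\<And>x. x \<noteq> 0 \<Longrightarrow> norm (gradient (singular l) x) \<le> 1 / norm x"
    "\<And>x. \<bar>x $ 1\<bar> < \<bar>x $ 2\<bar> \<Longrightarrow> norm (gradient (singular l) x) \<le> 1"
proof -
  obtain C where C: "tame C (singular 1)" using tame_singular by blast
  obtain M where M: "M \<ge> 0" "\<And>x. norm (gradient \<eta> x) \<le> M" using gradient_eta_bounded by blast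
  have C0: "C \<ge> 0" by (rule tame_nonneg[OF C])
  define l where "l = 1 / (1 + C + M)"
  have l: "l > 0" "l * C \<le> 1" "l * M \<le> 1" using C0 M(1) by (auto simp: l_def field_simps)
  have "tame (\<bar>l\<bar> * C) (singular l)"
    using tame_cmult[OF C, of l] by (simp add: singular_def[abs_def])
  then have "tame 1 (singular l)" by (rule tame_mono) (use l in simp)
  moreover have "norm (gradient (singular l) x) \<le> 1" if "\<bar>x $ 1\<bar> < \<bar>x $ 2\<bar>" for x
  proof -
    have "norm (gradient (singular l) x) \<le> l * norm (gradient \<eta> x)"
      using l by (simp add: gradient_singular_vertical[OF that] indicator_def)
    also have "\<dots> \<le> l * M" using l M by (intro mult_left_mono) auto
    finally show ?thesis using l by simp
  qed
  ultimately show ?thesis using l(1) by (intro that[of l]) (auto simp: tame_def)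
qed

lemma Phi_gradient_le_primal_bound:
  assumes "\<And>x. x \<noteq> 0 \<Longrightarrow> norm (G x) \<le> 1 / norm x" "\<And>x. \<bar>x $ 1\<bar> < \<bar>x $ 2\<bar> \<Longrightarrow> norm (G x) \<le> 1"
    and x: "x \<in> square" "x \<noteq> 0"
  shows "\<Phi> x (norm (G x :: real^2)) \<le> primal_bound x"
proof (cases "\<bar>x $ 1\<bar> < \<bar>x $ 2\<bar>")
  case True
  then have "\<Phi> x (norm (G x)) \<le> \<Phi> x 1" by (intro Phi_mono assms) auto
  also have "\<dots> = \<phi> 1 + \<psi> 1" using True by (simp add: double_phase_def weight_def)
  also have "\<dots> \<le> primal_bound x" by (simp add: primal_bound_def)
  finally show ?thesis .
next
  case False
  then have x1: "x $ 1 \<noteq> 0" using x(2) by (auto simp: vec_eq_iff forall_2)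
  have "norm (G x) \<le> 1 / norm x" using assms(1) x(2) by simp
  also have "\<dots> \<le> 1 / \<bar>x $ 1\<bar>" using abs_nth_le_norm[of x 1] x1 by (intro frac_le) auto
  finally have "\<phi> (norm (G x)) \<le> \<phi> (1 / \<bar>x $ 1\<bar>)" by (intro orlicz_function_mono orlicz) auto
  moreover have "\<bar>x $ 1\<bar> \<le> 1" using x(1)
      by (auto simp: square_def abs_le_iff less_imp_le minus_le_iff)
  ultimately show ?thesis
    using False by (simp add: double_phase_def weight_def primal_bound_def add_increasing2)
qed

text \<open>
  The competitor separates the spaces because both pairings take the value \<open>- 2 * l\<close> on it. In the
  energy the pairing is scaled until it outweighs the modular of the competitor; on \<open>H1_0\<close> only the
  nonnegative modular remains.
\<close>

lemma lavrentiev: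
  "H1 square \<Phi> \<noteq> W1 square \<Phi> \<and> H1_0 square \<Phi> \<noteq> W1_0 square \<Phi> \<and>
    (\<exists>b :: real^2 \<Rightarrow> real^2. b \<in> orlicz_space square (\<lambda>x. orlicz_conj (\<Phi> x)) \<and>
      (INF u\<in>W1_0 square \<Phi>. energy square \<Phi> b u) < (INF u\<in>H1_0 square \<Phi>. energy square \<Phi> b u))"
proof -
  obtain l where l: "l > 0" "\<And>x. x \<noteq> 0 \<Longrightarrow> norm (gradient (singular l) x) \<le> 1 / norm x"
    "\<And>x. \<bar>x $ 1\<bar> < \<bar>x $ 2\<bar> \<Longrightarrow> norm (gradient (singular l) x) \<le> 1"
    using norm_gradient_singular by blast
  let ?u = "singular l" and ?W = "weak_gradient square (singular l)"
  obtain C where C: "tame C ?u" using tame_singular by blast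
  have uW: "?u \<in> W11 square" by (rule tame_W11[OF C])
  have W: "AE x in lebesgue_on square. ?W x = gradient ?u x"
    by (rule weak_gradient_AE_eq[OF open_square tame_has_weak_gradient[OF C]])
  have ae: "AE x in lebesgue_on square. x \<in> square \<and> x \<noteq> (0::real^2)"
    using AE_completion[OF AE_lborel_singleton[of "0::real^2"]]
        by (subst AE_restrict_space_iff) auto
  have le: "AE x in lebesgue_on square. \<Phi> x (norm (?W x)) \<le> primal_bound x"
    using W ae
  proof eventually_elim
    fix x assume "?W x = gradient ?u x" "x \<in> square \<and> x \<noteq> 0"
    then show "\<Phi> x (norm (?W x)) \<le> primal_bound x"
      using Phi_gradient_le_primal_bound[OF l(2,3), of x] by simp
  qed
  have "luxemburg_norm square \<Phi> ?W < \<infinity>"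
    by (rule luxemburg_norm_finite[where c=1 and h=primal_bound])
       (use le primal_bound_finite Phi_scale in \<open>auto intro: borel_imp_lebesgue_on\<close>)
  then have orl: "?W \<in> orlicz_space square \<Phi>"
    using W11_weak_gradient(4)[OF uW] by (simp add: orlicz_space_def)
  have uW1: "?u \<in> W1 square \<Phi>" and uW10: "?u \<in> W1_0 square \<Phi>"
    using orl uW singular_W11_0 by (auto simp: W1_def W1_0_def)
  note Wm = W11_weak_gradient(4)[OF uW]
    and Gm = borel_measurable_integrable[OF tame_integrable(2)[OF C]]
    and um = borel_measurable_integrable[OF tame_integrable(1)[OF C]]
  have pair: "(\<integral>x. ray_field x \<bullet> ?W x \<partial>lebesgue_on square) = - 2 * l"
  proof -
    have "(\<integral>x. ray_field x \<bullet> ?W x \<partial>lebesgue_on square)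
        = (\<integral>x. ray_field x \<bullet> gradient ?u x \<partial>lebesgue_on square)"
      by (intro integral_cong_AE borel_measurable_inner ray_field_lebesgue Wm Gm)
          (use W in \<open>auto elim: eventually_mono\<close>)
    then show ?thesis by (simp add: singular_pairing)
  qed
  have pair': "(\<integral>x. \<eta> x * (ray_field x \<bullet> ?W x) + ?u x * (ray_field x \<bullet> gradient \<eta> x) \<partial>lebesgue_on
      square) = - 2 * l"
  proof -
    have "(\<integral>x. \<eta> x * (ray_field x \<bullet> ?W x) + ?u x * (ray_field x \<bullet> gradient \<eta> x) \<partial>lebesgue_on square)
      = (\<integral>x. \<eta> x * (ray_field x \<bullet> gradient ?u x) + ?u x * (ray_field x \<bullet> gradient \<eta> x)
          \<partial>lebesgue_on square)"
      by (intro integral_cong_AE borel_measurable_add borel_measurable_times eta_lebesgue um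
          borel_measurable_inner ray_field_lebesgue ray_field_gradient_eta_lebesgue Wm Gm
          borel_imp_lebesgue_on[OF eta_measurable(2)]) (use W in \<open>auto elim: eventually_mono\<close>)
    then show ?thesis by (simp add: singular_localized_pairing)
  qed
  have notH1: "?u \<notin> H1 square \<Phi>" using H1_pairing_zero[of ?u] pair' l(1) by auto
  have notH1_0: "?u \<notin> H1_0 square \<Phi>" using H1_0_pairing_zero[of ?u] pair l(1) by auto
  define m where "m = enn2real (\<integral>\<^sup>+x. \<Phi> x (norm (?W x)) \<partial>lebesgue_on square)"
  have "(\<integral>\<^sup>+x. \<Phi> x (norm (?W x)) \<partial>lebesgue_on square) < \<infinity>"
    using nn_integral_mono_AE[OF le] primal_bound_finite by (rule le_less_trans)
  then have m: "(\<integral>\<^sup>+x. \<Phi> x (norm (?W x)) \<partial>lebesgue_on square) = ennreal m" "m \<ge> 0"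
    by (auto simp: m_def)
  \<comment> \<open>This multiple makes the energy of the competitor equal to \<open>- 1\<close>.\<close>
  define s where "s = (m + 1) / (2 * l)"
  let ?b = "\<lambda>x. s *\<^sub>R ray_field x"
  have "energy square \<Phi> ?b ?u = ereal m + ereal (s * (- 2 * l))"
    using m by (simp add: energy_def pair)
  also have "s * (- 2 * l) = - (m + 1)" using l(1) by (simp add: s_def)
  finally have "energy square \<Phi> ?b ?u < 0" by simp
  then have "(INF u\<in>W1_0 square \<Phi>. energy square \<Phi> ?b u) < 0"
    using INF_lower[OF uW10, of "energy square \<Phi> ?b"] by (rule le_less_trans[rotated])
  also have "0 \<le> (INF u\<in>H1_0 square \<Phi>. energy square \<Phi> ?b u)"
  proof (rule INF_greatest)
    fix w assume "w \<in> H1_0 square \<Phi>"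
    then show "0 \<le> energy square \<Phi> ?b w"
      by (simp add: energy_def H1_0_pairing_zero)
  qed
  finally have "(INF u\<in>W1_0 square \<Phi>. energy square \<Phi> ?b u) <
      (INF u\<in>H1_0 square \<Phi>. energy square \<Phi> ?b u)" .
  then show ?thesis using notH1 notH1_0 uW1 uW10 ray_field_in_dual_space[of s] by blast
qed

end

theorem theorem17:
  fixes \<phi> \<psi> :: "real \<Rightarrow> ennreal"
    and p_minus p_plus c1 c2 :: real
  assumes "orlicz_function \<phi>" and "orlicz_function \<psi>"
    and "Delta2 \<phi>" and "Nabla2 \<phi>" and "Delta2 \<psi>" and "Nabla2 \<psi>"
    and "1 < p_minus" and "p_minus < p_plus" and "c1 > 0"
    and "\<And>t. t \<ge> 0 \<Longrightarrow> ennreal (t powr p_minus) \<le> \<phi> t"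
    and "\<And>t. t \<ge> 0 \<Longrightarrow> \<phi> t \<le> ennreal (c1 * t powr p_plus + c2)"
    and "\<And>t. t \<ge> 0 \<Longrightarrow> ennreal (t powr p_minus) \<le> \<psi> t"
    and "\<And>t. t \<ge> 0 \<Longrightarrow> \<psi> t \<le> ennreal (c1 * t powr p_plus + c2)"
    and "\<exists>c3\<ge>0. \<exists>c4\<ge>0. \<forall>t\<ge>0. \<phi> t \<le> ennreal c3 * \<psi> t + ennreal c4"
    and "((\<lambda>t. \<phi> t / \<psi> t) \<longlongrightarrow> 0) at_top"
    and "converges_at_0 (\<lambda>r. \<phi> (1 / r) * ennreal r)"
    and "converges_at_0 (\<lambda>r. orlicz_conj \<psi> (1 / r) * ennreal r)"
  shows "H1 square (double_phase \<phi> \<psi>) \<noteq> W1 square (double_phase \<phi> \<psi>) \<and>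
         H1_0 square (double_phase \<phi> \<psi>) \<noteq> W1_0 square (double_phase \<phi> \<psi>) \<and>
         (\<exists>b :: real^2 \<Rightarrow> real^2.
            b \<in> orlicz_space square (\<lambda>x. orlicz_conj (double_phase \<phi> \<psi> x)) \<and>
            (INF u\<in>W1_0 square (double_phase \<phi> \<psi>). energy square (double_phase \<phi> \<psi>) b u)
              < (INF u\<in>H1_0 square (double_phase \<phi> \<psi>). energy square (double_phase \<phi> \<psi>) b u))"
proof -
  interpret competing_phases \<phi> \<psi>
  proof
    show "\<phi> t < \<infinity>" if "t \<ge> 0" for t
      using assms(11)[OF that] by (rule le_less_trans) simp
    show "\<psi> t < \<infinity>" if "t \<ge> 0" for t
      using assms(13)[OF that] by (rule le_less_trans) simp
  qed (use assms in simp_all)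
  show ?thesis by (rule lavrentiev)
qed

end
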